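(* Let $k$ be an algebraically closed field, $Q$ a finite connected quiver without oriented cycles which is not Dynkin, with vertices $1,\dots,n$, let $\Lambda$ be the completion of the preprojective algebra of $Q$ over $k$, and let $W$ be the Coxeter group associated to $Q$ with generators $s_1,\dots,s_n$. Let $I_i=\Lambda(1-e_i)\Lambda$ and let $\langle I_1,\dots,I_n\rangle$ be the set of all finite products of the ideals $I_1,\dots,I_n$ (including the empty product $\Lambda$). Then there exists a bijection $W\to\langle I_1,\dots,I_n\rangle$, given by $w\mapsto I_w=I_{i_1}I_{i_2}\cdots I_{i_k}$ for any reduced expression $w=s_{i_1}s_{i_2}\cdots s_{i_k}$.
   Context: Preprojective algebra: let $\widetilde Q$ be obtained from $Q$ by adding an arrow $\alpha^*\colon i\to j$ for each arrow $\alpha\colon j\to i$ of $Q$; the preprojective algebra is $k\widetilde Q/(\sum_{\beta\in Q_1}[\beta,\beta^*])$, and $\Lambda$ is its completion with respect to the ideal generated by the arrows. $e_i$ is the idempotent at vertex $i$. The Coxeter group $W$ has generators $s_1,\dots,s_n$ and relations $s_i^2=1$; $s_is_j=s_js_i$ if there is no arrow between $i$ and $j$ in $Q$; $s_is_js_i=s_js_is_j$ if there is precisely one arrow between $i$ and $j$ in $Q$. An expression $w=s_{i_1}\cdots s_{i_k}$ is reduced if $k$ is minimal. *)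

theory Defs
  imports
    "HOL-Computational_Algebra.Polynomial"
    "HOL-Algebra.QuotRing"
    "HOL-Algebra.Ideal_Product"
    "Graph_Theory.Graph_Theory"
begin

section \<open>Quivers\<close>

text \<open>
  A quiver is a \<^typ>\<open>('v, 'a) pre_digraph\<close>; parallel arcs are allowed. An arrow
  \<open>a : i \<rightarrow> j\<close> has \<open>tail Q a = i\<close> and \<open>head Q a = j\<close>.
\<close>

definition num_arrows :: "('v, 'a) pre_digraph \<Rightarrow> 'v \<Rightarrow> 'v \<Rightarrow> nat" where
  "num_arrows Q i j = card {a \<in> arcs Q.
     (tail Q a = i \<and> head Q a = j) \<or> (tail Q a = j \<and> head Q a = i)}"

definition has_diagram :: "('v, 'a) pre_digraph \<Rightarrow> nat \<Rightarrow> nat set set \<Rightarrow> bool" where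
  "has_diagram Q n E \<longleftrightarrow> (\<exists>f. bij_betw f {1..n} (verts Q) \<and>
     (\<forall>i\<in>{1..n}. \<forall>j\<in>{1..n}.
        num_arrows Q (f i) (f j) = (if {i, j} \<in> E then 1 else 0)))"

text \<open>Edge sets, on the vertices \<open>1, \<dots>, n\<close>, of the diagrams of type A, D and E.\<close>

definition edges_A :: "nat \<Rightarrow> nat set set" where
  "edges_A n = {{i, i + 1} | i. 1 \<le> i \<and> i < n}"

definition edges_D :: "nat \<Rightarrow> nat set set" where
  "edges_D n = edges_A (n - 1) \<union> {{n - 2, n}}"

definition edges_E :: "nat \<Rightarrow> nat set set" where
  "edges_E n = edges_A (n - 1) \<union> {{3, n}}"

definition dynkin :: "('v, 'a) pre_digraph \<Rightarrow> bool" where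
  "dynkin Q \<longleftrightarrow>
     (\<exists>n\<ge>1. has_diagram Q n (edges_A n)) \<or>
     (\<exists>n\<ge>4. has_diagram Q n (edges_D n)) \<or>
     (\<exists>n\<in>{6, 7, 8}. has_diagram Q n (edges_E n))"

text \<open>\<open>Inl a\<close> is the arrow \<open>a\<close> of \<open>Q\<close>, and \<open>Inr a\<close> is the added arrow \<open>a\<^sup>*\<close>.\<close>

definition double_quiver :: "('v, 'a) pre_digraph \<Rightarrow> ('v, 'a + 'a) pre_digraph" where
  "double_quiver Q = \<lparr> verts = verts Q, arcs = arcs Q <+> arcs Q,
     tail = case_sum (tail Q) (head Q), head = case_sum (head Q) (tail Q) \<rparr>"


section \<open>Path algebras\<close>

text \<open>
  A path is a pair of its starting vertex and its list of arrows, so that \<open>(i, [])\<close> is the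
  trivial path at \<open>i\<close>. Elements of the path algebra are finitely supported functions on
  paths. Paths are concatenated from left to right: \<open>p q\<close> is \<open>p\<close> followed by \<open>q\<close>, and is zero
  if \<open>q\<close> does not start where \<open>p\<close> ends. The coefficient of a path in a product is thus the
  sum over all its splittings into two paths.
\<close>

type_synonym ('v, 'a) path = "'v \<times> 'a list"

definition paths :: "('v, 'a) pre_digraph \<Rightarrow> ('v, 'a) path set" where
  "paths G = {(u, p). \<exists>v. pre_digraph.awalk G u p v}"

definition path_algebra :: "('v, 'a) pre_digraph \<Rightarrow> (('v, 'a) path \<Rightarrow> 'k :: field) ring" where
  "path_algebra G =
    \<lparr> carrier = {f. finite {x. f x \<noteq> 0} \<and> {x. f x \<noteq> 0} \<subseteq> paths G},
      mult = (\<lambda>f g (u, p). \<Sum>i\<le>length p.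
        f (u, take i p) * g (last (pre_digraph.awalk_verts G u (take i p)), drop i p)),
      one = (\<lambda>(u, p). if u \<in> verts G \<and> p = [] then 1 else 0),
      zero = (\<lambda>_. 0),
      add = (\<lambda>f g x. f x + g x) \<rparr>"

definition path_elem :: "('v, 'a) path \<Rightarrow> ('v, 'a) path \<Rightarrow> 'k :: field" where
  "path_elem p = (\<lambda>q. if q = p then 1 else 0)"

definition arrow_elem :: "('v, 'a) pre_digraph \<Rightarrow> 'a \<Rightarrow> ('v, 'a) path \<Rightarrow> 'k :: field" where
  "arrow_elem G a = path_elem (tail G a, [a])"


section \<open>Adic completion\<close>

definition ideal_power :: "('r, 'm) ring_scheme \<Rightarrow> 'r set \<Rightarrow> nat \<Rightarrow> 'r set" where
  "ideal_power R J m = (ideal_prod R J ^^ m) (carrier R)"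

text \<open>
  The inverse limit of the rings \<open>R / J\<^sup>m\<close>. The elements of \<open>R / J\<^sup>m\<close> are cosets of \<open>J\<^sup>m\<close>, and
  the transition map sends a coset of \<open>J\<^sup>m\<^sup>+\<^sup>1\<close> to the coset of \<open>J\<^sup>m\<close> that contains it.
\<close>

definition adic_completion :: "('r, 'm) ring_scheme \<Rightarrow> 'r set \<Rightarrow> (nat \<Rightarrow> 'r set) ring" where
  "adic_completion R J =
    \<lparr> carrier = {x. \<forall>m. x m \<in> carrier (R Quot ideal_power R J m) \<and> x (Suc m) \<subseteq> x m},
      mult = (\<lambda>x y m. x m \<otimes>\<^bsub>R Quot ideal_power R J m\<^esub> y m),
      one = (\<lambda>m. \<one>\<^bsub>R Quot ideal_power R J m\<^esub>),
      zero = (\<lambda>m. \<zero>\<^bsub>R Quot ideal_power R J m\<^esub>),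
      add = (\<lambda>x y m. x m \<oplus>\<^bsub>R Quot ideal_power R J m\<^esub> y m) \<rparr>"

definition to_completion :: "('r, 'm) ring_scheme \<Rightarrow> 'r set \<Rightarrow> 'r \<Rightarrow> nat \<Rightarrow> 'r set" where
  "to_completion R J r = (\<lambda>m. ideal_power R J m +>\<^bsub>R\<^esub> r)"


section \<open>The completed preprojective algebra and its ideals\<close>

type_synonym ('v, 'a, 'k) double_path_elem = "('v, 'a + 'a) path \<Rightarrow> 'k"

definition preprojective_relation ::
    "('v, 'a) pre_digraph \<Rightarrow> ('v, 'a, 'k :: field) double_path_elem" where
  "preprojective_relation Q =
    (let R = path_algebra (double_quiver Q);
         x = (\<lambda>b. arrow_elem (double_quiver Q) (Inl b));
         x' = (\<lambda>b. arrow_elem (double_quiver Q) (Inr b))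
     in \<Oplus>\<^bsub>R\<^esub>b\<in>arcs Q. (x b \<otimes>\<^bsub>R\<^esub> x' b) \<ominus>\<^bsub>R\<^esub> (x' b \<otimes>\<^bsub>R\<^esub> x b))"

definition preprojective_ideal ::
    "('v, 'a) pre_digraph \<Rightarrow> ('v, 'a, 'k :: field) double_path_elem set" where
  "preprojective_ideal Q = Idl\<^bsub>path_algebra (double_quiver Q)\<^esub> {preprojective_relation Q}"

definition preprojective_algebra ::
    "('v, 'a) pre_digraph \<Rightarrow> ('v, 'a, 'k :: field) double_path_elem set ring" where
  "preprojective_algebra Q = path_algebra (double_quiver Q) Quot preprojective_ideal Q"

definition to_preprojective ::
    "('v, 'a) pre_digraph \<Rightarrow> ('v, 'a, 'k :: field) double_path_elem
      \<Rightarrow> ('v, 'a, 'k) double_path_elem set" where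
  "to_preprojective Q x = preprojective_ideal Q +>\<^bsub>path_algebra (double_quiver Q)\<^esub> x"

definition arrow_ideal ::
    "('v, 'a) pre_digraph \<Rightarrow> ('v, 'a, 'k :: field) double_path_elem set set" where
  "arrow_ideal Q = Idl\<^bsub>preprojective_algebra Q\<^esub>
     ((\<lambda>a. to_preprojective Q (arrow_elem (double_quiver Q) a)) ` arcs (double_quiver Q))"

type_synonym ('v, 'a, 'k) completed_elem = "nat \<Rightarrow> ('v, 'a, 'k) double_path_elem set set"

definition completed_preprojective_algebra ::
    "('v, 'a) pre_digraph \<Rightarrow> ('v, 'a, 'k :: field) completed_elem ring" where
  "completed_preprojective_algebra Q =
     adic_completion (preprojective_algebra Q) (arrow_ideal Q)"

definition vertex_idempotent ::
    "('v, 'a) pre_digraph \<Rightarrow> 'v \<Rightarrow> ('v, 'a, 'k :: field) completed_elem" where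
  "vertex_idempotent Q i = to_completion (preprojective_algebra Q) (arrow_ideal Q)
     (to_preprojective Q (path_elem (i, [])))"

definition vertex_ideal ::
    "('v, 'a) pre_digraph \<Rightarrow> 'v \<Rightarrow> ('v, 'a, 'k :: field) completed_elem set" where
  "vertex_ideal Q i =
    (let L = completed_preprojective_algebra Q
     in Idl\<^bsub>L\<^esub> {\<one>\<^bsub>L\<^esub> \<ominus>\<^bsub>L\<^esub> vertex_idempotent Q i})"

definition ideal_word ::
    "('v, 'a) pre_digraph \<Rightarrow> 'v list \<Rightarrow> ('v, 'a, 'k :: field) completed_elem set" where
  "ideal_word Q is =
    (let L = completed_preprojective_algebra Q
     in foldr (\<lambda>i J. ideal_prod L (vertex_ideal Q i) J) is (carrier L))"

definition ideal_products ::
    "('v, 'a) pre_digraph \<Rightarrow> ('v, 'a, 'k :: field) completed_elem set set" where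
  "ideal_products Q = ideal_word Q ` lists (verts Q)"


section \<open>Groups given by generators and relations\<close>

text \<open>
  Words in the generators and their formal inverses: \<open>(g, True)\<close> stands for \<open>g\<close> and
  \<open>(g, False)\<close> for its inverse.
\<close>

type_synonym 'g gword = "('g \<times> bool) list"

inductive presented_eq :: "'g set \<Rightarrow> ('g gword \<times> 'g gword) set \<Rightarrow> 'g gword \<Rightarrow> 'g gword \<Rightarrow> bool"
  for S :: "'g set" and R :: "('g gword \<times> 'g gword) set"
where
  pres_refl: "x \<in> lists (S \<times> UNIV) \<Longrightarrow> presented_eq S R x x"
| pres_sym: "presented_eq S R x y \<Longrightarrow> presented_eq S R y x"
| pres_trans: "presented_eq S R x y \<Longrightarrow> presented_eq S R y z \<Longrightarrow> presented_eq S R x z"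
| pres_append: "presented_eq S R x y \<Longrightarrow> presented_eq S R x' y' \<Longrightarrow>
    presented_eq S R (x @ x') (y @ y')"
| pres_inverse: "g \<in> S \<Longrightarrow> presented_eq S R [(g, b), (g, \<not> b)] []"
| pres_relation: "(x, y) \<in> R \<Longrightarrow> presented_eq S R x y"

definition presented_group ::
    "'g set \<Rightarrow> ('g gword \<times> 'g gword) set \<Rightarrow> 'g gword set monoid" where
  "presented_group S R =
    \<lparr> carrier = lists (S \<times> UNIV) // {(x, y). presented_eq S R x y},
      mult = (\<lambda>X Y. \<Union>x\<in>X. \<Union>y\<in>Y. Collect (presented_eq S R (x @ y))),
      one = Collect (presented_eq S R []) \<rparr>"

definition presented_gen :: "'g set \<Rightarrow> ('g gword \<times> 'g gword) set \<Rightarrow> 'g \<Rightarrow> 'g gword set" where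
  "presented_gen S R g = Collect (presented_eq S R [(g, True)])"


section \<open>The Coxeter group of a quiver\<close>

definition coxeter_relations :: "('v, 'a) pre_digraph \<Rightarrow> ('v gword \<times> 'v gword) set" where
  "coxeter_relations Q =
    (let s = (\<lambda>i. (i, True)) in
      {([s i, s i], []) | i. i \<in> verts Q} \<union>
      {([s i, s j], [s j, s i]) | i j. i \<in> verts Q \<and> j \<in> verts Q \<and> num_arrows Q i j = 0} \<union>
      {([s i, s j, s i], [s j, s i, s j]) | i j.
         i \<in> verts Q \<and> j \<in> verts Q \<and> num_arrows Q i j = 1})"

definition coxeter_group :: "('v, 'a) pre_digraph \<Rightarrow> 'v gword set monoid" where
  "coxeter_group Q = presented_group (verts Q) (coxeter_relations Q)"

definition coxeter_gen :: "('v, 'a) pre_digraph \<Rightarrow> 'v \<Rightarrow> 'v gword set" where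
  "coxeter_gen Q i = presented_gen (verts Q) (coxeter_relations Q) i"

definition expression :: "('v, 'a) pre_digraph \<Rightarrow> 'v list \<Rightarrow> 'v gword set \<Rightarrow> bool" where
  "expression Q is w \<longleftrightarrow> is \<in> lists (verts Q) \<and>
     w = foldr (\<lambda>i x. coxeter_gen Q i \<otimes>\<^bsub>coxeter_group Q\<^esub> x) is \<one>\<^bsub>coxeter_group Q\<^esub>"

definition reduced_expression :: "('v, 'a) pre_digraph \<Rightarrow> 'v list \<Rightarrow> 'v gword set \<Rightarrow> bool" where
  "reduced_expression Q is w \<longleftrightarrow>
     expression Q is w \<and> (\<forall>js. expression Q js w \<longrightarrow> length is \<le> length js)"

end

theory Submission
  imports Defs "HOL-Library.Function_Algebras"
begin

text \<open>
  On the left ideals of \<open>\<Lambda>\<close>, multiplication by \<open>I\<^sub>i\<close> is an operator \<open>D\<^sub>i\<close> with right adjoint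
  \<open>U\<^sub>i\<close>, where \<open>U\<^sub>i J\<close> consists of the elements that \<open>I\<^sub>i\<close> multiplies into \<open>J\<close>. The operators \<open>D\<^sub>i\<close>
  are idempotent and satisfy the braid relations of \<open>W\<close>, so that every product of the ideals
  \<open>I\<^sub>i\<close> is given by a word that cannot be shortened by braid moves and \<open>i i \<rightarrow> i\<close>.

  The key point concerns two vertices: if \<open>U\<^sub>i J = J = U\<^sub>j J\<close>, then \<open>U\<^sub>i\<close> also fixes
  \<open>D\<^sub>j D\<^sub>i D\<^sub>j \<dots> J\<close> as long as the number of factors is smaller than the order of \<open>s\<^sub>i s\<^sub>j\<close>.
  This only uses that every linear relation \<open>\<Sum> a u\<^sub>a = 0\<close> over the arrows at a vertex is a
  multiple of the preprojective relation. It follows that \<open>U\<^sub>i\<close> fixes the ideal of such a word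
  unless a braid move brings \<open>i\<close> to the front of the word. Since \<open>U\<^sub>i D\<^sub>i J = J\<close> whenever
  \<open>U\<^sub>i J = J\<close>, first letters can be cancelled, and words with equal ideals are related by braid
  moves. Sending \<open>J\<close> to \<open>D\<^sub>i J\<close> if \<open>U\<^sub>i J = J\<close> and to \<open>U\<^sub>i J\<close> otherwise defines an action of \<open>W\<close> on
  the products of ideals, and the bijection is the orbit map of \<open>\<Lambda>\<close>.
\<close>

section \<open>Words up to braid moves\<close>

text \<open>The obstacle is the form of \<Lambda>: an inverse limit of quotients of a quotient,
  whose elements are sequences of sets of cosets. Ideals are therefore replaced by their preimages
  in the type of all functions on paths, where the set \<open>null\<close> takes the place of zero.
  The preprojective relation is homogeneous of degree two, so membership in \<open>null\<close> is
  tested degree by degree, and the statement about linear relations passes from polynomials to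
  series. In these terms I_i consists of the series without constant term at i. As a right ideal it
  is generated by the other idempotents and the arrows leaving i, which gives the formula for
  \<open>D\<close>; as a left ideal it is generated by the other idempotents and the arrows entering
  i, which gives the formula for \<open>U\<close>. Since \<open>U\<close> detects which letters can
  be moved to the front of a word, the ideals themselves supply the solution of the word problem in
  W.\<close>

fun altw :: "'v \<Rightarrow> 'v \<Rightarrow> nat \<Rightarrow> 'v list" where
  "altw i j 0 = []"
| "altw i j (Suc r) = i # altw j i r"

text \<open>\<open>below_order q r\<close> says that \<open>r\<close> is smaller than the order of \<open>s\<^sub>i s\<^sub>j\<close>, where \<open>q\<close> is
  the number of arrows between \<open>i\<close> and \<open>j\<close>.\<close>

definition below_order :: "nat \<Rightarrow> nat \<Rightarrow> bool" where
  "below_order q r \<longleftrightarrow> (q = 0 \<longrightarrow> r < 2) \<and> (q = 1 \<longrightarrow> r < 3)"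

lemma below_order_mono: "below_order q r \<Longrightarrow> s \<le> r \<Longrightarrow> below_order q s"
  by (auto simp: below_order_def)

inductive braid_step :: "('v \<Rightarrow> 'v \<Rightarrow> nat) \<Rightarrow> 'v list \<Rightarrow> 'v list \<Rightarrow> bool" for q where
  commute: "i \<noteq> j \<Longrightarrow> q i j = 0 \<Longrightarrow> braid_step q (x @ [i, j] @ y) (x @ [j, i] @ y)"
| braid: "i \<noteq> j \<Longrightarrow> q i j = 1 \<Longrightarrow> braid_step q (x @ [i, j, i] @ y) (x @ [j, i, j] @ y)"

text \<open>By Tits' theorem these are the reduced words of the Coxeter group. This form speaks of
  braid moves only, so it suits both ways to shorten a word: \<open>j j\<close> becomes
  \<open>j\<close> for ideals and disappears in the group.\<close>

definition braid_free :: "('v \<Rightarrow> 'v \<Rightarrow> nat) \<Rightarrow> 'v list \<Rightarrow> bool" where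
  "braid_free q u \<longleftrightarrow> (\<nexists>x j y. (braid_step q)\<^sup>*\<^sup>* u (x @ [j, j] @ y))"

lemma braid_step_Cons: "braid_step q u v \<Longrightarrow> braid_step q (i # u) (i # v)"
proof (induction rule: braid_step.induct)
  case (commute k j x y)
  then show ?case using braid_step.commute[of k j q "i # x" y] by simp
next
  case (braid k j x y)
  then show ?case using braid_step.braid[of k j q "i # x" y] by simp
qed

lemma braid_step_length: "braid_step q u v \<Longrightarrow> length v = length u"
  by (induction rule: braid_step.induct) auto

lemma braid_step_set: "braid_step q u v \<Longrightarrow> set v = set u"
  by (induction rule: braid_step.induct) auto

lemma braids_Cons: "(braid_step q)\<^sup>*\<^sup>* u v \<Longrightarrow> (braid_step q)\<^sup>*\<^sup>* (i # u) (i # v)"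
  by (induction rule: rtranclp_induct) (auto intro: rtranclp.rtrancl_into_rtrancl braid_step_Cons)

lemma braids_append: "(braid_step q)\<^sup>*\<^sup>* u v \<Longrightarrow> (braid_step q)\<^sup>*\<^sup>* (x @ u) (x @ v)"
  by (induction x) (auto intro: braids_Cons)

lemma braids_length: "(braid_step q)\<^sup>*\<^sup>* u v \<Longrightarrow> length v = length u"
  by (induction rule: rtranclp_induct) (auto dest: braid_step_length)

lemma braids_set: "(braid_step q)\<^sup>*\<^sup>* u v \<Longrightarrow> set v = set u"
  by (induction rule: rtranclp_induct) (auto dest: braid_step_set)

lemma braids_lists: "(braid_step q)\<^sup>*\<^sup>* u v \<Longrightarrow> u \<in> lists S \<Longrightarrow> v \<in> lists S"
  using braids_set[of q u v] by (simp add: in_lists_conv_set)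

lemma braid_free_braids: "braid_free q u \<Longrightarrow> (braid_step q)\<^sup>*\<^sup>* u v \<Longrightarrow> braid_free q v"
  unfolding braid_free_def by (meson rtranclp_trans)

lemma braid_free_append: "braid_free q (x @ u) \<Longrightarrow> braid_free q u"
  unfolding braid_free_def by (metis append_assoc braids_append)

lemma braid_free_Cons: "braid_free q (i # u) \<Longrightarrow> braid_free q u"
  using braid_free_append[of q "[i]" u] by simp

lemma braid_free_no_repeat: "braid_free q u \<Longrightarrow> (braid_step q)\<^sup>*\<^sup>* u (i # i # v) \<Longrightarrow> False"
  unfolding braid_free_def by (metis append_Cons append_Nil)

text \<open>\<open>L\<close> marks the left ideals and \<open>T\<close> is the ideal \<Lambda>
  itself. \<open>U_alt\<close> carries the information about two vertices; \<open>D_T\<close> is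
  what finally separates the empty word from the others.\<close>

locale braid_operators =
  fixes S :: "'v set" and q :: "'v \<Rightarrow> 'v \<Rightarrow> nat" and D U :: "'v \<Rightarrow> 'x \<Rightarrow> 'x"
    and L :: "'x \<Rightarrow> bool" and T :: 'x
  assumes q_sym: "q i j = q j i"
    and L_T: "L T"
    and L_D: "i \<in> S \<Longrightarrow> L J \<Longrightarrow> L (D i J)"
    and D_idem: "i \<in> S \<Longrightarrow> L J \<Longrightarrow> D i (D i J) = D i J"
    and U_D: "i \<in> S \<Longrightarrow> L J \<Longrightarrow> U i J = J \<Longrightarrow> U i (D i J) = J"
    and D_commute: "i \<in> S \<Longrightarrow> j \<in> S \<Longrightarrow> i \<noteq> j \<Longrightarrow> q i j = 0 \<Longrightarrow> L J \<Longrightarrow> D i (D j J) = D j (D i J)"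
    and D_braid: "i \<in> S \<Longrightarrow> j \<in> S \<Longrightarrow> i \<noteq> j \<Longrightarrow> q i j = 1 \<Longrightarrow> L J \<Longrightarrow>
      D i (D j (D i J)) = D j (D i (D j J))"
    and U_alt: "i \<in> S \<Longrightarrow> j \<in> S \<Longrightarrow> i \<noteq> j \<Longrightarrow> L J \<Longrightarrow> U i J = J \<Longrightarrow> U j J = J \<Longrightarrow>
      below_order (q i j) r \<Longrightarrow> U i (foldr D (altw j i r) J) = foldr D (altw j i r) J"
    and U_T: "i \<in> S \<Longrightarrow> U i T = T"
    and D_T: "i \<in> S \<Longrightarrow> D i T \<noteq> T"
begin

abbreviation braids (infix "\<sim>" 50) where "u \<sim> v \<equiv> (braid_step q)\<^sup>*\<^sup>* u v"
abbreviation "free \<equiv> braid_free q"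

lemma braids_sym: "u \<sim> v \<Longrightarrow> v \<sim> u"
proof (induction rule: rtranclp_induct)
  case (step v w)
  have "braid_step q w v" using step(2)
    by cases (metis (no_types, lifting) braid_step.commute braid_step.braid q_sym)+
  then show ?case using step by (meson converse_rtranclp_into_rtranclp)
qed simp

lemma L_word: "u \<in> lists S \<Longrightarrow> L J \<Longrightarrow> L (foldr D u J)"
  by (induction u) (auto intro: L_D)

lemma word_step: "braid_step q u v \<Longrightarrow> u \<in> lists S \<Longrightarrow> L J \<Longrightarrow> foldr D u J = foldr D v J"
proof (induction rule: braid_step.induct)
  case (commute i j x y)
  then show ?case using D_commute[of i j "foldr D y J"] L_word[of y J] by simp
next
  case (braid i j x y)
  then show ?case using D_braid[of i j "foldr D y J"] L_word[of y J] by simp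
qed

lemma word_braids: "u \<sim> v \<Longrightarrow> u \<in> lists S \<Longrightarrow> L J \<Longrightarrow> foldr D u J = foldr D v J"
  by (induction rule: rtranclp_induct) (auto dest: word_step braids_lists)

text \<open>A dihedral word at least as long as the order of s_i s_j leaves room for one braid move
  on its first two or three letters. For two or more arrows the order is infinite and the second
  assumption fails.\<close>

lemma altw_exchange:
  assumes "i \<noteq> j" "\<not> below_order (q i j) r"
  shows "\<exists>y'. altw i j r @ y \<sim> j # y'"
proof -
  have *: "\<exists>y'. x @ y \<sim> j # y'" if "x = [i, j] @ z \<and> q i j = 0 \<or> x = [i, j, i] @ z \<and> q i j = 1" for x z
  proof -
    have "\<exists>y'. braid_step q (x @ y) (j # y')"
      using that assms(1) braid_step.commute[of i j q "[]" "z @ y"] 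
        braid_step.braid[of i j q "[]" "z @ y"] by auto
    then show ?thesis by blast
  qed
  have "q i j = 0 \<and> r \<ge> 2 \<or> q i j = 1 \<and> r \<ge> 3"
    using assms(2) by (auto simp: below_order_def)
  then consider "r = Suc (Suc (r - 2))" "q i j = 0"
    | "r = Suc (Suc (Suc (r - 3)))" "q i j = 1"
    by fastforce
  then show ?thesis
  proof cases
    case 1
    then have "altw i j r = [i, j] @ altw i j (r - 2)" by (metis altw.simps(2) append_Cons append_Nil)
    then show ?thesis using * 1(2) by blast
  next
    case 2
    then have "altw i j r = [i, j, i] @ altw j i (r - 3)" by (metis altw.simps(2) append_Cons append_Nil)
    then show ?thesis using * 2(2) by blast
  qed
qed

text \<open>This is the factorization of a Coxeter group element into a part in the dihedral
  subgroup of \<open>i\<close>, \<open>j\<close> and a shortest coset representative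
  \<open>y\<close>, carried out on words: letters \<open>i\<close> and \<open>j\<close> are split
  off as long as a braid move brings one of them to the front.\<close>

lemma alternating_decomposition:
  assumes "free u" "u \<in> lists S" "i \<noteq> j"
  shows "\<exists>y r. free y \<and> y \<in> lists S \<and> length y + r = length u \<and>
     (u \<sim> altw i j r @ y \<or> u \<sim> altw j i r @ y) \<and> (\<nexists>z. y \<sim> i # z) \<and> (\<nexists>z. y \<sim> j # z)"
  using assms(1,2)
proof (induction "length u" arbitrary: u rule: less_induct)
  case less
  have step: ?case if ij: "k = i \<and> l = j \<or> k = j \<and> l = i" and u': "u \<sim> k # u'" for k l u'
  proof -
    have "k \<noteq> l" using ij assms(3) by auto
    have fr: "free (k # u')" using less.prems u' braid_free_braids by blast
    have len: "length u = Suc (length u')" using braids_length[OF u'] by simp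
    have "u' \<in> lists S" using braids_lists[OF u' less.prems(2)] by simp
    then obtain y r where y: "free y" "y \<in> lists S" "length y + r = length u'"
      and alt: "u' \<sim> altw i j r @ y \<or> u' \<sim> altw j i r @ y"
      and nd: "\<nexists>z. y \<sim> i # z" "\<nexists>z. y \<sim> j # z"
      using less.hyps[of u'] braid_free_Cons[OF fr] len by auto
    have "u' \<sim> altw k l r @ y \<or> u' \<sim> altw l k r @ y" using alt ij by auto
    \<comment> \<open>The letters split off must alternate: another \<open>k\<close> in front of
      \<open>u'\<close> would braid \<open>u\<close> to a word starting with \<open>k k\<close>. For
      \<open>r = 0\<close> the two alternatives coincide.\<close>
    then have "u' \<sim> altw l k r @ y"
    proof
      assume *: "u' \<sim> altw k l r @ y"
      show ?thesis
      proof (cases r)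
        case (Suc r')
        then have "k # u' \<sim> k # k # altw l k r' @ y" using braids_Cons[OF *, of k] by simp
        then show ?thesis using braid_free_no_repeat[OF fr] by blast
      qed (use * in simp)
    qed
    then have "u \<sim> altw k l (Suc r) @ y"
      using u' braids_Cons[of q u' "altw l k r @ y" k] by (simp add: rtranclp_trans)
    then have "u \<sim> altw i j (Suc r) @ y \<or> u \<sim> altw j i (Suc r) @ y"
      using ij by auto
    moreover have "length y + Suc r = length u" using y(3) len by simp
    ultimately show ?thesis using y(1,2) nd by blast
  qed
  show ?case
  proof (cases "(\<exists>z. u \<sim> i # z) \<or> (\<exists>z. u \<sim> j # z)")
    case True
    then show ?thesis
    proof
      assume "\<exists>z. u \<sim> i # z"
      then obtain z where "u \<sim> i # z" ..
      then show ?thesis by (intro step[of i j z]) simp_all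
    next
      assume "\<exists>z. u \<sim> j # z"
      then obtain z where "u \<sim> j # z" ..
      then show ?thesis by (intro step[of j i z]) simp_all
    qed
  next
    case False
    then show ?thesis using less.prems by (intro exI[of _ u] exI[of _ 0]) auto
  qed
qed

text \<open>Split \<open>u\<close> relative to \<open>i\<close> and its own first letter
  \<open>j\<close>. The remainder \<open>y\<close> is shorter and neither letter can be moved to its
  front, so by induction both \<open>U i\<close> and \<open>U j\<close> fix its ideal. If the
  dihedral part starts with \<open>j\<close>, it is either short enough for \<open>U_alt\<close> or
  so long that a braid move puts \<open>i\<close> in front.\<close>

lemma descent_or_closed:
  assumes "free u" "u \<in> lists S" "i \<in> S"
  shows "(\<exists>z. u \<sim> i # z) \<or> U i (foldr D u T) = foldr D u T"
  using assms
proof (induction "length u" arbitrary: u i rule: less_induct)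
  case less
  show ?case
  proof (cases u)
    case Nil
    then show ?thesis using U_T less.prems by simp
  next
    case (Cons j v)
    show ?thesis
    proof (cases "j = i")
      case True
      then show ?thesis using Cons by blast
    next
      case False
      have jS: "j \<in> S" using Cons less.prems by simp
      obtain y r where y: "free y" "y \<in> lists S" "length y + r = length u"
        and alt: "u \<sim> altw i j r @ y \<or> u \<sim> altw j i r @ y"
        and nd: "\<nexists>z. y \<sim> i # z" "\<nexists>z. y \<sim> j # z"
        using alternating_decomposition[OF less.prems(1,2), of i j] False by metis
      have r0: "r \<noteq> 0"
      proof
        assume "r = 0"
        then have "u \<sim> y" using alt by auto
        then show False using nd(2) Cons braids_sym by blast
      qed
      then have ly: "length y < length u" using y by linarith
      have Py: "U i (foldr D y T) = foldr D y T" "U j (foldr D y T) = foldr D y T"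
        using less.hyps[OF ly y(1,2)] nd less.prems jS by blast+
      from alt show ?thesis
      proof
        assume "u \<sim> altw i j r @ y"
        then show ?thesis using r0 by (cases r) auto
      next
        assume a: "u \<sim> altw j i r @ y"
        show ?thesis
        proof (cases "below_order (q i j) r")
          case True
          then show ?thesis
            using U_alt[OF less.prems(3) jS _ L_word[OF y(2) L_T] Py] False
              word_braids[OF a less.prems(2) L_T] by simp
        next
          case n: False
          then obtain y' where "altw j i r @ y \<sim> i # y'"
            using altw_exchange[of j i r y] False q_sym by metis
          then show ?thesis using a by (meson rtranclp_trans)
        qed
      qed
    qed
  qed
qed

text \<open>No braid moves bring \<open>i\<close> to the front of \<open>u'\<close>, since
  \<open>u\<close> would then braid to a word starting with \<open>i i\<close>. Hence
  \<open>U i\<close> fixes the ideal of \<open>u'\<close>, and applying \<open>U i\<close> to the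
  ideal of \<open>u\<close> cancels the letter.\<close>

lemma descent_tail:
  assumes "free u" "u \<in> lists S" "u \<sim> i # u'"
  shows "free u'" "u' \<in> lists S" "i \<in> S" "length u = Suc (length u')"
    "foldr D u T = D i (foldr D u' T)" "U i (foldr D u' T) = foldr D u' T"
    "U i (foldr D u T) = foldr D u' T"
proof -
  have fr: "free (i # u')" using assms braid_free_braids by blast
  then show f': "free u'" by (rule braid_free_Cons)
  show u': "u' \<in> lists S" and i: "i \<in> S" using braids_lists[OF assms(3,2)] by auto
  show "length u = Suc (length u')" using braids_length[OF assms(3)] by simp
  show e: "foldr D u T = D i (foldr D u' T)" using word_braids[OF assms(3,2) L_T] by simp
  have "\<nexists>z. u' \<sim> i # z"
  proof
    assume "\<exists>z. u' \<sim> i # z"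
    then obtain z where "u' \<sim> i # z" ..
    then show False using braid_free_no_repeat[OF fr braids_Cons] by blast
  qed
  then show P: "U i (foldr D u' T) = foldr D u' T" using descent_or_closed[OF f' u' i] by blast
  show "U i (foldr D u T) = foldr D u' T" using U_D[OF i L_word[OF u' L_T] P] e by simp
qed

text \<open>Induction on the total length. A letter that can lead both words is cancelled by
  \<open>U i\<close>. If it can lead \<open>u\<close> only, then \<open>U i\<close> shortens
  \<open>u\<close> and leaves the ideal of \<open>v\<close> alone, so \<open>u'\<close> and
  \<open>v\<close> are braid equivalent; if this happens from both sides, each word is one letter
  longer than the other.\<close>

lemma word_inj:
  assumes "free u" "u \<in> lists S" "free v" "v \<in> lists S" "foldr D u T = foldr D v T"
  shows "u \<sim> v"
  using assms
proof (induction "length u + length v" arbitrary: u v rule: less_induct)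
  case less
  note fu = less.prems(1,2) and fv = less.prems(3,4) and eq = less.prems(5)
  have common: ?case if "u \<sim> i # u'" "v \<sim> i # v'" for i u' v'
  proof -
    note tu = descent_tail[OF fu that(1)] and tv = descent_tail[OF fv that(2)]
    have "foldr D u' T = foldr D v' T" using tu(7) tv(7) eq by simp
    then have "u' \<sim> v'" using less.hyps[OF _ tu(1,2) tv(1,2)] tu(4) tv(4) by simp
    then show ?thesis using that braids_sym by (meson braids_Cons rtranclp_trans)
  qed
  have drop: "u' \<sim> v \<and> v \<sim> u'" if "u \<sim> i # u'" "\<nexists>z. v \<sim> i # z" for i u'
  proof -
    note tu = descent_tail[OF fu that(1)]
    have "U i (foldr D v T) = foldr D v T" using descent_or_closed[OF fv tu(3)] that(2) by blast
    then have "foldr D u' T = foldr D v T" using tu(7) eq by simp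
    then have "u' \<sim> v" using less.hyps[OF _ tu(1,2) fv] tu(4) by simp
    then show ?thesis using braids_sym by blast
  qed
  have drop': "v' \<sim> u" if "v \<sim> i # v'" "\<nexists>z. u \<sim> i # z" for i v'
  proof -
    note tv = descent_tail[OF fv that(1)]
    have "U i (foldr D u T) = foldr D u T" using descent_or_closed[OF fu tv(3)] that(2) by blast
    then have "foldr D v' T = foldr D u T" using tv(7) eq by simp
    then show ?thesis using less.hyps[OF _ tv(1,2) fu] tv(4) by simp
  qed
  show ?case
  proof (cases u)
    case Nil
    show ?thesis
    proof (cases v)
      case (Cons j v')
      have "\<nexists>z. u \<sim> j # z" using Nil braids_length by fastforce
      then have "v' \<sim> u" using drop'[of j v'] Cons by simp
      then have "v' = []" using Nil braids_length by fastforce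
      then show ?thesis using eq Nil Cons D_T[of j] fv by simp
    qed (use Nil in simp)
  next
    case (Cons i u')
    show ?thesis
    proof (cases "\<exists>z. v \<sim> i # z")
      case True
      then obtain z where "v \<sim> i # z" ..
      then show ?thesis using common[of i u' z] Cons by simp
    next
      case False
      then have uv: "u' \<sim> v" using drop[of i u'] Cons by simp
      show ?thesis
      proof (cases v)
        case Nil
        then show ?thesis using eq uv Cons D_T[of i] fu braids_length[OF uv] by simp
      next
        case c: (Cons j v')
        show ?thesis
        proof (cases "\<exists>z. u \<sim> j # z")
          case True
          then obtain z where "u \<sim> j # z" ..
          then show ?thesis using common[of j z v'] c by simp
        next
          case False
          then have "v' \<sim> u" using drop'[of j v'] c by simp
          then have "length u = length v'" "length v = length u'" using uv braids_length by blast+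
          then show ?thesis using Cons c by simp
        qed
      qed
    qed
  qed
qed

text \<open>Idempotence of the ideals allows \<open>j j\<close> to be replaced by \<open>j\<close>,
  as in the 0-Hecke monoid of W, and each such replacement shortens the word.\<close>

lemma word_free_exists:
  "u \<in> lists S \<Longrightarrow> \<exists>v\<in>lists S. free v \<and> foldr D v T = foldr D u T"
proof (induction "length u" arbitrary: u rule: less_induct)
  case less
  show ?case
  proof (cases "free u")
    case False
    then obtain x j y where b: "u \<sim> x @ [j, j] @ y" unfolding braid_free_def by blast
    have m: "x @ [j, j] @ y \<in> lists S" using braids_lists[OF b less.prems] .
    have e: "foldr D (x @ [j] @ y) T = foldr D u T"
      using word_braids[OF b less.prems L_T] D_idem[of j "foldr D y T"] L_word[of y T] L_T m
      by simp
    have "length (x @ [j] @ y) < length u" "x @ [j] @ y \<in> lists S"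
      using braids_length[OF b] m by auto
    then show ?thesis using less.hyps[of "x @ [j] @ y"] e by metis
  qed (use less.prems in blast)
qed

section \<open>The reflection action on products of ideals\<close>

definition products :: "'x set" where "products = (\<lambda>u. foldr D u T) ` lists S"

definition reflect :: "'v \<Rightarrow> 'x \<Rightarrow> 'x" where
  "reflect i J = (if U i J = J then D i J else U i J)"

lemma productsE:
  assumes "J \<in> products"
  obtains u where "free u" "u \<in> lists S" "J = foldr D u T"
proof -
  obtain v where v: "v \<in> lists S" "J = foldr D v T" using assms by (auto simp: products_def)
  obtain w where "w \<in> lists S" "free w" "foldr D w T = foldr D v T"
    using word_free_exists[OF v(1)] by blast
  then show thesis using that[of w] v(2) by simp
qed

lemma products_D:
  assumes "i \<in> S" "J \<in> products"
  shows "D i J \<in> products"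
proof -
  obtain v where "v \<in> lists S" "J = foldr D v T" using assms(2) by (auto simp: products_def)
  then have "D i J = foldr D (i # v) T" "i # v \<in> lists S" using assms(1) by auto
  then show ?thesis unfolding products_def by blast
qed

lemma products_L: "J \<in> products \<Longrightarrow> L J"
  using L_word L_T by (auto simp: products_def)

lemma reflect_products:
  assumes "i \<in> S" "J \<in> products"
  shows "reflect i J \<in> products" "reflect i (reflect i J) = J"
proof -
  obtain u where u: "free u" "u \<in> lists S" "J = foldr D u T" using productsE[OF assms(2)] .
  have LJ: "L J" using products_L assms(2) .
  have "reflect i J \<in> products \<and> reflect i (reflect i J) = J"
  proof (cases "U i J = J")
    case True
    have "D i J \<in> products" using products_D assms by blast
    moreover have "reflect i (D i J) = J"
      using U_D[OF assms(1) LJ True] by (auto simp: reflect_def)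
    ultimately show ?thesis using True by (simp add: reflect_def)
  next
    case False
    then obtain u' where d: "u \<sim> i # u'" using descent_or_closed[OF u(1,2) assms(1)] u by blast
    note t = descent_tail[OF u(1,2) d]
    have "foldr D u' T \<in> products" using t(2) by (auto simp: products_def)
    then show ?thesis using t u(3) False by (simp add: reflect_def)
  qed
  then show "reflect i J \<in> products" "reflect i (reflect i J) = J" by auto
qed

text \<open>\<open>K\<close> is the ideal of the coset representative from
  \<open>alternating_decomposition\<close>, so \<open>J\<close> lies on one of the two chains that
  descend from \<open>K\<close>. The bound says that \<open>r\<close> is at most the order of s_i
  s_j.\<close>

lemma alternating_base:
  assumes "J \<in> products" "i \<in> S" "j \<in> S" "i \<noteq> j"
  obtains K r where "K \<in> products" "U i K = K" "U j K = K"
    "r = 0 \<or> below_order (q i j) (r - 1)"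
    "J = foldr D (altw i j r) K \<or> J = foldr D (altw j i r) K"
proof -
  obtain u where u: "free u" "u \<in> lists S" "J = foldr D u T" using productsE[OF assms(1)] .
  obtain y r where y: "free y" "y \<in> lists S" 
    and alt: "u \<sim> altw i j r @ y \<or> u \<sim> altw j i r @ y"
    and nd: "\<nexists>z. y \<sim> i # z" "\<nexists>z. y \<sim> j # z"
    using alternating_decomposition[OF u(1,2) assms(4)] by metis
  \<comment> \<open>Otherwise the alternating word without its first letter \<open>k\<close> could
    itself be braided to start with \<open>k\<close>, and \<open>u\<close> to start with
    \<open>k k\<close>.\<close>
  have bound: "below_order (q i j) r'" if r: "r = Suc r'" and kl: "k = i \<and> l = j \<or> k = j \<and> l = i"
    and a: "u \<sim> altw k l r @ y" for r' k l
  proof (rule ccontr)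
    assume "\<not> below_order (q i j) r'"
    then have "\<not> below_order (q l k) r'" "l \<noteq> k" using kl q_sym[of i j] assms(4) by auto
    then obtain y' where "altw l k r' @ y \<sim> k # y'" using altw_exchange by blast
    then have "k # altw l k r' @ y \<sim> k # k # y'" by (rule braids_Cons)
    moreover have "u \<sim> k # altw l k r' @ y" using a r by simp
    ultimately show False using braid_free_no_repeat[OF u(1)] by (meson rtranclp_trans)
  qed
  have b: "r = 0 \<or> below_order (q i j) (r - 1)"
    using alt bound[of "r - 1" i j] bound[of "r - 1" j i] by fastforce
  have e: "J = foldr D (altw i j r) (foldr D y T) \<or> J = foldr D (altw j i r) (foldr D y T)"
    using alt word_braids[OF _ u(2) L_T] u(3) by fastforce
  show ?thesis
  proof (rule that[of "foldr D y T" r])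
    show "foldr D y T \<in> products" using y by (auto simp: products_def)
    show "U i (foldr D y T) = foldr D y T" "U j (foldr D y T) = foldr D y T"
      using descent_or_closed[OF y] nd assms by blast+
  qed (use b e in auto)
qed

text \<open>Below the order of s_i s_j a reflection moves one step along a chain under
  \<open>K\<close>, in either direction, and is expressed by \<open>D\<close> alone. The relations
  of W can then be checked element by element on the dihedral orbit of \<open>K\<close>.\<close>

lemma reflect_alt:
  assumes "i \<in> S" "j \<in> S" "i \<noteq> j" "L K" "U i K = K" "U j K = K" "below_order (q i j) r"
  shows "reflect i (foldr D (altw j i r) K) = D i (foldr D (altw j i r) K)"
    "reflect i (D i (foldr D (altw j i r) K)) = foldr D (altw j i r) K"
proof -
  have P: "U i (foldr D (altw j i r) K) = foldr D (altw j i r) K"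
    using U_alt assms by blast
  then show "reflect i (foldr D (altw j i r) K) = D i (foldr D (altw j i r) K)"
    by (simp add: reflect_def)
  have "set (altw k l n) \<subseteq> {k, l}" for k l :: 'v and n by (induction n arbitrary: k l) auto
  then have "altw j i r \<in> lists S" using assms(1,2) by (auto simp: in_lists_conv_set)
  then show "reflect i (D i (foldr D (altw j i r) K)) = foldr D (altw j i r) K"
    using U_D[OF assms(1) L_word[OF _ assms(4)] P] by (auto simp: reflect_def)
qed

text \<open>The orbit consists of \<open>K\<close>, \<open>D i K\<close>, \<open>D j K\<close> and
  the lower end, where the two chains meet by \<open>D_commute\<close>. The relation is checked at
  each of these.\<close>

lemma reflect_commute:
  assumes "J \<in> products" "i \<in> S" "j \<in> S" "i \<noteq> j" "q i j = 0"
  shows "reflect i (reflect j J) = reflect j (reflect i J)"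
proof -
  obtain K r where K: "K \<in> products" "U i K = K" "U j K = K" and r: "r = 0 \<or> below_order (q i j) (r - 1)"
    and J: "J = foldr D (altw i j r) K \<or> J = foldr D (altw j i r) K"
    using alternating_base[OF assms(1-4)] by metis
  have LK: "L K" using K products_L by blast
  have b: "below_order (q i j) s \<longleftrightarrow> s < 2" "below_order (q j i) s \<longleftrightarrow> s < 2" for s
    using assms(5) q_sym[of j i] by (auto simp: below_order_def)
  note R = reflect_alt[OF assms(2-4) LK K(2,3), unfolded b]
    and R' = reflect_alt[OF assms(3,2) assms(4)[symmetric] LK K(3,2), unfolded b]
  note rules = R[of 0] R[of "Suc 0"] R'[of 0] R'[of "Suc 0"]
  have c: "D j (D i K) = D i (D j K)" using D_commute assms LK by metis
  have "r = 0 \<or> r = 1 \<or> r = 2" using r[unfolded b] by linarith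
  then show ?thesis using J rules c by (auto simp: numeral_2_eq_2)
qed

text \<open>As for commuting letters, with chains of length three that meet by
  \<open>D_braid\<close>.\<close>

lemma reflect_braid:
  assumes "J \<in> products" "i \<in> S" "j \<in> S" "i \<noteq> j" "q i j = 1"
  shows "reflect i (reflect j (reflect i J)) = reflect j (reflect i (reflect j J))"
proof -
  obtain K r where K: "K \<in> products" "U i K = K" "U j K = K" and r: "r = 0 \<or> below_order (q i j) (r - 1)"
    and J: "J = foldr D (altw i j r) K \<or> J = foldr D (altw j i r) K"
    using alternating_base[OF assms(1-4)] by metis
  have LK: "L K" using K products_L by blast
  have b: "below_order (q i j) s \<longleftrightarrow> s < 3" "below_order (q j i) s \<longleftrightarrow> s < 3" for s
    using assms(5) q_sym[of j i] by (auto simp: below_order_def)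
  note R = reflect_alt[OF assms(2-4) LK K(2,3), unfolded b]
    and R' = reflect_alt[OF assms(3,2) assms(4)[symmetric] LK K(3,2), unfolded b]
  note rules = R[of 0] R[of "Suc 0"] R'[of 0] R'[of "Suc 0"]
    R[of "Suc (Suc 0)"] R'[of "Suc (Suc 0)"]
  have c: "D j (D i (D j K)) = D i (D j (D i K))" using D_braid assms LK by metis
  have "r = 0 \<or> r = 1 \<or> r = 2 \<or> r = 3" using r[unfolded b] by linarith
  then show ?thesis using J rules c by (auto simp: numeral_2_eq_2 numeral_3_eq_3)
qed

text \<open>Along a braid-free word each letter \<open>i\<close> meets an ideal that
  \<open>U i\<close> fixes, so \<open>reflect\<close> never takes its second branch.\<close>

lemma reflect_free:
  assumes "free u" "u \<in> lists S"
  shows "foldr reflect u T = foldr D u T"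
  using assms
proof (induction u)
  case (Cons i u)
  note t = descent_tail[OF Cons.prems, of i u]
  have "reflect i (foldr D u T) = D i (foldr D u T)" using t(6) by (simp add: reflect_def)
  then show ?case using Cons t by simp
qed simp

end

section \<open>Left ideals and the adjoint operators\<close>

text \<open>The type \<open>'g\<close> will be all functions on paths, and \<open>N\<close> is the
  subgroup of those that vanish in \<Lambda>, so equality in \<Lambda> is congruence modulo
  \<open>N\<close>. \<open>e i\<close> and \<open>A a\<close> are left multiplication by idempotents
  and arrows, \<open>st\<close> exchanges an arrow with its opposite, and \<open>B a\<close> is
  multiplication by the opposite of \<open>a\<close> up to sign. \<open>relation\<close> and
  \<open>exact\<close> say that the kernel of the map taking a family \<open>u\<close> to the sum of
  the \<open>A a (u a)\<close> at a vertex is generated by the preprojective relation;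
  \<open>e (tgt a)\<close> appears because \<open>A a\<close> sees only that part of
  \<open>u a\<close>.\<close>

locale preprojective_module =
  fixes V :: "'v set" and E :: "'e set" and src tgt :: "'e \<Rightarrow> 'v" and st :: "'e \<Rightarrow> 'e"
    and e :: "'v \<Rightarrow> 'g \<Rightarrow> 'g :: ab_group_add" and A B :: "'e \<Rightarrow> 'g \<Rightarrow> 'g" and N :: "'g set"
  assumes finite_V: "finite V" and finite_E: "finite E"
    and src_V: "a \<in> E \<Longrightarrow> src a \<in> V" and tgt_V: "a \<in> E \<Longrightarrow> tgt a \<in> V"
    and no_loop: "a \<in> E \<Longrightarrow> src a \<noteq> tgt a"
    and st_E: "a \<in> E \<Longrightarrow> st a \<in> E" and st_st: "a \<in> E \<Longrightarrow> st (st a) = a"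
    and src_st: "a \<in> E \<Longrightarrow> src (st a) = tgt a" and tgt_st: "a \<in> E \<Longrightarrow> tgt (st a) = src a"
    and e_diff: "e i (x - y) = e i x - e i y"
    and A_diff: "A a (x - y) = A a x - A a y"
    and e_e: "e i (e j x) = (if i = j then e i x else 0)"
    and e_A: "a \<in> E \<Longrightarrow> e i (A a x) = (if i = src a then A a x else 0)"
    and A_e: "a \<in> E \<Longrightarrow> A a (e i x) = (if i = tgt a then A a x else 0)"
    and N_zero: "0 \<in> N" and N_diff: "x \<in> N \<Longrightarrow> y \<in> N \<Longrightarrow> x - y \<in> N"
    and N_e: "i \<in> V \<Longrightarrow> x \<in> N \<Longrightarrow> e i x \<in> N" and N_A: "a \<in> E \<Longrightarrow> x \<in> N \<Longrightarrow> A a x \<in> N"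
    and e_sum: "x - (\<Sum>i\<in>V. e i x) \<in> N"
    and B_st: "a \<in> E \<Longrightarrow> B a x = A (st a) x \<or> B a x = - A (st a) x"
    and relation: "i \<in> V \<Longrightarrow> (\<Sum>a\<in>{a \<in> E. src a = i}. A a (B a x)) \<in> N"
    and exact: "i \<in> V \<Longrightarrow> (\<Sum>a\<in>{a \<in> E. src a = i}. A a (u a)) \<in> N \<Longrightarrow>
      \<exists>y. \<forall>a\<in>{a \<in> E. src a = i}. e (tgt a) (u a) - B a y \<in> N"
begin

definition out :: "'v \<Rightarrow> 'e set" where "out i = {a \<in> E. src a = i}"

definition left_ideal :: "'g set \<Rightarrow> bool" where
  "left_ideal K \<longleftrightarrow> N \<subseteq> K \<and> (\<forall>x\<in>K. \<forall>y\<in>K. x - y \<in> K) \<and>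
     (\<forall>i\<in>V. \<forall>x\<in>K. e i x \<in> K) \<and> (\<forall>a\<in>E. \<forall>x\<in>K. A a x \<in> K)"

text \<open>\<open>D i K\<close> is the product of the ideal \<open>I\<^sub>i\<close> with \<open>K\<close>, and \<open>U i\<close> is right adjoint to \<open>D i\<close>:
  \<open>U i K\<close> consists of the elements that \<open>I\<^sub>i\<close> multiplies into \<open>K\<close>.\<close>

definition D :: "'v \<Rightarrow> 'g set \<Rightarrow> 'g set" where
  "D i K = {x. (\<forall>t\<in>V - {i}. e t x \<in> K) \<and>
     (\<exists>u. (\<forall>a\<in>out i. u a \<in> K) \<and> e i x - (\<Sum>a\<in>out i. A a (u a)) \<in> N)}"

definition U :: "'v \<Rightarrow> 'g set \<Rightarrow> 'g set" where
  "U i K = {x. (\<forall>t\<in>V - {i}. e t x \<in> K) \<and> (\<forall>b\<in>E. tgt b = i \<longrightarrow> A b x \<in> K)}"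

definition links :: "'v \<Rightarrow> 'v \<Rightarrow> nat" where
  "links i j = card {a \<in> E. src a = i \<and> tgt a = j}"

lemma outD: "a \<in> out i \<Longrightarrow> a \<in> E" "a \<in> out i \<Longrightarrow> src a = i" by (auto simp: out_def)

lemma out_tgt: "a \<in> out i \<Longrightarrow> tgt a \<in> V" "a \<in> out i \<Longrightarrow> tgt a \<noteq> i"
  using tgt_V no_loop unfolding out_def by fastforce+

lemma finite_out: "finite (out i)" using finite_E by (simp add: out_def)

lemma A_zero: "A a 0 = 0" using A_diff[of a 0 0] by simp
lemma A_minus: "A a (- x) = - A a x"
  using A_diff[of a 0 x] by (simp add: A_zero)

lemma links_sym: "links i j = links j i"
proof -
  have "bij_betw st {a \<in> E. src a = i \<and> tgt a = j} {a \<in> E. src a = j \<and> tgt a = i}"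
    by (rule bij_betw_byWitness[of _ st]) (auto simp: st_E st_st src_st tgt_st)
  then show ?thesis by (simp add: links_def bij_betw_same_card)
qed

text \<open>Weaker than \<open>left_ideal\<close>, so that the facts below also cover the preimage
  of a left ideal under an arrow, which occurs in the proof of the braid relation.\<close>

definition subgroup_over :: "'g set \<Rightarrow> bool" where
  "subgroup_over K \<longleftrightarrow> N \<subseteq> K \<and> (\<forall>x\<in>K. \<forall>y\<in>K. x - y \<in> K)"

lemma left_idealD:
  assumes "left_ideal K"
  shows "subgroup_over K" "i \<in> V \<Longrightarrow> x \<in> K \<Longrightarrow> e i x \<in> K" "a \<in> E \<Longrightarrow> x \<in> K \<Longrightarrow> A a x \<in> K"
  using assms by (auto simp: left_ideal_def subgroup_over_def)

context
  fixes K assumes K: "subgroup_over K"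
begin

lemma sub_N: "x \<in> N \<Longrightarrow> x \<in> K" and sub_diff: "x \<in> K \<Longrightarrow> y \<in> K \<Longrightarrow> x - y \<in> K"
  using K by (auto simp: subgroup_over_def)

lemma sub_zero: "0 \<in> K" using sub_N N_zero by blast
lemma sub_minus: "x \<in> K \<Longrightarrow> - x \<in> K" using sub_diff[of 0 x] sub_zero by simp
lemma sub_add: "x \<in> K \<Longrightarrow> y \<in> K \<Longrightarrow> x + y \<in> K"
  using sub_diff[of x "- y"] sub_minus by simp
lemma sub_sum: "(\<And>x. x \<in> X \<Longrightarrow> f x \<in> K) \<Longrightarrow> sum f X \<in> K"
  by (induction X rule: infinite_finite_induct) (auto simp: sub_zero sub_add)

lemma sub_diff_iff: "x - y \<in> K \<Longrightarrow> x \<in> K \<longleftrightarrow> y \<in> K"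
  using sub_add[of "x - y" y] sub_diff[of x "x - y"] by auto

lemma sub_congr: "x - y \<in> N \<Longrightarrow> x \<in> K \<longleftrightarrow> y \<in> K"
  using sub_diff_iff sub_N by blast

lemma sub_local: "(\<And>t. t \<in> V \<Longrightarrow> e t x \<in> K) \<Longrightarrow> x \<in> K"
  using sub_congr[OF e_sum[of x]] sub_sum[of V "\<lambda>t. e t x"] by simp

lemma sub_B: "a \<in> E \<Longrightarrow> B a x \<in> K \<longleftrightarrow> A (st a) x \<in> K"
  using B_st[of a x] sub_minus by (metis minus_minus)

lemma D_local_in:
  assumes "x \<in> D i J" "\<And>a y. a \<in> out i \<Longrightarrow> y \<in> J \<Longrightarrow> A a y \<in> K"
  shows "e i x \<in> K"
proof -
  obtain u where u: "\<forall>a\<in>out i. u a \<in> J" "e i x - (\<Sum>a\<in>out i. A a (u a)) \<in> N"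
    using assms(1) by (auto simp: D_def)
  have "(\<Sum>a\<in>out i. A a (u a)) \<in> K" using u(1) assms(2) by (intro sub_sum) blast
  then show ?thesis using sub_congr[OF u(2)] by simp
qed

text \<open>The elements \<open>e t x\<close> and \<open>A a x\<close> generate
  \<open>D i J\<close>. This reduction to generators is behind the inclusions between products of
  ideals.\<close>

lemma D_least:
  assumes "\<And>t x. t \<in> V \<Longrightarrow> t \<noteq> i \<Longrightarrow> x \<in> J \<Longrightarrow> e t x \<in> K"
    "\<And>a x. a \<in> out i \<Longrightarrow> x \<in> J \<Longrightarrow> A a x \<in> K"
  shows "D i J \<subseteq> K"
proof
  fix x assume x: "x \<in> D i J"
  show "x \<in> K"
  proof (rule sub_local)
    fix t assume t: "t \<in> V"
    show "e t x \<in> K"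
    proof (cases "t = i")
      case True
      then show ?thesis using D_local_in[OF x] assms(2) by blast
    next
      case False
      then have "e t x \<in> J" using x t by (auto simp: D_def)
      then have "e t (e t x) \<in> K" using assms(1) t False by blast
      then show ?thesis by (simp add: e_e)
    qed
  qed
qed

end

lemma D_I:
  assumes "\<And>t. t \<in> V \<Longrightarrow> t \<noteq> i \<Longrightarrow> e t x \<in> K" "\<And>a. a \<in> out i \<Longrightarrow> u a \<in> K"
    "e i x - (\<Sum>a\<in>out i. A a (u a)) \<in> N"
  shows "x \<in> D i K"
proof -
  have "\<exists>u. (\<forall>a\<in>out i. u a \<in> K) \<and> e i x - (\<Sum>a\<in>out i. A a (u a)) \<in> N"
    using assms(2,3) by (intro exI[of _ u]) simp
  then show ?thesis using assms(1) by (simp add: D_def)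
qed

lemma e_in_D:
  assumes "left_ideal K" "t \<in> V" "t \<noteq> i" "x \<in> K"
  shows "e t x \<in> D i K"
proof (rule D_I[where u = "\<lambda>_. 0"])
  note z = sub_zero[OF left_idealD(1)[OF assms(1)]]
  show "e r (e t x) \<in> K" for r using left_idealD(2)[OF assms(1,2,4)] z by (simp add: e_e)
  show "e i (e t x) - (\<Sum>a\<in>out i. A a 0) \<in> N" using assms(3) N_zero by (simp add: e_e A_zero)
  show "0 \<in> K" by (rule z)
qed

lemma A_in_D:
  assumes "left_ideal K" "a \<in> out i" "x \<in> K"
  shows "A a x \<in> D i K"
proof (rule D_I[where u = "\<lambda>b. if b = a then x else 0"])
  note z = sub_zero[OF left_idealD(1)[OF assms(1)]]
  show "e r (A a x) \<in> K" if "r \<noteq> i" for r using that z outD[OF assms(2)] by (simp add: e_A)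
  show "(if b = a then x else 0) \<in> K" for b using assms(3) z by simp
  have "(\<Sum>b\<in>out i. A b (if b = a then x else 0)) = (\<Sum>b\<in>out i. if b = a then A a x else 0)"
    by (rule sum.cong) (auto simp: A_zero)
  then have "(\<Sum>b\<in>out i. A b (if b = a then x else 0)) = A a x"
    using assms(2) finite_out by simp
  then show "e i (A a x) - (\<Sum>b\<in>out i. A b (if b = a then x else 0)) \<in> N"
    using outD[OF assms(2)] N_zero by (simp add: e_A)
qed

lemma D_subset:
  assumes "left_ideal K"
  shows "D i K \<subseteq> K"
proof (rule D_least[OF left_idealD(1)[OF assms]])
  show "e t x \<in> K" if "t \<in> V" "x \<in> K" for t x by (rule left_idealD(2)[OF assms that])
  show "A a x \<in> K" if "a \<in> out i" "x \<in> K" for a x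
    by (rule left_idealD(3)[OF assms outD(1)[OF that(1)] that(2)])
qed

lemma left_ideal_D:
  assumes K: "left_ideal K" and i: "i \<in> V"
  shows "left_ideal (D i K)"
proof -
  note s = left_idealD(1)[OF K]
  have local: "e j x \<in> D i K" if x: "x \<in> D i K" and j: "j \<in> V" for j x
  proof (cases "j = i")
    case True
    show ?thesis using x True sub_zero[OF s] by (auto simp: D_def e_e)
  next
    case False
    then show ?thesis using e_in_D[OF K j] subsetD[OF D_subset[OF K] x] by simp
  qed
  show ?thesis unfolding left_ideal_def
  proof (intro conjI ballI subsetI)
    fix x assume x: "x \<in> N"
    then have "\<forall>t\<in>V. e t x \<in> N" using N_e by blast
    then show "x \<in> D i K" unfolding D_def using sub_N[OF s] sub_zero[OF s] i
      by (auto simp: A_zero intro!: exI[of _ "\<lambda>_. 0"])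
  next
    fix x y assume x: "x \<in> D i K" and y: "y \<in> D i K"
    obtain u where u: "\<forall>a\<in>out i. u a \<in> K" "e i x - (\<Sum>a\<in>out i. A a (u a)) \<in> N"
      using x by (auto simp: D_def)
    obtain w where w: "\<forall>a\<in>out i. w a \<in> K" "e i y - (\<Sum>a\<in>out i. A a (w a)) \<in> N"
      using y by (auto simp: D_def)
    have "e i (x - y) - (\<Sum>a\<in>out i. A a (u a - w a)) =
      (e i x - (\<Sum>a\<in>out i. A a (u a))) - (e i y - (\<Sum>a\<in>out i. A a (w a)))"
      by (simp add: e_diff A_diff sum_subtractf algebra_simps)
    then have "e i (x - y) - (\<Sum>a\<in>out i. A a (u a - w a)) \<in> N" using N_diff u(2) w(2) by simp
    moreover have "\<forall>a\<in>out i. u a - w a \<in> K" using u w sub_diff[OF s] by blast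
    moreover have "\<forall>t\<in>V - {i}. e t (x - y) \<in> K"
      using x y sub_diff[OF s] by (simp add: D_def e_diff)
    ultimately show "x - y \<in> D i K" by (auto simp: D_def)
  next
    fix j x assume "j \<in> V" "x \<in> D i K"
    then show "e j x \<in> D i K" using local by blast
  next
    fix a x assume a: "a \<in> E" and x: "x \<in> D i K"
    then have xK: "x \<in> K" using D_subset[OF K] by blast
    show "A a x \<in> D i K"
    proof (cases "src a = i")
      case True
      then show ?thesis using A_in_D[OF K _ xK, of a i] a by (simp add: out_def)
    next
      case False
      then show ?thesis
        using e_in_D[OF K src_V[OF a] False left_idealD(3)[OF K a xK]] e_A[OF a, of "src a" x] by simp
    qed
  qed
qed

text \<open>An arrow \<open>a\<close> leaving \<open>i\<close> ends at another vertex because there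
  are no loops. So \<open>A a x\<close> equals \<open>A a (e (tgt a) x)\<close>, where
  \<open>e (tgt a) x\<close> already lies in \<open>D i K\<close>.\<close>

lemma D_idem:
  assumes K: "left_ideal K" and i: "i \<in> V"
  shows "D i (D i K) = D i K"
proof
  have DK: "left_ideal (D i K)" by (rule left_ideal_D[OF K i])
  show "D i (D i K) \<subseteq> D i K" by (rule D_subset[OF DK])
  show "D i K \<subseteq> D i (D i K)"
  proof (rule D_least[OF left_idealD(1)[OF left_ideal_D[OF DK i]]])
    fix t x assume t: "t \<in> V" "t \<noteq> i" "x \<in> K"
    then have "e t (e t x) \<in> D i (D i K)" using e_in_D K DK by blast
    then show "e t x \<in> D i (D i K)" by (simp add: e_e)
  next
    fix a x assume a: "a \<in> out i" "x \<in> K"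
    have "e (tgt a) x \<in> D i K" by (rule e_in_D[OF K out_tgt[OF a(1)] a(2)])
    then have "A a (e (tgt a) x) \<in> D i (D i K)" using A_in_D[OF DK a(1)] by blast
    then show "A a x \<in> D i (D i K)" using A_e outD(1)[OF a(1)] by simp
  qed
qed

text \<open>One inclusion is monotonicity of \<open>U i\<close>, the other is the unit of the
  adjunction: an arrow that enters \<open>i\<close> starts elsewhere, so it maps \<open>K\<close>
  into \<open>D i K\<close>.\<close>

lemma U_D:
  assumes K: "left_ideal K" and "i \<in> V" "U i K = K"
  shows "U i (D i K) = K"
proof
  have "U i (D i K) \<subseteq> U i K" using D_subset[OF K] by (auto simp: U_def)
  then show "U i (D i K) \<subseteq> K" using assms(3) by simp
  have A: "A b x \<in> D i K" if "b \<in> E" "tgt b = i" "x \<in> K" for b x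
    using e_in_D[OF K src_V[OF that(1)], of i "A b x"] left_idealD(3)[OF K that(1,3)]
      no_loop[OF that(1)] that e_A by simp
  have e: "e t x \<in> D i K" if "t \<in> V - {i}" "x \<in> K" for t x
    using e_in_D[OF K] that by blast
  show "K \<subseteq> U i (D i K)" using A e unfolding U_def by blast
qed

lemma subset_U:
  assumes "left_ideal K"
  shows "K \<subseteq> U i K"
  using left_idealD[OF assms] by (auto simp: U_def)

section \<open>Commutation and braid relations between the operators\<close>

lemma no_link:
  assumes "links i j = 0" "a \<in> E" "src a = i"
  shows "tgt a \<noteq> j"
  using assms finite_E by (auto simp: links_def)

text \<open>It suffices to treat generators. The target of an arrow \<open>b\<close> leaving
  \<open>j\<close> is not \<open>i\<close>, so \<open>e (tgt b) y\<close> lies in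
  \<open>D i K\<close>; and what an arrow leaving \<open>i\<close> produces starts at
  \<open>i\<close>, hence is kept by \<open>D j\<close>.\<close>

lemma D_commute_subset:
  assumes K: "left_ideal K" and i: "i \<in> V" and j: "j \<in> V" and ij: "i \<noteq> j" and l: "links i j = 0"
  shows "D i (D j K) \<subseteq> D j (D i K)"
proof -
  have Di: "left_ideal (D i K)" by (rule left_ideal_D[OF K i])
  then have Dji: "left_ideal (D j (D i K))" using left_ideal_D j by blast
  have t2: "e t x \<in> D j (D i K)" if "t \<in> V" "t \<noteq> i" "t \<noteq> j" "x \<in> K" for t x
    using e_in_D[OF Di that(1,3) e_in_D[OF K that(1,2,4)]] by (simp add: e_e)
  show ?thesis
  proof (rule D_least[OF left_idealD(1)[OF Dji]])
    fix t x assume t: "t \<in> V" "t \<noteq> i" "x \<in> D j K"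
    show "e t x \<in> D j (D i K)"
    proof (cases "t = j")
      case False
      then show ?thesis using t2 t D_subset[OF K] by blast
    next
      case True
      show ?thesis unfolding True
      proof (rule D_local_in[OF left_idealD(1)[OF Dji] t(3)])
        fix b y assume b: "b \<in> out j" "y \<in> K"
        have "tgt b \<noteq> i" using no_link[of j i b] links_sym l b outD by metis
        then have "e (tgt b) y \<in> D i K" by (rule e_in_D[OF K out_tgt(1)[OF b(1)] _ b(2)])
        then have "A b (e (tgt b) y) \<in> D j (D i K)" using A_in_D[OF Di b(1)] by blast
        then show "A b y \<in> D j (D i K)" using A_e outD(1)[OF b(1)] by simp
      qed
    qed
  next
    fix a x assume a: "a \<in> out i" "x \<in> D j K"
    then have "A a x \<in> D i K" using A_in_D[OF K] D_subset[OF K] by blast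
    then have "e i (A a x) \<in> D j (D i K)" using e_in_D[OF Di i ij] by blast
    then show "A a x \<in> D j (D i K)" using e_A outD[OF a(1)] by simp
  qed
qed

lemma D_commute:
  assumes "left_ideal K" "i \<in> V" "j \<in> V" "i \<noteq> j" "links i j = 0"
  shows "D i (D j K) = D j (D i K)"
proof -
  have l: "links j i = 0" using assms(5) links_sym[of j i] by simp
  show ?thesis
    using D_commute_subset[OF assms(1) assms(2,3,4,5)]
      D_commute_subset[OF assms(1) assms(3,2) assms(4)[symmetric] l]
    by (rule subset_antisym)
qed

text \<open>Let \<alpha> be the only arrow from \<open>i\<close> to \<open>j\<close> and \<beta> its
  opposite. Generators of the left side that avoid the products \<alpha>\<beta> and \<beta>\<alpha>
  lie in the right side \<open>M\<close> directly. For these two products the preprojective relation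
  at \<open>i\<close> or \<open>j\<close> gives an expression by the other arrows at that vertex,
  which end outside of \<open>i\<close> and \<open>j\<close>.\<close>

lemma D_braid_subset:
  assumes K: "left_ideal K" and i: "i \<in> V" and j: "j \<in> V" and ij: "i \<noteq> j" and l: "links i j = 1"
  shows "D j (D i (D j K)) \<subseteq> D i (D j (D i K))"
proof -
  define M where "M = D i (D j (D i K))"
  have Di: "left_ideal (D i K)" by (rule left_ideal_D[OF K i])
  have Dj: "left_ideal (D j K)" by (rule left_ideal_D[OF K j])
  have Dji: "left_ideal (D j (D i K))" by (rule left_ideal_D[OF Di j])
  have M: "left_ideal M" unfolding M_def by (rule left_ideal_D[OF Dji i])
  note sM = left_idealD(1)[OF M]
  obtain \<alpha> where s: "{a \<in> E. src a = i \<and> tgt a = j} = {\<alpha>}"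
    using l unfolding links_def by (rule card_1_singletonE)
  have "\<alpha> \<in> {a \<in> E. src a = i \<and> tgt a = j}" unfolding s by simp
  then have \<alpha>: "\<alpha> \<in> E" "src \<alpha> = i" "tgt \<alpha> = j" by auto
  have \<alpha>u: "a = \<alpha>" if "a \<in> E" "src a = i" "tgt a = j" for a
  proof -
    have "a \<in> {a \<in> E. src a = i \<and> tgt a = j}" using that by simp
    then show ?thesis unfolding s by simp
  qed
  define \<beta> where "\<beta> = st \<alpha>"
  have \<beta>: "\<beta> \<in> E" "src \<beta> = j" "tgt \<beta> = i" "st \<beta> = \<alpha>"
    using \<alpha> by (simp_all add: \<beta>_def st_E src_st tgt_st st_st)
  have \<beta>u: "b = \<beta>" if "b \<in> E" "src b = j" "tgt b = i" for b
  proof -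
    have "st b = \<alpha>" using \<alpha>u[of "st b"] that by (simp add: st_E src_st tgt_st)
    then show ?thesis using st_st[OF that(1)] by (simp add: \<beta>_def)
  qed
  have A_tgt: "A a (e (tgt a) x) = A a x" if "a \<in> E" for a x using A_e that by simp
  have e_src: "e (src a) (A a x) = A a x" if "a \<in> E" for a x using e_A that by simp
  have m0: "e t x \<in> D j (D i K)" if "t \<in> V" "t \<noteq> i" "t \<noteq> j" "x \<in> K" for t x
    using e_in_D[OF Di that(1,3) e_in_D[OF K that(1,2,4)]] by (simp add: e_e)
  have m1: "e t x \<in> M" if "t \<in> V" "t \<noteq> i" "t \<noteq> j" "x \<in> K" for t x
    using e_in_D[OF Dji that(1,2) m0[OF that]] by (simp add: e_e M_def)
  have m2: "A a x \<in> M" if "a \<in> out i" "tgt a \<noteq> j" "x \<in> K" for a x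
  proof -
    have "e (tgt a) x \<in> D j (D i K)" using m0[OF out_tgt[OF that(1)] that(2,3)] .
    then have "A a (e (tgt a) x) \<in> M" unfolding M_def by (rule A_in_D[OF Dji that(1)])
    then show ?thesis using A_tgt[OF outD(1)[OF that(1)]] by simp
  qed
  have m3': "A b x \<in> D j (D i K)" if "b \<in> out j" "tgt b \<noteq> i" "x \<in> K" for b x
  proof -
    have "e (tgt b) x \<in> D i K" by (rule e_in_D[OF K out_tgt(1)[OF that(1)] that(2,3)])
    then have "A b (e (tgt b) x) \<in> D j (D i K)" by (rule A_in_D[OF Di that(1)])
    then show ?thesis using A_tgt[OF outD(1)[OF that(1)]] by simp
  qed
  have jM: "A b x \<in> M" if "b \<in> out j" "A b x \<in> D j (D i K)" for b x
    using e_in_D[OF Dji j ij[symmetric] that(2)] e_src[of b x] outD[OF that(1)] by (simp add: M_def)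
  have m3: "A b x \<in> M" if "b \<in> out j" "tgt b \<noteq> i" "x \<in> K" for b x
    using jM m3' that by blast
  have \<alpha>o: "\<alpha> \<in> out i" and \<beta>o: "\<beta> \<in> out j" using \<alpha> \<beta> by (auto simp: out_def)
  have m4: "A \<alpha> (A b x) \<in> M" if "b \<in> out j" "tgt b \<noteq> i" "x \<in> K" for b x
    unfolding M_def using A_in_D[OF Dji \<alpha>o] m3'[OF that] by blast
  have m5: "A \<beta> (A a x) \<in> M" if "a \<in> out i" "tgt a \<noteq> j" "x \<in> K" for a x
    using jM[OF \<beta>o] A_in_D[OF Di \<beta>o] A_in_D[OF K that(1,3)] by blast
  \<comment> \<open>In the relation at \<open>k\<close> all summands except the one of \<gamma> lie
    in \<open>M\<close> by assumption, hence so does that one; its sign is irrelevant in a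
    subgroup.\<close>
  have rel: "A \<gamma> (A (st \<gamma>) y) \<in> M"
    if \<gamma>: "\<gamma> \<in> out k" and k: "k \<in> V" and y: "y \<in> K"
      and other: "\<And>a x. a \<in> out k \<Longrightarrow> a \<noteq> \<gamma> \<Longrightarrow> x \<in> K \<Longrightarrow> A a x \<in> M" for k \<gamma> y
  proof -
    have "(\<Sum>a\<in>out k. A a (B a y)) \<in> M"
      using relation[OF k, of y] sub_N[OF sM] by (simp add: out_def)
    moreover have "(\<Sum>a\<in>out k - {\<gamma>}. A a (B a y)) \<in> M"
    proof (rule sub_sum[OF sM])
      fix a assume a: "a \<in> out k - {\<gamma>}"
      then have "a \<in> E" by (simp add: out_def)
      then have "B a y \<in> K"
        using sub_B[OF left_idealD(1)[OF K]] left_idealD(3)[OF K st_E y] by blast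
      then show "A a (B a y) \<in> M" using other a by blast
    qed
    moreover have "A \<gamma> (B \<gamma> y) = (\<Sum>a\<in>out k. A a (B a y)) - (\<Sum>a\<in>out k - {\<gamma>}. A a (B a y))"
      using sum.remove[OF finite_out \<gamma>, of "\<lambda>a. A a (B a y)"] by simp
    ultimately have "A \<gamma> (B \<gamma> y) \<in> M" using sub_diff[OF sM] by simp
    then show ?thesis
      using B_st[OF outD(1)[OF \<gamma>], of y] sub_minus[OF sM, of "A \<gamma> (B \<gamma> y)"]
      by (auto simp: A_minus)
  qed
  have m6: "A \<alpha> (A \<beta> y) \<in> M" if "y \<in> K" for y
  proof -
    have "A a x \<in> M" if "a \<in> out i" "a \<noteq> \<alpha>" "x \<in> K" for a x
      using m2[OF that(1) _ that(3)] \<alpha>u[OF outD[OF that(1)]] that(2) by blast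
    then show ?thesis unfolding \<beta>_def using rel[OF \<alpha>o i that] by blast
  qed
  have m7: "A \<beta> (A \<alpha> y) \<in> M" if "y \<in> K" for y
  proof -
    have "A b x \<in> M" if "b \<in> out j" "b \<noteq> \<beta>" "x \<in> K" for b x
      using m3[OF that(1) _ that(3)] \<beta>u[OF outD[OF that(1)]] that(2) by blast
    then show ?thesis using rel[OF \<beta>o j that] \<beta>(4) by auto
  qed
  have pull: "subgroup_over {z. A a z \<in> M}" if "a \<in> E" for a
    using sub_N[OF sM] sub_diff[OF sM] N_A[OF that] by (auto simp: subgroup_over_def A_diff)
  show ?thesis unfolding M_def[symmetric]
  proof (rule D_least[OF sM])
    fix t x assume t: "t \<in> V" "t \<noteq> j" "x \<in> D i (D j K)"
    show "e t x \<in> M"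
    proof (cases "t = i")
      case False
      then show ?thesis using m1 t D_subset[OF K] D_subset[OF Dj] by blast
    next
      case True
      show ?thesis unfolding True
      proof (rule D_local_in[OF sM t(3)])
        fix a y assume a: "a \<in> out i" and y: "y \<in> D j K"
        show "A a y \<in> M"
        proof (cases "tgt a = j")
          case False
          then show ?thesis using m2 a y D_subset[OF K] by blast
        next
          case True
          then have "a = \<alpha>" using \<alpha>u[OF outD[OF a]] by blast
          have "e j y \<in> {z. A \<alpha> z \<in> M}"
          proof (rule D_local_in[OF pull[OF \<alpha>(1)] y])
            fix b z assume b: "b \<in> out j" "z \<in> K"
            then show "A b z \<in> {z. A \<alpha> z \<in> M}"
              using m4[OF b(1) _ b(2)] m6[OF b(2)] \<beta>u[OF outD[OF b(1)]] by blast
          qed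
          then show ?thesis using A_tgt[OF \<alpha>(1), of y] \<alpha>(3) \<open>a = \<alpha>\<close> by simp
        qed
      qed
    qed
  next
    fix b x assume b: "b \<in> out j" and x: "x \<in> D i (D j K)"
    show "A b x \<in> M"
    proof (cases "tgt b = i")
      case False
      then show ?thesis using m3 b x D_subset[OF K] D_subset[OF Dj] by blast
    next
      case True
      then have "b = \<beta>" using \<beta>u[OF outD[OF b]] by blast
      have "e i x \<in> {z. A \<beta> z \<in> M}"
      proof (rule D_local_in[OF pull[OF \<beta>(1)] x])
        fix a y assume a: "a \<in> out i" "y \<in> D j K"
        then have "y \<in> K" using D_subset[OF K] by blast
        then show "A a y \<in> {z. A \<beta> z \<in> M}"
          using m5[OF a(1)] m7 \<alpha>u[OF outD[OF a(1)]] by blast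
      qed
      then show ?thesis using A_tgt[OF \<beta>(1), of x] \<beta>(3) \<open>b = \<beta>\<close> by simp
    qed
  qed
qed

lemma D_braid:
  assumes "left_ideal K" "i \<in> V" "j \<in> V" "i \<noteq> j" "links i j = 1"
  shows "D i (D j (D i K)) = D j (D i (D j K))"
proof -
  have l: "links j i = 1" using assms(5) links_sym[of j i] by simp
  show ?thesis
    using D_braid_subset[OF assms(1) assms(2,3,4,5)]
      D_braid_subset[OF assms(1) assms(3,2) assms(4)[symmetric] l]
    by (rule subset_antisym[rotated])
qed

section \<open>Alternating products at two vertices\<close>

lemma left_ideal_alt:
  assumes "left_ideal J" "i \<in> V" "j \<in> V"
  shows "left_ideal (foldr D (altw i j r) J)"
  using assms by (induction r arbitrary: i j) (auto intro: left_ideal_D)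

lemma alt_subset:
  assumes "left_ideal J" "i \<in> V" "j \<in> V"
  shows "foldr D (altw i j r) J \<subseteq> J"
  using assms(2,3)
proof (induction r arbitrary: i j)
  case (Suc r)
  have "D i (foldr D (altw j i r) J) \<subseteq> foldr D (altw j i r) J"
    by (rule D_subset[OF left_ideal_alt[OF assms(1) Suc.prems(2,1)]])
  then show ?case using Suc.IH[OF Suc.prems(2,1)] by simp
qed simp

text \<open>Exactness writes \<open>x\<close>, modulo elements that are harmless by induction, as \<open>\<alpha>\<^sup>* y\<close> with
  \<open>y \<in> J\<close>. If \<open>r \<ge> 2\<close>, then there is a second arrow \<open>\<alpha>'\<close> parallel to \<open>\<alpha>\<close>, and \<open>\<alpha>'\<^sup>* y\<close> satisfies the
  hypothesis for \<open>r - 1\<close>.\<close>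

lemma alt_cancel_arrow:
  assumes "left_ideal J" "i \<in> V" "j \<in> V" "i \<noteq> j" "U i J = J" "U j J = J"
    and "\<alpha> \<in> E" "src \<alpha> = j" "tgt \<alpha> = i"
    and "below_order (links i j) (Suc r)"
    and "x \<in> J" "A \<alpha> x \<in> foldr D (altw j i (Suc r)) J"
  shows "e i x \<in> foldr D (altw i j r) J"
  using assms(2-)
proof (induction r arbitrary: i j \<alpha> x)
  case 0
  then show ?case using left_idealD(2)[OF assms(1)] by simp
next
  case (Suc r)
  define K where "K = foldr D (altw i j (Suc r)) J"
  note \<alpha> = Suc.prems(6-8)
  have lK: "left_ideal K" unfolding K_def by (rule left_ideal_alt[OF assms(1) Suc.prems(1,2)])
  note sK = left_idealD(1)[OF lK] and sJ = left_idealD(1)[OF assms(1)]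
  have KJ: "K \<subseteq> J" unfolding K_def by (rule alt_subset[OF assms(1) Suc.prems(1,2)])
  have "A \<alpha> x \<in> D j K" using Suc.prems(11) by (simp add: K_def)
  then obtain v where v: "\<forall>b\<in>out j. v b \<in> K" "e j (A \<alpha> x) - (\<Sum>b\<in>out j. A b (v b)) \<in> N"
    by (auto simp: D_def)
  have \<alpha>o: "\<alpha> \<in> out j" using \<alpha> by (simp add: out_def)
  \<comment> \<open>The membership of \<open>A \<alpha> x\<close> in \<open>D j K\<close> is
    rewritten as a linear relation among the arrows leaving \<open>j\<close>, with coefficient
    \<open>x - v \<alpha>\<close> at \<alpha> and \<open>- v b\<close> elsewhere, so that
    \<open>exact\<close> applies.\<close>
  define w where "w = (\<lambda>b. (if b = \<alpha> then x else 0) - v b)"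
  have "(\<Sum>b\<in>out j. A b (w b)) = (\<Sum>b\<in>out j. (if b = \<alpha> then A \<alpha> x else 0) - A b (v b))"
    by (rule sum.cong) (auto simp: w_def A_diff A_zero)
  also have "\<dots> = e j (A \<alpha> x) - (\<Sum>b\<in>out j. A b (v b))"
    using \<alpha> \<alpha>o finite_out by (simp add: sum_subtractf e_A)
  finally have "(\<Sum>b\<in>out j. A b (w b)) \<in> N" using v(2) by simp
  then obtain y where y: "\<And>b. b \<in> out j \<Longrightarrow> e (tgt b) (w b) - B b y \<in> N"
    using exact[of j w] Suc.prems(2) unfolding out_def by blast
  have wJ: "w b \<in> J" if "b \<in> out j" for b
  proof -
    have "v b \<in> J" using that v(1) KJ by blast
    then show ?thesis
      using sub_diff[OF sJ, of _ "v b"] Suc.prems(10) sub_zero[OF sJ] unfolding w_def by (cases "b = \<alpha>") force+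
  qed
  have stJ: "A (st b) y \<in> J" if b: "b \<in> out j" for b
  proof -
    have "e (tgt b) (w b) \<in> J" by (rule left_idealD(2)[OF assms(1) out_tgt(1)[OF b] wJ[OF b]])
    then show ?thesis using sub_congr[OF sJ y[OF b]] sub_B[OF sJ] outD(1)[OF b] by blast
  qed
  \<comment> \<open>The arrows that enter \<open>j\<close> are the opposites of those that leave
    \<open>j\<close>, and all of these map \<open>y\<close> into \<open>J\<close>. The assumption
    \<open>U j J = J\<close> then moves the \<open>j\<close>-part of \<open>y\<close> itself into
    \<open>J\<close>.\<close>
  have "e j y \<in> U j J"
  proof -
    have "A \<gamma> (e j y) \<in> J" if \<gamma>: "\<gamma> \<in> E" "tgt \<gamma> = j" for \<gamma>
    proof -
      have "st \<gamma> \<in> out j" using \<gamma> by (simp add: out_def st_E src_st)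
      then show ?thesis using stJ[of "st \<gamma>"] \<gamma> by (simp add: st_st A_e)
    qed
    then show ?thesis using sub_zero[OF sJ] by (auto simp: U_def e_e)
  qed
  then have yJ: "e j y \<in> J" using Suc.prems(5) by simp
  have A_st: "A (st b) (e j y) = A (st b) y" if "b \<in> out j" for b
    using A_e[OF st_E[OF outD(1)[OF that]], of j y] tgt_st outD[OF that] by simp
  have key: "A (st \<alpha>) (e j y) \<in> K"
  proof (cases r)
    case 0
    then show ?thesis
      using A_in_D[OF assms(1), of "st \<alpha>" i "e j y"] yJ \<alpha> by (simp add: K_def out_def st_E src_st)
  next
    case (Suc r')
    \<comment> \<open>Here at least three factors are still below the order of s_i s_j, so the order
      is infinite and there are at least two arrows.\<close>
    have "links j i \<noteq> 0" "links j i \<noteq> 1"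
      using Suc.prems(9) links_sym[of j i] Suc by (auto simp: below_order_def)
    then have "\<not> {a \<in> E. src a = j \<and> tgt a = i} \<subseteq> {\<alpha>}"
      using card_mono[of "{\<alpha>}" "{a \<in> E. src a = j \<and> tgt a = i}"] unfolding links_def by auto
    then obtain \<alpha>' where a': "\<alpha>' \<in> E" "src \<alpha>' = j" "tgt \<alpha>' = i" "\<alpha>' \<noteq> \<alpha>" by blast
    have ao: "\<alpha>' \<in> out j" using a' by (simp add: out_def)
    \<comment> \<open>Unlike \<open>w \<alpha>\<close>, this coefficient does not involve
      \<open>x\<close>: it is the \<open>i\<close>-part of \<open>- v \<alpha>'\<close>. So the
      opposite of \<open>\<alpha>'\<close> maps \<open>y\<close> into \<open>K\<close>, which is the
      hypothesis of the induction with \<open>i\<close> and \<open>j\<close> exchanged.\<close>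
    have "e i (w \<alpha>') \<in> K"
      using a' v(1) ao sub_minus[OF sK] left_idealD(2)[OF lK Suc.prems(1)] by (auto simp: w_def)
    then have "A (st \<alpha>') y \<in> K"
      using y[OF ao] a' sub_congr[OF sK] sub_B[OF sK] by blast
    then have "A (st \<alpha>') (e j y) \<in> foldr D (altw i j (Suc r)) J" 
      using A_st[OF ao] by (simp add: K_def)
    then have "e j (e j y) \<in> foldr D (altw j i r) J"
      using Suc.IH[of j i "st \<alpha>'" "e j y"] Suc.prems a' yJ links_sym[of i j] st_E src_st tgt_st
        below_order_mono[of "links i j" "Suc (Suc r)" "Suc r"] by simp
    then have "e j y \<in> foldr D (altw j i r) J" by (simp add: e_e)
    then show ?thesis
      using A_in_D[OF left_ideal_alt[OF assms(1) Suc.prems(2,1)], of "st \<alpha>" i] \<alpha>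
      by (simp add: K_def out_def st_E src_st)
  qed
  then have "B \<alpha> y \<in> K" using A_st[OF \<alpha>o] sub_B[OF sK \<alpha>(1)] by simp
  then have "e i (w \<alpha>) \<in> K" using y[OF \<alpha>o] \<alpha>(3) sub_congr[OF sK] by blast
  moreover have "e i (v \<alpha>) \<in> K" using v(1) \<alpha>o left_idealD(2)[OF lK Suc.prems(1)] by blast
  ultimately have "e i (w \<alpha>) + e i (v \<alpha>) \<in> K" using sub_add[OF sK] by blast
  then show ?case by (simp add: w_def e_diff K_def)
qed

text \<open>Only the \<open>i\<close>-part of an element \<open>x\<close> of \<open>U i K\<close> is
  in question. For \<open>r \<ge> 2\<close> there is an arrow from \<open>j\<close> to
  \<open>i\<close>, and \<open>alt_cancel_arrow\<close> places \<open>e i x\<close> in the product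
  with the first letter \<open>j\<close> removed; for \<open>r = 1\<close> that product is
  \<open>J\<close>, which contains \<open>x\<close>. As \<open>i \<noteq> j\<close>, applying
  \<open>D j\<close> keeps \<open>e i x\<close>.\<close>

lemma U_alt:
  assumes J: "left_ideal J" and i: "i \<in> V" and j: "j \<in> V" and ij: "i \<noteq> j"
    and UJ: "U i J = J" "U j J = J" and b: "below_order (links i j) r"
  shows "U i (foldr D (altw j i r) J) = foldr D (altw j i r) J"
proof
  define K where "K = foldr D (altw j i r) J"
  have lK: "left_ideal K" unfolding K_def by (rule left_ideal_alt[OF J j i])
  have KJ: "K \<subseteq> J" unfolding K_def by (rule alt_subset[OF J j i])
  show "K \<subseteq> U i K" by (rule subset_U[OF lK])
  show "U i K \<subseteq> K"
  proof (cases r)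
    case 0
    then show ?thesis using UJ by (simp add: K_def)
  next
    case (Suc r')
    show ?thesis
    proof
      fix x assume x: "x \<in> U i K"
      then have "x \<in> U i J" using KJ by (auto simp: U_def)
      then have xJ: "x \<in> J" using UJ by simp
      have ei: "e i x \<in> foldr D (altw i j r') J"
      proof (cases r')
        case 0
        then show ?thesis using xJ left_idealD(2)[OF J i] by simp
      next
        case (Suc r'')
        then have "links j i \<noteq> 0" using b \<open>r = Suc r'\<close> links_sym[of i j] by (auto simp: below_order_def)
        then have "{a \<in> E. src a = j \<and> tgt a = i} \<noteq> {}" unfolding links_def by force
        then obtain \<alpha> where \<alpha>: "\<alpha> \<in> E" "src \<alpha> = j" "tgt \<alpha> = i" by blast
        then have "A \<alpha> x \<in> K" using x by (simp add: U_def)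
        then show ?thesis
          using alt_cancel_arrow[OF J i j ij UJ \<alpha> _ xJ, of r'] b \<open>r = Suc r'\<close> by (simp add: K_def)
      qed
      show "x \<in> K"
      proof (rule sub_local[OF left_idealD(1)[OF lK]])
        fix t assume t: "t \<in> V"
        show "e t x \<in> K"
        proof (cases "t = i")
          case False
          then show ?thesis using x t by (simp add: U_def)
        next
          case True
          show ?thesis
            using e_in_D[OF left_ideal_alt[OF J i j] i ij ei] True Suc by (simp add: K_def e_e)
        qed
      qed
    qed
  qed
qed

theorem braid_operatorsI:
  assumes "\<And>i. i \<in> V \<Longrightarrow> D i UNIV \<noteq> UNIV"
  shows "braid_operators V links D U left_ideal UNIV"
proof
  show "left_ideal UNIV" by (simp add: left_ideal_def)
  show "U i UNIV = UNIV" for i by (simp add: U_def)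
qed (rule links_sym left_ideal_D D_idem U_D D_commute D_braid U_alt assms; assumption?)+

end

section \<open>Formal power series of paths\<close>

lemma sum_apply: "(\<Sum>x\<in>X. f x) y = (\<Sum>x\<in>X. f x y)"
  by (induction X rule: infinite_finite_induct) auto

lemma uminus_fun_apply: "(- f) x = - f x" for f :: "'a \<Rightarrow> 'b :: ab_group_add"
  by (simp add: fun_Compl_def)

lemma minus_fun_apply: "(f - g) x = f x - g x" for f g :: "'a \<Rightarrow> 'b :: ab_group_add"
  by (simp add: fun_diff_def)

definition scale :: "'k :: field \<Rightarrow> ('x \<Rightarrow> 'k) \<Rightarrow> 'x \<Rightarrow> 'k" where "scale c f = (\<lambda>x. c * f x)"

lemma scale_apply: "scale c f x = c * f x" by (simp add: scale_def)

text \<open>Left multiplication by the idempotent at \<open>i\<close>, see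
  \<open>conv_idem\<close>.\<close>

definition vpart :: "'v \<Rightarrow> (('v, 'b) path \<Rightarrow> 'k :: field) \<Rightarrow> ('v, 'b) path \<Rightarrow> 'k" where
  "vpart i f = (\<lambda>(u, p). if u = i then f (u, p) else 0)"

definition hpart :: "nat \<Rightarrow> (('v, 'b) path \<Rightarrow> 'k :: field) \<Rightarrow> ('v, 'b) path \<Rightarrow> 'k" where
  "hpart d f = (\<lambda>(u, p). if length p = d then f (u, p) else 0)"

definition trunc :: "nat \<Rightarrow> (('v, 'b) path \<Rightarrow> 'k :: field) \<Rightarrow> ('v, 'b) path \<Rightarrow> 'k" where
  "trunc d f = (\<lambda>(u, p). if length p < d then f (u, p) else 0)"

lemma vpart_apply: "vpart i f (u, p) = (if u = i then f (u, p) else 0)"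
  and hpart_apply: "hpart d f (u, p) = (if length p = d then f (u, p) else 0)"
  and trunc_apply: "trunc d f (u, p) = (if length p < d then f (u, p) else 0)"
  by (simp_all add: vpart_def hpart_def trunc_def)

context pre_digraph
begin

text \<open>The product of the path algebra, on all functions. It needs no finite support because a
  path has only finitely many splittings.\<close>

definition conv :: "(('a, 'b) path \<Rightarrow> 'k :: field) \<Rightarrow> (('a, 'b) path \<Rightarrow> 'k) \<Rightarrow> ('a, 'b) path \<Rightarrow> 'k" where
  "conv f g = (\<lambda>(u, p). \<Sum>i\<le>length p.
     f (u, take i p) * g (last (awalk_verts u (take i p)), drop i p))"

definition unit :: "('a, 'b) path \<Rightarrow> 'k :: field" where
  "unit = (\<lambda>(u, p). if u \<in> verts G \<and> p = [] then 1 else 0)"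

text \<open>Left multiplication by the arrow \<open>a\<close>, see
  \<open>conv_arrow_elem\<close>.\<close>

definition arr :: "'b \<Rightarrow> (('a, 'b) path \<Rightarrow> 'k :: field) \<Rightarrow> ('a, 'b) path \<Rightarrow> 'k" where
  "arr a f = (\<lambda>(u, p). case p of [] \<Rightarrow> 0
     | b # q \<Rightarrow> if b = a \<and> u = tail G a then f (head G a, q) else 0)"

text \<open>The left derivative with respect to the first arrow: a series is its constant part plus
  the sum of the \<open>arr a (der a f)\<close>, see \<open>expansion\<close>.\<close>

definition der :: "'b \<Rightarrow> (('a, 'b) path \<Rightarrow> 'k :: field) \<Rightarrow> ('a, 'b) path \<Rightarrow> 'k" where
  "der a f = (\<lambda>(u, p). if u = head G a then f (tail G a, a # p) else 0)"

text \<open>Removes the values at pairs that are not paths, so that the operators can act on a whole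
  function type.\<close>

definition res :: "(('a, 'b) path \<Rightarrow> 'k :: field) \<Rightarrow> ('a, 'b) path \<Rightarrow> 'k" where
  "res f = (\<lambda>x. if x \<in> paths G then f x else 0)"

definition series :: "(('a, 'b) path \<Rightarrow> 'k :: field) set" where
  "series = {f. \<forall>x. x \<notin> paths G \<longrightarrow> f x = 0}"

definition polys :: "(('a, 'b) path \<Rightarrow> 'k :: field) set" where
  "polys = {f. finite {x. f x \<noteq> 0} \<and> {x. f x \<noteq> 0} \<subseteq> paths G}"

lemma unit_apply: "unit (u, p) = (if u \<in> verts G \<and> p = [] then 1 else 0)"
  and arr_apply: "arr a f (u, p) = (case p of [] \<Rightarrow> 0
     | b # q \<Rightarrow> if b = a \<and> u = tail G a then f (head G a, q) else 0)"
  and der_apply: "der a f (u, p) = (if u = head G a then f (tail G a, a # p) else 0)"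
  and res_apply: "res f x = (if x \<in> paths G then f x else 0)"
  by (simp_all add: unit_def arr_def der_def res_def)

lemma conv_Nil: "conv f g (u, []) = f (u, []) * g (u, [])"
  by (simp add: conv_def)

text \<open>The recursion behind the inductions on paths. The shifted left factor ignores its
  starting vertex; this is harmless, as \<open>conv\<close> evaluates it at \<open>head G a\<close>
  only, and \<open>conv_cong_left\<close> exploits this freedom.\<close>

lemma conv_Cons: "conv f g (u, a # p) = f (u, []) * g (u, a # p)
    + conv (\<lambda>(v, q). f (u, a # q)) g (head G a, p)"
  by (simp add: conv_def sum.atMost_Suc_shift del: sum.atMost_Suc)

lemma conv_cong_left:
  "(\<And>q. f (u, q) = f' (u, q)) \<Longrightarrow> conv f g (u, p) = conv f' g (u, p)"
  by (simp add: conv_def)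

lemma conv_add_left: "conv (f + f') g = conv f g + conv f' g"
  by (rule ext) (simp add: conv_def split_beta sum.distrib algebra_simps)

lemma conv_add_right: "conv f (g + g') = conv f g + conv f g'"
  by (rule ext) (simp add: conv_def split_beta sum.distrib algebra_simps)

lemma conv_scale_left: "conv (scale c f) g = scale c (conv f g)"
  by (rule ext) (simp add: conv_def scale_apply split_beta sum_distrib_left algebra_simps)

lemma conv_scale_right: "conv f (scale c g) = scale c (conv f g)"
  by (rule ext) (simp add: conv_def scale_apply split_beta sum_distrib_left algebra_simps)

lemma conv_zero_left: "conv 0 g = 0"
  by (simp add: conv_def fun_eq_iff)

lemma conv_sum_left: "conv (\<Sum>x\<in>X. f x) g = (\<Sum>x\<in>X. conv (f x) g)"
  by (rule ext) (simp add: conv_def split_beta sum_apply sum_distrib_right sum.swap[of _ X])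

lemma conv_assoc_apply: "conv (conv f g) h (u, p) = conv f (conv g h) (u, p)"
proof (induction p arbitrary: u f g)
  case Nil
  then show ?case by (simp add: conv_Nil)
next
  case (Cons a p)
  let ?f = "\<lambda>(v :: 'a, q). f (u, a # q)" and ?g = "\<lambda>(v :: 'a, q). g (u, a # q)"
  have "conv (\<lambda>(v, q). conv f g (u, a # q)) h (head G a, p)
      = conv (scale (f (u, [])) ?g + conv ?f g) h (head G a, p)"
    by (rule conv_cong_left) (simp add: conv_Cons scale_apply)
  also have "\<dots> = f (u, []) * conv ?g h (head G a, p) + conv (conv ?f g) h (head G a, p)"
    by (simp add: conv_add_left conv_scale_left scale_apply)
  also have "conv (conv ?f g) h (head G a, p) = conv ?f (conv g h) (head G a, p)"
    by (rule Cons.IH)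
  finally show ?case by (simp add: conv_Cons conv_Nil algebra_simps)
qed

lemma conv_assoc: "conv (conv f g) h = conv f (conv g h)"
  using conv_assoc_apply by (auto simp: fun_eq_iff)

lemma conv_idem: "conv (path_elem (i, [])) f = vpart i f"
proof
  fix x :: "('a, 'b) path"
  obtain u p where x: "x = (u, p)" by force
  have z: "(\<lambda>(v, q). path_elem (i, []) (u, a # q)) = 0" for a :: 'b and u :: 'a
    by (auto simp: path_elem_def fun_eq_iff)
  show "conv (path_elem (i, [])) f x = vpart i f x"
    by (cases p) (simp_all add: x conv_Nil conv_Cons z conv_zero_left, auto simp: path_elem_def vpart_apply)
qed

lemma conv_arr: "conv (arr a f) g = arr a (conv f g)"
proof
  fix x :: "('a, 'b) path"
  obtain u p where x: "x = (u, p)" by force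
  show "conv (arr a f) g x = arr a (conv f g) x"
  proof (cases p)
    case (Cons b q)
    have "conv (\<lambda>(v :: 'a, r). arr a f (u, b # r)) g (head G b, q) =
       conv (if b = a \<and> u = tail G a then f else 0) g (head G b, q)"
      by (rule conv_cong_left) (simp add: arr_apply)
    then show ?thesis
      unfolding x Cons conv_Cons by (simp add: arr_apply conv_zero_left)
  qed (simp add: x conv_Nil arr_apply)
qed

lemma arrow_elem_arr: "arrow_elem G a = arr a (path_elem (head G a, []))"
  by (auto simp: arrow_elem_def path_elem_def arr_apply fun_eq_iff split: list.splits)

lemma vpart_head_arr: "arr a (vpart i f) = (if i = head G a then arr a f else 0)"
  by (auto simp: arr_apply vpart_apply fun_eq_iff split: list.splits)

lemma vpart_arr: "vpart i (arr a f) = (if i = tail G a then arr a f else 0)"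
  by (auto simp: arr_apply vpart_apply fun_eq_iff split: list.splits)

lemma conv_arrow_elem: "conv (arrow_elem G a) f = arr a f"
  unfolding arrow_elem_arr conv_arr conv_idem by (simp add: vpart_head_arr)

lemma vpart_vpart: "vpart i (vpart j f) = (if i = j then vpart i f else 0)"
  by (auto simp: vpart_apply fun_eq_iff)

lemma paths_Nil: "(u, []) \<in> paths G \<longleftrightarrow> u \<in> verts G"
  by (auto simp: paths_def awalk_def)

end

context fin_digraph
begin

lemma paths_Cons: "(u, a # p) \<in> paths G \<longleftrightarrow> a \<in> arcs G \<and> u = tail G a \<and> (head G a, p) \<in> paths G"
  by (auto simp: paths_def awalk_def)

lemma paths_verts: "(u, p) \<in> paths G \<Longrightarrow> u \<in> verts G"
  by (auto simp: paths_def awalk_def)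

lemma paths_append: "(u, p) \<in> paths G \<Longrightarrow> (last (awalk_verts u p), q) \<in> paths G \<Longrightarrow> (u, p @ q) \<in> paths G"
  by (induction p arbitrary: u) (auto simp: paths_Cons)

lemma end_verts: "(u, p) \<in> paths G \<Longrightarrow> last (awalk_verts u p) \<in> verts G"
  by (induction p arbitrary: u) (auto simp: paths_Cons paths_Nil)

lemma seriesD: "f \<in> series \<Longrightarrow> x \<notin> paths G \<Longrightarrow> f x = 0"
  unfolding series_def by blast

lemma seriesI: "(\<And>x. x \<notin> paths G \<Longrightarrow> f x = 0) \<Longrightarrow> f \<in> series"
  unfolding series_def by blast

lemma polys_series: "f \<in> polys \<Longrightarrow> f \<in> series"
  by (auto simp: polys_def series_def)

lemma series_conv:
  assumes "f \<in> series" "g \<in> series"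
  shows "conv f g \<in> series"
proof (rule seriesI)
  fix x assume x: "x \<notin> paths G"
  obtain u p where up: "x = (u, p)" by force
  have z: "f (u, take i p) * g (last (awalk_verts u (take i p)), drop i p) = 0" for i
    using paths_append[of u "take i p" "drop i p"] x up seriesD[OF assms(1)] seriesD[OF assms(2)]
    by (metis append_take_drop_id mult_eq_0_iff)
  show "conv f g x = 0" unfolding up conv_def prod.case by (rule sum.neutral) (use z in blast)
qed

lemma conv_unit_left: "f \<in> series \<Longrightarrow> conv unit f = f"
proof -
  assume f: "f \<in> series"
  have z: "(\<lambda>(v, q). unit (u, a # q)) = (0 :: ('a, 'b) path \<Rightarrow> 'k :: field)" for a u
    by (auto simp: unit_apply fun_eq_iff)
  have "conv unit f (u, p) = unit (u, []) * f (u, p)" for u p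
    by (cases p) (simp_all only: conv_Nil conv_Cons z conv_zero_left zero_fun_apply add_0_right)
  then have "conv unit f (u, p) = f (u, p)" for u p
    using seriesD[OF f, of "(u, p)"] paths_verts[of u p] by (auto simp: unit_apply)
  then show ?thesis by (auto simp: fun_eq_iff)
qed

lemma conv_unit_right: 
  fixes f :: "('a, 'b) path \<Rightarrow> 'k :: field"
  assumes f: "f \<in> series"
  shows "conv f unit = f"
proof -
  have "conv f unit (u, p) = f (u, p)" for u p
  proof -
    have "conv f unit (u, p) = (\<Sum>i\<le>length p. if i = length p then f (u, p) else 0)"
      unfolding conv_def prod.case
    proof (rule sum.cong)
      fix i assume i: "i \<in> {..length p}"
      show "f (u, take i p) * unit (last (awalk_verts u (take i p)), drop i p)
        = (if i = length p then f (u, p) else 0)"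
        using i seriesD[OF f, of "(u, p)"] end_verts[of u p] by (auto simp: unit_apply)
    qed simp
    then show ?thesis by simp
  qed
  then show ?thesis by (auto simp: fun_eq_iff)
qed

lemma series_closed:
  "0 \<in> series" "unit \<in> series" "f \<in> series \<Longrightarrow> g \<in> series \<Longrightarrow> f + g \<in> series"
  "f \<in> series \<Longrightarrow> - f \<in> series" "f \<in> series \<Longrightarrow> scale c f \<in> series"
  "f \<in> series \<Longrightarrow> vpart i f \<in> series" "f \<in> series \<Longrightarrow> hpart d f \<in> series"
  "f \<in> series \<Longrightarrow> a \<in> arcs G \<Longrightarrow> arr a f \<in> series"
  "f \<in> series \<Longrightarrow> a \<in> arcs G \<Longrightarrow> der a f \<in> series" "res h \<in> series"
  by (auto simp: series_def unit_apply paths_Nil uminus_fun_apply scale_apply vpart_apply hpart_apply arr_apply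
      der_apply res_apply paths_Cons split: list.splits)

section \<open>Polynomials among the power series\<close>

lemma finite_paths: "finite {x \<in> paths G. length (snd x) < d}"
proof -
  have "{x \<in> paths G. length (snd x) < d} \<subseteq> verts G \<times> {p. set p \<subseteq> arcs G \<and> length p \<le> d}"
    by (auto simp: paths_def awalk_def)
  then show ?thesis by (rule finite_subset) (intro finite_cartesian_product finite_lists_length_le finite_verts finite_arcs)
qed

text \<open>Finite support amounts to bounded degree because a finite quiver has finitely many paths
  of bounded length. The bound is the easier property to carry through products and
  derivatives.\<close>

lemma polys_iff: "f \<in> polys \<longleftrightarrow> f \<in> series \<and> (\<exists>d. \<forall>x. f x \<noteq> 0 \<longrightarrow> length (snd x) < d)"
proof
  assume f: "f \<in> polys"
  then have "finite ((\<lambda>x. length (snd x)) ` {x. f x \<noteq> 0})" by (simp add: polys_def)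
  then obtain d where "\<forall>n \<in> (\<lambda>x. length (snd x)) ` {x. f x \<noteq> 0}. n < d"
    using finite_nat_bounded by (metis lessThan_iff subsetD)
  then show "f \<in> series \<and> (\<exists>d. \<forall>x. f x \<noteq> 0 \<longrightarrow> length (snd x) < d)"
    using polys_series[OF f] by auto
next
  assume "f \<in> series \<and> (\<exists>d. \<forall>x. f x \<noteq> 0 \<longrightarrow> length (snd x) < d)"
  then obtain d where "f \<in> series" "\<forall>x. f x \<noteq> 0 \<longrightarrow> length (snd x) < d" by blast
  then have "{x. f x \<noteq> 0} \<subseteq> {x \<in> paths G. length (snd x) < d}" by (auto simp: series_def)
  then show "f \<in> polys" using finite_paths finite_subset unfolding polys_def by blast
qed

lemma polysE:
  assumes "f \<in> polys"
  obtains d where "\<And>u p. f (u, p) \<noteq> 0 \<Longrightarrow> length p < d"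
  using assms polys_iff[of f] by (metis snd_conv)

lemma polysI:
  assumes "f \<in> series" "\<And>u p. f (u, p) \<noteq> 0 \<Longrightarrow> length p < d"
  shows "f \<in> polys"
  using assms polys_iff[of f] by (metis prod.collapse)

lemma polys_zero: "0 \<in> polys" by (simp add: polys_def)

lemma polys_unit: "unit \<in> polys"
  by (rule polysI[of _ 1]) (auto simp: series_closed unit_apply split: if_splits)

lemma polys_add:
  assumes "f \<in> polys" "g \<in> polys"
  shows "f + g \<in> polys"
proof -
  obtain d where d: "\<And>u p. f (u, p) \<noteq> 0 \<Longrightarrow> length p < d" using polysE[OF assms(1)] by blast
  obtain d' where d': "\<And>u p. g (u, p) \<noteq> 0 \<Longrightarrow> length p < d'" using polysE[OF assms(2)] by blast
  show ?thesis
  proof (rule polysI[of _ "max d d'"])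
    show "f + g \<in> series" using assms by (simp add: polys_series series_closed)
    fix u p assume "(f + g) (u, p) \<noteq> 0"
    then have "f (u, p) \<noteq> 0 \<or> g (u, p) \<noteq> 0" by auto
    then show "length p < max d d'" using d[of u p] d'[of u p] by linarith
  qed
qed

lemma polys_closed:
  assumes "f \<in> polys"
  shows "- f \<in> polys" "scale c f \<in> polys" "vpart i f \<in> polys" "hpart d f \<in> polys"
    "a \<in> arcs G \<Longrightarrow> arr a f \<in> polys" "a \<in> arcs G \<Longrightarrow> der a f \<in> polys"
proof -
  have s: "f \<in> series" by (rule polys_series[OF assms])
  obtain d' where d': "\<And>u p. f (u, p) \<noteq> 0 \<Longrightarrow> length p < d'" using polysE[OF assms] by blast
  show "- f \<in> polys" "scale c f \<in> polys" "vpart i f \<in> polys" "hpart d f \<in> polys"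
    by (rule polysI[of _ d'], auto simp: s series_closed uminus_fun_apply scale_apply vpart_apply hpart_apply 
        intro: d' split: if_splits)+
  show "arr a f \<in> polys" if "a \<in> arcs G"
    by (rule polysI[of _ "Suc d'"]) (auto simp: s series_closed that arr_apply intro: d' split: if_splits list.splits)
  show "der a f \<in> polys" if "a \<in> arcs G"
  proof (rule polysI[of _ d'])
    fix u p assume "der a f (u, p) \<noteq> 0"
    then have "f (tail G a, a # p) \<noteq> 0" by (auto simp: der_apply split: if_splits)
    then show "length p < d'" using d' by fastforce
  qed (simp add: s series_closed that)
qed

lemma polys_sum: "(\<And>x. x \<in> X \<Longrightarrow> f x \<in> polys) \<Longrightarrow> sum f X \<in> polys"
  by (induction X rule: infinite_finite_induct) (auto simp: polys_zero polys_add)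

lemma polys_conv:
  assumes "f \<in> polys" "g \<in> polys"
  shows "conv f g \<in> polys"
proof -
  obtain d where d: "\<And>u p. f (u, p) \<noteq> 0 \<Longrightarrow> length p < d" using polysE[OF assms(1)] by blast
  obtain d' where d': "\<And>u p. g (u, p) \<noteq> 0 \<Longrightarrow> length p < d'" using polysE[OF assms(2)] by blast
  show ?thesis
  proof (rule polysI[of _ "d + d'"])
    show "conv f g \<in> series" using assms polys_series series_conv by blast
    fix u p assume "conv f g (u, p) \<noteq> 0"
    then obtain i where "i \<le> length p"
      "f (u, take i p) * g (last (awalk_verts u (take i p)), drop i p) \<noteq> 0"
      unfolding conv_def by (auto elim: sum.not_neutral_contains_not_neutral)
    then show "length p < d + d'" using d[of u "take i p"] d'[of _ "drop i p"] by fastforce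
  qed
qed

lemma trunc_polys: "f \<in> series \<Longrightarrow> trunc d f \<in> polys"
  by (rule polysI[of _ d]) (auto simp: series_def trunc_apply split: if_splits)

lemma path_elem_polys: "x \<in> paths G \<Longrightarrow> path_elem x \<in> polys"
  by (auto simp: polys_def path_elem_def)

lemma arrow_elem_polys: "a \<in> arcs G \<Longrightarrow> arrow_elem G a \<in> polys"
  unfolding arrow_elem_arr by (intro polys_closed path_elem_polys) (auto simp: paths_Nil)

lemma arrows_expansion:
  assumes "f \<in> series" "\<And>u. f (u, []) = 0"
  shows "f = (\<Sum>a\<in>arcs G. arr a (der a f))"
proof
  fix x :: "('a, 'b) path"
  obtain u p where x: "x = (u, p)" by force
  show "f x = (\<Sum>a\<in>arcs G. arr a (der a f)) x"
  proof (cases p)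
    case Nil
    then show ?thesis using assms(2) by (simp add: x sum_apply arr_apply)
  next
    case (Cons b q)
    have "(\<Sum>a\<in>arcs G. arr a (der a f) x) = (\<Sum>a\<in>arcs G. if a = b then f x else 0)"
      using seriesD[OF assms(1), of x] by (intro sum.cong) (auto simp: x Cons arr_apply der_apply paths_Cons)
    then show ?thesis
      using seriesD[OF assms(1), of x] by (auto simp: sum_apply x Cons paths_Cons)
  qed
qed

lemma expansion:
  assumes "f \<in> series"
  shows "f = (\<Sum>i\<in>verts G. scale (f (i, [])) (path_elem (i, []))) + (\<Sum>a\<in>arcs G. arr a (der a f))"
proof -
  define c where "c = (\<Sum>i\<in>verts G. scale (f (i, [])) (path_elem (i, [])) :: ('a, 'b) path \<Rightarrow> 'c)"
  have c: "c x = (if snd x = [] then f x else 0)" for x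
  proof -
    obtain u p where x: "x = (u, p)" by force
    have "c x = (\<Sum>i\<in>verts G. if i = u then (if p = [] then f x else 0) else 0)"
      unfolding c_def sum_apply by (rule sum.cong) (auto simp: x scale_apply path_elem_def)
    then show ?thesis using seriesD[OF assms, of x] by (auto simp: x paths_Nil)
  qed
  have d: "der a (f - c) = der a f" for a
    by (auto simp: der_apply fun_eq_iff c minus_fun_apply)
  have "f - c = (\<Sum>a\<in>arcs G. arr a (der a (f - c)))"
    using assms by (intro arrows_expansion) (auto simp: series_def c minus_fun_apply)
  then show ?thesis unfolding c_def[symmetric] d by (simp add: algebra_simps)
qed

text \<open>The completed path algebra; \<Lambda> will be its quotient by the series in
  \<open>null\<close>.\<close>

definition series_algebra :: "(('a, 'b) path \<Rightarrow> 'k :: field) ring" where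
  "series_algebra = \<lparr>carrier = series, mult = conv, one = unit, zero = 0, add = (+)\<rparr>"

lemma path_algebra_eq:
  "path_algebra G = \<lparr>carrier = polys, mult = conv, one = unit, zero = 0, add = (+)\<rparr>"
  by (simp add: path_algebra_def polys_def conv_def unit_def fun_eq_iff plus_fun_def zero_fun_def)

lemma ring_conv:
  assumes "C \<subseteq> series" "0 \<in> C" "unit \<in> C" "\<And>f g. f \<in> C \<Longrightarrow> g \<in> C \<Longrightarrow> f + g \<in> C"
    "\<And>f. f \<in> C \<Longrightarrow> - f \<in> C" "\<And>f g. f \<in> C \<Longrightarrow> g \<in> C \<Longrightarrow> conv f g \<in> C"
  shows "ring \<lparr>carrier = C, mult = conv, one = unit, zero = 0, add = (+)\<rparr>"
proof (rule ringI)
  show "abelian_group \<lparr>carrier = C, mult = conv, one = unit, zero = 0, add = (+)\<rparr>"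
    by (rule abelian_groupI) (use assms in \<open>auto simp: algebra_simps intro!: bexI[of _ "- _"]\<close>)
  show "monoid \<lparr>carrier = C, mult = conv, one = unit, zero = 0, add = (+)\<rparr>"
    by (rule monoidI) (use assms in \<open>auto simp: conv_assoc conv_unit_left conv_unit_right subset_iff\<close>)
qed (auto simp: conv_add_left conv_add_right)

lemma ring_path_algebra: "ring (path_algebra G :: (('a, 'b) path \<Rightarrow> 'k :: field) ring)"
  unfolding path_algebra_eq
  by (rule ring_conv) (auto simp: polys_series polys_zero polys_unit polys_add polys_closed polys_conv)

lemma ring_series_algebra: "ring (series_algebra :: (('a, 'b) path \<Rightarrow> 'k :: field) ring)"
  unfolding series_algebra_def
  by (rule ring_conv) (auto simp: series_closed series_conv)

end

section \<open>The preprojective relations\<close>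

lemma scale_add: "scale c (f + g) = scale c f + scale c g"
  by (simp add: fun_eq_iff scale_apply algebra_simps)

lemma scale_minus_one: "scale (- 1) f = - f"
  by (simp add: fun_eq_iff scale_apply uminus_fun_apply)

lemma scale_zero: "scale c 0 = 0"
  by (simp add: fun_eq_iff scale_apply)

lemma vpart_add: "vpart i (f + g) = vpart i f + vpart i g"
  and vpart_diff: "vpart i (f - g) = vpart i f - vpart i g"
  and vpart_zero: "vpart i 0 = 0"
  and vpart_scale: "vpart i (scale c f) = scale c (vpart i f)"
  and vpart_sum: "vpart i (\<Sum>x\<in>X. h x) = (\<Sum>x\<in>X. vpart i (h x))"
  by (auto simp: fun_eq_iff scale_apply vpart_apply minus_fun_apply sum_apply)

lemma hpart_add: "hpart d (f + g) = hpart d f + hpart d g"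
  and hpart_diff: "hpart d (f - g) = hpart d f - hpart d g"
  and hpart_zero: "hpart d 0 = 0"
  and hpart_scale: "hpart d (scale c f) = scale c (hpart d f)"
  and hpart_sum: "hpart d (\<Sum>x\<in>X. h x) = (\<Sum>x\<in>X. hpart d (h x))"
  and hpart_vpart: "hpart d (vpart i f) = vpart i (hpart d f)"
  by (auto simp: fun_eq_iff scale_apply hpart_apply vpart_apply minus_fun_apply sum_apply)

context pre_digraph
begin

lemma arr_add: "arr a (f + g) = arr a f + arr a g"
  and arr_diff: "arr a (f - g) = arr a f - arr a g"
  and arr_zero: "arr a 0 = 0"
  and arr_scale: "arr a (scale c f) = scale c (arr a f)"
  and hpart_arr: "hpart d (arr a f) = (case d of 0 \<Rightarrow> 0 | Suc e \<Rightarrow> arr a (hpart e f))"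
  by (auto simp: fun_eq_iff scale_apply arr_apply hpart_apply minus_fun_apply split: list.splits nat.splits)

lemma der_add: "der a (f + g) = der a f + der a g"
  and der_sum: "der a (\<Sum>x\<in>X. h x) = (\<Sum>x\<in>X. der a (h x))"
  and der_arr: "der a (arr b f) = (if a = b then vpart (head G a) f else 0)"
  and hpart_der: "hpart d (der a f) = der a (hpart (Suc d) f)"
  by (auto simp: fun_eq_iff scale_apply arr_apply der_apply vpart_apply hpart_apply sum_apply)

lemma res_add: "res (f + g) = res f + res g"
  and res_diff: "res (f - g) = res f - res g"
  and res_zero: "res 0 = 0"
  and res_scale: "res (scale c f) = scale c (res f)"
  and res_sum: "res (\<Sum>x\<in>X. h x) = (\<Sum>x\<in>X. res (h x))"
  by (auto simp: fun_eq_iff scale_apply res_apply minus_fun_apply sum_apply)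

lemma res_series: "f \<in> series \<Longrightarrow> res f = f"
  by (auto simp: fun_eq_iff res_apply series_def)

lemma res_vpart: "res (vpart i f) = vpart i (res f)"
  by (auto simp: fun_eq_iff vpart_apply res_apply)

end

lemma (in fin_digraph) res_arr: "a \<in> arcs G \<Longrightarrow> res (arr a f) = arr a (res f)"
  and res_der: "a \<in> arcs G \<Longrightarrow> res (der a f) = der a (res f)"
  by (auto simp: fun_eq_iff arr_apply der_apply res_apply paths_Cons split: list.splits)

text \<open>Treats arrows and added arrows alike: with the signs \<open>sg\<close>, the sum of
  commutators becomes a single signed sum over all arrows of the double quiver.\<close>

locale doubled_digraph = fin_digraph G for G :: "('a, 'b) pre_digraph" +
  fixes st :: "'b \<Rightarrow> 'b" and sg :: "'b \<Rightarrow> 'k :: field"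
  assumes st_arcs: "a \<in> arcs G \<Longrightarrow> st a \<in> arcs G"
    and st_st: "a \<in> arcs G \<Longrightarrow> st (st a) = a"
    and tail_st: "a \<in> arcs G \<Longrightarrow> tail G (st a) = head G a"
    and head_st: "a \<in> arcs G \<Longrightarrow> head G (st a) = tail G a"
    and no_loops: "a \<in> arcs G \<Longrightarrow> tail G a \<noteq> head G a"
    and sg: "sg a = 1 \<or> sg a = - 1"
begin

definition star :: "'b \<Rightarrow> (('a, 'b) path \<Rightarrow> 'k) \<Rightarrow> ('a, 'b) path \<Rightarrow> 'k" where
  "star a y = scale (sg a) (arr (st a) y)"

definition relator :: "('a, 'b) path \<Rightarrow> 'k" where
  "relator = (\<Sum>a\<in>arcs G. scale (sg a) (conv (arrow_elem G a) (arrow_elem G (st a))))"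

text \<open>Left multiplication by the relator (\<open>relmul_conv\<close>), written with the first
  arrows split off so that \<open>der_relmul\<close> can read off each coefficient.\<close>

definition relmul :: "(('a, 'b) path \<Rightarrow> 'k) \<Rightarrow> ('a, 'b) path \<Rightarrow> 'k" where
  "relmul y = (\<Sum>a\<in>arcs G. arr a (star a y))"

lemma relmul_conv: "conv relator y = relmul y"
  unfolding relator_def relmul_def conv_sum_left
  by (rule sum.cong) (simp_all add: conv_scale_left conv_arrow_elem conv_arr star_def arr_scale)

lemma conv_relmul: "conv (relmul y) z = relmul (conv y z)"
  unfolding relmul_conv[symmetric] by (rule conv_assoc)

lemma relmul_scale: "relmul (scale c y) = scale c (relmul y)"
  unfolding relmul_conv[symmetric] by (rule conv_scale_right)

lemma star_add: "star a (y + z) = star a y + star a z"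
  by (simp add: star_def arr_add scale_add)

lemma star_zero: "star a 0 = 0"
  by (simp add: star_def arr_zero scale_zero)

lemma star_vpart: "a \<in> arcs G \<Longrightarrow> star a (vpart i y) = (if i = tail G a then star a y else 0)"
  by (simp add: star_def vpart_head_arr head_st scale_zero)

lemma vpart_star: "a \<in> arcs G \<Longrightarrow> vpart i (star a y) = (if i = head G a then star a y else 0)"
  by (simp add: star_def vpart_scale vpart_arr tail_st scale_zero)

lemma vpart_relmul: "vpart i (relmul y) = relmul (vpart i y)"
  unfolding relmul_def vpart_sum
  by (rule sum.cong) (simp_all add: vpart_arr star_vpart arr_zero)

lemma der_relmul: "a \<in> arcs G \<Longrightarrow> der a (relmul y) = star a y"
proof -
  assume a: "a \<in> arcs G"
  have "der a (relmul y) = (\<Sum>b\<in>arcs G. if b = a then vpart (head G a) (star a y) else 0)"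
    unfolding relmul_def der_sum by (rule sum.cong) (auto simp: der_arr)
  then show ?thesis using a by (simp add: vpart_star)
qed

lemma hpart_star: "hpart d (star a y) = (case d of 0 \<Rightarrow> 0 | Suc e \<Rightarrow> star a (hpart e y))"
  by (auto simp: star_def hpart_scale hpart_arr scale_zero split: nat.splits)

lemma hpart_relmul: "hpart d (relmul y) = (if d < 2 then 0 else relmul (hpart (d - 2) y))"
proof -
  have "hpart d (relmul y) = (\<Sum>a\<in>arcs G. if d < 2 then 0 else arr a (star a (hpart (d - 2) y)))"
    unfolding relmul_def hpart_sum
    by (rule sum.cong) (auto simp: hpart_arr hpart_star arr_zero numeral_2_eq_2 split: nat.splits)
  then show ?thesis by (simp add: relmul_def)
qed

lemma star_polys: "y \<in> polys \<Longrightarrow> a \<in> arcs G \<Longrightarrow> star a y \<in> polys"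
  by (simp add: star_def polys_closed st_arcs)

lemma relmul_polys: "y \<in> polys \<Longrightarrow> relmul y \<in> polys"
  unfolding relmul_def by (intro polys_sum) (simp add: polys_closed star_polys)

lemma relator_polys: "relator \<in> polys"
  unfolding relator_def by (intro polys_sum) (simp add: polys_closed polys_conv arrow_elem_polys st_arcs)

text \<open>The two-sided ideal of the relator (\<open>genideal_relator\<close>), generated in a
  restricted way: right factors occur only next to the relator, and left factors are added one arrow
  at a time. This makes the first arrow of each generated term visible, as
  \<open>rel_ideal_der\<close> requires; closure under all multiplications is derived.\<close>

inductive_set rel_ideal :: "(('a, 'b) path \<Rightarrow> 'k) set" where
  zero: "0 \<in> rel_ideal"
| relator: "f \<in> rel_ideal \<Longrightarrow> y \<in> polys \<Longrightarrow> relmul y + f \<in> rel_ideal"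
| arrow: "f \<in> rel_ideal \<Longrightarrow> g \<in> rel_ideal \<Longrightarrow> a \<in> arcs G \<Longrightarrow> arr a f + g \<in> rel_ideal"

text \<open>Induction eta-expands goals about functions, and the rules for pointwise sums would then
  rewrite below the abstractions.\<close>

declare plus_fun_apply [simp del] zero_fun_apply [simp del]

lemma rel_ideal_polys: "f \<in> rel_ideal \<Longrightarrow> f \<in> polys"
  by (induction rule: rel_ideal.induct) (auto simp: polys_zero polys_add polys_closed relmul_polys)

lemma rel_ideal_relmul: "y \<in> polys \<Longrightarrow> relmul y \<in> rel_ideal"
  using rel_ideal.relator[OF rel_ideal.zero, of y] by simp

lemma rel_ideal_arr: "f \<in> rel_ideal \<Longrightarrow> a \<in> arcs G \<Longrightarrow> arr a f \<in> rel_ideal"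
  using rel_ideal.arrow[OF _ rel_ideal.zero, of f a] by simp

lemma rel_ideal_add: "f \<in> rel_ideal \<Longrightarrow> g \<in> rel_ideal \<Longrightarrow> f + g \<in> rel_ideal"
  by (induction rule: rel_ideal.induct) (auto simp: add.assoc intro: rel_ideal.intros)

lemma rel_ideal_scale: "f \<in> rel_ideal \<Longrightarrow> scale c f \<in> rel_ideal"
  by (induction rule: rel_ideal.induct)
    (auto simp: scale_zero scale_add relmul_scale[symmetric] arr_scale[symmetric] polys_closed
      intro: rel_ideal.intros)

lemma rel_ideal_uminus: "f \<in> rel_ideal \<Longrightarrow> - f \<in> rel_ideal"
  using rel_ideal_scale[of f "- 1"] by (simp add: scale_minus_one)

lemma rel_ideal_diff: "f \<in> rel_ideal \<Longrightarrow> g \<in> rel_ideal \<Longrightarrow> f - g \<in> rel_ideal"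
  using rel_ideal_add[of f "- g"] rel_ideal_uminus by simp

lemma rel_ideal_sum: "(\<And>x. x \<in> X \<Longrightarrow> f x \<in> rel_ideal) \<Longrightarrow> sum f X \<in> rel_ideal"
  by (induction X rule: infinite_finite_induct) (auto simp: rel_ideal.zero rel_ideal_add)

lemma rel_ideal_vpart: "f \<in> rel_ideal \<Longrightarrow> vpart i f \<in> rel_ideal"
proof (induction rule: rel_ideal.induct)
  case zero
  then show ?case by (simp add: vpart_zero rel_ideal.zero)
next
  case (relator f y)
  then show ?case by (simp add: vpart_add vpart_relmul rel_ideal.relator polys_closed)
next
  case (arrow f g a)
  then show ?case by (cases "i = tail G a") (auto simp: vpart_add vpart_arr rel_ideal.arrow)
qed

lemma rel_ideal_hpart: "f \<in> rel_ideal \<Longrightarrow> hpart d f \<in> rel_ideal"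
proof (induction arbitrary: d rule: rel_ideal.induct)
  case zero
  then show ?case by (simp add: hpart_zero rel_ideal.zero)
next
  case (relator f y)
  then show ?case by (simp add: hpart_add hpart_relmul rel_ideal.relator polys_closed)
next
  case (arrow f g a)
  then show ?case by (cases d) (simp_all add: hpart_add hpart_arr rel_ideal.arrow)
qed

lemma rel_ideal_conv_right: "f \<in> rel_ideal \<Longrightarrow> z \<in> polys \<Longrightarrow> conv f z \<in> rel_ideal"
  by (induction rule: rel_ideal.induct)
    (auto simp: conv_zero_left conv_add_left conv_relmul conv_arr polys_conv intro: rel_ideal.intros)

text \<open>Induction on the degree of the left factor, whose constant terms act through
  \<open>vpart\<close> and whose first arrows act through \<open>arr\<close> on products with left
  factors of smaller degree.\<close>

lemma rel_ideal_conv_left: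
  assumes "g \<in> polys" "f \<in> rel_ideal"
  shows "conv g f \<in> rel_ideal"
proof -
  obtain d where "\<And>u p. g (u, p) \<noteq> 0 \<Longrightarrow> length p < d" using polysE[OF assms(1)] by blast
  then show ?thesis using assms(1)
  proof (induction d arbitrary: g)
    case 0
    then have "g = 0" by (auto simp: fun_eq_iff zero_fun_apply)
    then show ?case by (simp add: conv_zero_left rel_ideal.zero)
  next
    case (Suc d)
    have "conv (der a g) f \<in> rel_ideal" if a: "a \<in> arcs G" for a
    proof (rule Suc.IH)
      fix u p assume "der a g (u, p) \<noteq> 0"
      then have "g (tail G a, a # p) \<noteq> 0" by (auto simp: der_apply split: if_splits)
      then show "length p < d" using Suc.prems(1) by fastforce
    qed (simp add: polys_closed Suc.prems(2) a)
    then have "(\<Sum>i\<in>verts G. scale (g (i, [])) (vpart i f)) + (\<Sum>a\<in>arcs G. arr a (conv (der a g) f)) \<in> rel_ideal"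
      using assms(2) by (intro rel_ideal_add rel_ideal_sum rel_ideal_scale rel_ideal_vpart rel_ideal_arr) auto
    moreover have "conv g f = (\<Sum>i\<in>verts G. scale (g (i, [])) (vpart i f)) + (\<Sum>a\<in>arcs G. arr a (conv (der a g) f))"
      by (subst expansion[OF polys_series[OF Suc.prems(2)]])
        (simp add: conv_add_left conv_sum_left conv_scale_left conv_idem conv_arr)
    ultimately show ?case by simp
  qed
qed

lemma rel_ideal_Nil: "f \<in> rel_ideal \<Longrightarrow> f (u, []) = 0"
  by (induction rule: rel_ideal.induct)
    (auto simp: relmul_def sum_apply arr_apply plus_fun_apply zero_fun_apply)

text \<open>Exactness for polynomials. A term \<open>relmul y\<close> has the derivative
  \<open>star a y\<close>, and a term \<open>arr b f\<close> with \<open>f\<close> in the ideal has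
  a derivative in the ideal, so \<open>y\<close> collects the contributions of the first
  kind.\<close>

lemma rel_ideal_der:
  assumes "f \<in> rel_ideal"
  shows "\<exists>y\<in>polys. \<forall>a\<in>arcs G. der a f - star a y \<in> rel_ideal"
  using assms
proof (induction rule: rel_ideal.induct)
  case zero
  have "der a 0 - star a 0 = 0" for a by (simp add: star_zero fun_eq_iff der_apply zero_fun_apply)
  then show ?case using polys_zero rel_ideal.zero by metis
next
  case (relator f y)
  then obtain z where z: "z \<in> polys" "\<forall>a\<in>arcs G. der a f - star a z \<in> rel_ideal" by blast
  have "der a (relmul y + f) - star a (y + z) = der a f - star a z" if "a \<in> arcs G" for a
    using that by (simp add: der_add der_relmul star_add)
  then have "\<forall>a\<in>arcs G. der a (relmul y + f) - star a (y + z) \<in> rel_ideal" using z(2) by simp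
  then show ?case using polys_add[OF relator.hyps(2) z(1)] by blast
next
  case (arrow f g b)
  then obtain z where z: "z \<in> polys" "\<forall>a\<in>arcs G. der a g - star a z \<in> rel_ideal" by blast
  have "der a (arr b f + g) - star a z \<in> rel_ideal" if "a \<in> arcs G" for a
    using z(2) that rel_ideal_add[OF rel_ideal_vpart[OF arrow.hyps(1), of "head G a"]]
    by (auto simp: der_add der_arr add_diff_eq[symmetric])
  then show ?case using z(1) by blast
qed

text \<open>The closure of the ideal of relations among the formal infinite combinations of paths;
  the values outside of the paths of \<open>G\<close> do not matter.\<close>

definition null :: "(('a, 'b) path \<Rightarrow> 'k) set" where
  "null = {f. \<forall>d. hpart d (res f) \<in> rel_ideal}"

lemma null_der:
  assumes "f \<in> null"
  shows "\<exists>y. \<forall>a\<in>arcs G. der a f - star a y \<in> null"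
proof -
  have "\<forall>d. \<exists>y\<in>polys. \<forall>a\<in>arcs G. der a (hpart d (res f)) - star a y \<in> rel_ideal"
    using assms rel_ideal_der by (simp add: null_def)
  then obtain y where y: "\<And>d. y d \<in> polys"
    "\<And>d a. a \<in> arcs G \<Longrightarrow> der a (hpart d (res f)) - star a (y d) \<in> rel_ideal" by metis
  \<comment> \<open>The witnesses for the single degrees are glued to one series. The relator has
    degree two, so the part of \<open>z\<close> of degree n must come from the witness for degree n
    + 2.\<close>
  define z where "z = (\<lambda>(u, p). y (length p + 2) (u, p))"
  have "der a f - star a z \<in> null" if a: "a \<in> arcs G" for a
    unfolding null_def
  proof (rule CollectI, rule allI)
    fix d
    have "hpart d (res (star a z)) = hpart d (star a (y (Suc d)))"
    proof (rule ext)
      fix x :: "('a, 'b) path"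
      obtain u p where x: "x = (u, p)" by force
      have "star a (y (Suc d)) \<in> series" using star_polys[OF y(1) a] polys_series by blast
      then show "hpart d (res (star a z)) x = hpart d (star a (y (Suc d))) x"
        using seriesD[of "star a (y (Suc d))" x]
        by (auto simp: x hpart_apply res_apply star_def scale_apply arr_apply z_def split: list.splits)
    qed
    then have "hpart d (res (der a f - star a z)) = hpart d (der a (hpart (Suc d) (res f)) - star a (y (Suc d)))"
      using a by (simp add: res_diff hpart_diff res_der hpart_der) (simp add: hpart_def fun_eq_iff der_apply)
    then show "hpart d (res (der a f - star a z)) \<in> rel_ideal"
      using rel_ideal_hpart[OF y(2)[OF a]] by simp
  qed
  then show ?thesis by blast
qed

lemma null_zero: "0 \<in> null"
  by (simp add: null_def res_zero hpart_zero rel_ideal.zero)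

lemma null_res: "res f = 0 \<Longrightarrow> f \<in> null"
  by (simp add: null_def hpart_zero rel_ideal.zero)

lemma null_diff: "f \<in> null \<Longrightarrow> g \<in> null \<Longrightarrow> f - g \<in> null"
  by (simp add: null_def res_diff hpart_diff rel_ideal_diff)

lemma null_vpart: "f \<in> null \<Longrightarrow> vpart i f \<in> null"
  by (simp add: null_def res_vpart hpart_vpart rel_ideal_vpart)

lemma null_arr: "f \<in> null \<Longrightarrow> a \<in> arcs G \<Longrightarrow> arr a f \<in> null"
  by (auto simp: null_def res_arr hpart_arr rel_ideal_arr rel_ideal.zero split: nat.splits)

lemma hpart_res_polys: "hpart d (res f) \<in> polys"
  by (rule polysI[of _ "Suc d"]) (auto simp: series_closed hpart_apply split: if_splits)

lemma null_relmul: "relmul f \<in> null"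
proof -
  have "res (relmul f) = relmul (res f)"
    by (simp add: relmul_def res_sum res_arr star_def res_scale st_arcs)
  then show ?thesis
    by (simp add: null_def hpart_relmul rel_ideal_relmul hpart_res_polys rel_ideal.zero)
qed

lemma preprojective_module: "preprojective_module (verts G) (arcs G) (tail G) (head G) st vpart arr star null"
proof
  show "x - (\<Sum>i\<in>verts G. vpart i x) \<in> null" for x
  proof (rule null_res, rule ext)
    fix y :: "('a, 'b) path"
    obtain u p where y: "y = (u, p)" by force
    have "(\<Sum>i\<in>verts G. vpart i x y) = (\<Sum>i\<in>verts G. if i = u then x y else 0)"
      by (rule sum.cong) (auto simp: y vpart_apply)
    then show "res (x - (\<Sum>i\<in>verts G. vpart i x)) y = 0 y"
      using paths_verts[of u p] by (auto simp: y res_apply minus_fun_apply sum_apply zero_fun_apply)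
  qed
  show "star a x = arr (st a) x \<or> star a x = - arr (st a) x" for a x
    using sg[of a] by (auto simp: star_def scale_minus_one) (simp add: scale_def)
  show "(\<Sum>a\<in>{a \<in> arcs G. tail G a = i}. arr a (star a x)) \<in> null" for i x
  proof -
    have "vpart i (relmul x) = (\<Sum>a\<in>arcs G. if tail G a = i then arr a (star a x) else 0)"
      unfolding relmul_def vpart_sum by (rule sum.cong) (auto simp: vpart_arr)
    also have "\<dots> = (\<Sum>a\<in>{a \<in> arcs G. tail G a = i}. arr a (star a x))"
      by (simp add: sum.inter_filter)
    finally show ?thesis using null_vpart[OF null_relmul] by metis
  qed
  show "\<exists>y. \<forall>a\<in>{a \<in> arcs G. tail G a = i}. vpart (head G a) (u a) - star a y \<in> null"
    if n: "(\<Sum>a\<in>{a \<in> arcs G. tail G a = i}. arr a (u a)) \<in> null" for i u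
  proof -
    define X where "X = {a \<in> arcs G. tail G a = i}"
    have "finite X" by (simp add: X_def)
    have "der a (\<Sum>b\<in>X. arr b (u b)) = vpart (head G a) (u a)" if "a \<in> X" for a
    proof -
      have "der a (\<Sum>b\<in>X. arr b (u b)) = (\<Sum>b\<in>X. if b = a then vpart (head G a) (u a) else 0)"
        unfolding der_sum by (rule sum.cong) (auto simp: der_arr)
      then show ?thesis using that \<open>finite X\<close> by simp
    qed
    then show ?thesis using null_der[OF n] unfolding X_def by fastforce
  qed
qed (simp_all add: tail_in_verts head_in_verts no_loops st_arcs st_st tail_st head_st vpart_diff
    arr_diff vpart_vpart vpart_arr vpart_head_arr null_zero null_diff null_vpart null_arr)

end

section \<open>The completion as a quotient of the power series\<close>

lemma (in ring_hom_ring) ideal_image: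
  assumes surj: "h ` carrier R = carrier S" and I: "ideal I R"
  shows "ideal (h ` I) S"
proof (rule idealI)
  interpret I: ideal I R by (rule I)
  show "ring S" by (rule S.ring_axioms)
  show "subgroup (h ` I) (add_monoid S)"
    by (rule img_is_add_subgroup[OF I.a_subgroup])
  fix a x assume "a \<in> h ` I" "x \<in> carrier S"
  then obtain b y where b: "b \<in> I" "a = h b" and y: "y \<in> carrier R" "x = h y"
    using surj by blast
  have e: "x \<otimes>\<^bsub>S\<^esub> a = h (y \<otimes> b)" "a \<otimes>\<^bsub>S\<^esub> x = h (b \<otimes> y)" using b y I.Icarr by simp_all
  show "x \<otimes>\<^bsub>S\<^esub> a \<in> h ` I" "a \<otimes>\<^bsub>S\<^esub> x \<in> h ` I"
    unfolding e using I.I_l_closed[OF b(1) y(1)] I.I_r_closed[OF b(1) y(1)] by blast+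
qed

lemma uminus_eq_if_add_eq_plus:
  assumes "R = \<lparr>carrier = C, mult = m, one = u, zero = 0, add = (+)\<rparr>" "ring R"
    "f \<in> carrier R" "- f \<in> carrier R"
  shows "\<ominus>\<^bsub>R\<^esub> f = - (f :: 'x :: ab_group_add)"
proof -
  interpret ring R by (rule assms(2))
  have "- f \<oplus>\<^bsub>R\<^esub> f = \<zero>\<^bsub>R\<^esub>" by (simp add: assms(1))
  then show ?thesis using assms(3,4) minus_equality by blast
qed

context doubled_digraph
begin

abbreviation R :: "(('a, 'b) path \<Rightarrow> 'k) ring" where "R \<equiv> path_algebra G"

abbreviation series_ring :: "(('a, 'b) path \<Rightarrow> 'k) ring" where "series_ring \<equiv> series_algebra"

lemma R_simps: "carrier R = polys" "f \<otimes>\<^bsub>R\<^esub> g = conv f g" "f \<oplus>\<^bsub>R\<^esub> g = f + g" "\<zero>\<^bsub>R\<^esub> = 0" "\<one>\<^bsub>R\<^esub> = unit"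
  by (simp_all add: path_algebra_eq)

lemma series_ring_simps: "carrier series_ring = series" "f \<otimes>\<^bsub>series_ring\<^esub> g = conv f g"
  "f \<oplus>\<^bsub>series_ring\<^esub> g = f + g" "\<zero>\<^bsub>series_ring\<^esub> = 0" "\<one>\<^bsub>series_ring\<^esub> = unit"
  by (simp_all add: series_algebra_def)

lemma R_uminus: "f \<in> polys \<Longrightarrow> \<ominus>\<^bsub>R\<^esub> f = - f"
  by (rule uminus_eq_if_add_eq_plus[OF path_algebra_eq ring_path_algebra]) (simp_all add: R_simps polys_closed)

lemma R_minus: "f \<in> polys \<Longrightarrow> g \<in> polys \<Longrightarrow> f \<ominus>\<^bsub>R\<^esub> g = f - g"
  by (simp add: a_minus_def R_uminus R_simps)

lemma series_uminus: "f \<in> series \<Longrightarrow> \<ominus>\<^bsub>series_ring\<^esub> f = - f"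
  by (rule uminus_eq_if_add_eq_plus[OF series_algebra_def ring_series_algebra])
    (simp_all add: series_ring_simps series_closed)

lemma ideal_R_I:
  assumes "X \<subseteq> polys" "0 \<in> X" "\<And>f g. f \<in> X \<Longrightarrow> g \<in> X \<Longrightarrow> f + g \<in> X" "\<And>f. f \<in> X \<Longrightarrow> - f \<in> X"
    "\<And>f g. f \<in> X \<Longrightarrow> g \<in> polys \<Longrightarrow> conv g f \<in> X" "\<And>f g. f \<in> X \<Longrightarrow> g \<in> polys \<Longrightarrow> conv f g \<in> X"
  shows "ideal X R"
proof (rule idealI[OF ring_path_algebra])
  interpret ring R by (rule ring_path_algebra)
  show "subgroup X (add_monoid R)"
  proof (rule add.subgroupI)
    fix f assume "f \<in> X"
    then show "\<ominus>\<^bsub>R\<^esub> f \<in> X" using assms(1,4) R_uminus by (metis subsetD)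
  qed (use assms in \<open>auto simp: R_simps\<close>)
qed (use assms in \<open>auto simp: R_simps\<close>)

lemma ideal_rel_ideal: "ideal rel_ideal R"
  by (rule ideal_R_I)
    (auto simp: rel_ideal_polys rel_ideal.zero rel_ideal_add rel_ideal_uminus rel_ideal_conv_left
      rel_ideal_conv_right)

lemma genideal_relator: "Idl\<^bsub>R\<^esub> {relator} = rel_ideal"
proof
  interpret ring R by (rule ring_path_algebra)
  have "relator = relmul unit"
    using relmul_conv[of unit] conv_unit_right[OF polys_series[OF relator_polys]] by simp
  then show "Idl\<^bsub>R\<^esub> {relator} \<subseteq> rel_ideal"
    using rel_ideal_relmul[OF polys_unit] by (intro genideal_minimal ideal_rel_ideal) simp
  have r: "relator \<in> carrier R" by (simp add: R_simps relator_polys)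
  interpret I: ideal "Idl\<^bsub>R\<^esub> {relator}" R by (rule genideal_ideal) (use r in simp)
  have rI: "relator \<in> Idl\<^bsub>R\<^esub> {relator}" by (rule genideal_self'[OF r])
  show "rel_ideal \<subseteq> Idl\<^bsub>R\<^esub> {relator}"
  proof
    fix f assume "f \<in> rel_ideal"
    then show "f \<in> Idl\<^bsub>R\<^esub> {relator}"
    proof (induction rule: rel_ideal.induct)
      case zero
      show ?case using I.zero_closed unfolding R_simps .
    next
      case (relator f y)
      then have "relator \<otimes>\<^bsub>R\<^esub> y \<oplus>\<^bsub>R\<^esub> f \<in> Idl\<^bsub>R\<^esub> {relator}"
        using rI I.I_r_closed by (intro I.a_closed) (auto simp: R_simps)
      then show ?case unfolding R_simps relmul_conv .
    next
      case (arrow f g a)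
      then have "arrow_elem G a \<otimes>\<^bsub>R\<^esub> f \<oplus>\<^bsub>R\<^esub> g \<in> Idl\<^bsub>R\<^esub> {relator}"
        using I.I_l_closed by (intro I.a_closed) (auto simp: R_simps arrow_elem_polys)
      then show ?case unfolding R_simps conv_arrow_elem .
    qed
  qed
qed

section \<open>The arrow-adic filtration of the preprojective algebra\<close>

definition proj :: "(('a, 'b) path \<Rightarrow> 'k) \<Rightarrow> (('a, 'b) path \<Rightarrow> 'k) set" where
  "proj f = rel_ideal +>\<^bsub>R\<^esub> f"

definition A where "A = R Quot rel_ideal"

definition arrows where "arrows = Idl\<^bsub>A\<^esub> ((\<lambda>a. proj (arrow_elem G a)) ` arcs G)"

lemma ring_A: "ring A"
  unfolding A_def by (rule ideal.quotient_is_ring[OF ideal_rel_ideal])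

lemma proj_hom: "ring_hom_ring R A proj"
  using ideal.rcos_ring_hom_ring[OF ideal_rel_ideal] unfolding A_def proj_def .

lemma A_carrier: "carrier A = proj ` polys"
  by (auto simp: A_def FactRing_def A_RCOSETS_def' proj_def R_simps)

lemma proj_simps:
  assumes "f \<in> polys" "g \<in> polys"
  shows "proj f \<in> carrier A" "proj (f + g) = proj f \<oplus>\<^bsub>A\<^esub> proj g" "proj (conv f g) = proj f \<otimes>\<^bsub>A\<^esub> proj g"
    "proj (f - g) = proj f \<ominus>\<^bsub>A\<^esub> proj g"
proof -
  interpret p: ring_hom_ring R A proj by (rule proj_hom)
  show "proj f \<in> carrier A" using assms A_carrier by blast
  show "proj (f + g) = proj f \<oplus>\<^bsub>A\<^esub> proj g" "proj (conv f g) = proj f \<otimes>\<^bsub>A\<^esub> proj g"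
    using p.hom_add[of f g] p.hom_mult[of f g] assms by (simp_all add: R_simps)
  have "proj (f \<ominus>\<^bsub>R\<^esub> g) = proj f \<ominus>\<^bsub>A\<^esub> proj g" 
    using assms[folded R_simps(1)] p.R.a_inv_closed[of g] p.hom_add[of f "\<ominus>\<^bsub>R\<^esub> g"]
    unfolding a_minus_def by simp
  then show "proj (f - g) = proj f \<ominus>\<^bsub>A\<^esub> proj g" using R_minus assms by simp
qed

lemma proj_eq_iff:
  assumes "f \<in> polys" "g \<in> polys"
  shows "proj f = proj g \<longleftrightarrow> f - g \<in> rel_ideal"
  using ring.quotient_eq_iff_same_a_r_cos[OF ring_path_algebra ideal_rel_ideal, of f g] assms
  by (simp add: R_simps R_minus proj_def)

text \<open>The polynomials without terms of degree below \<open>m\<close>; their image in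
  \<open>A\<close> is the \<open>m\<close>-th power of the arrow ideal, see
  \<open>ideal_power_low\<close>.\<close>

definition low :: "nat \<Rightarrow> (('a, 'b) path \<Rightarrow> 'k) set" where
  "low m = {f \<in> polys. \<forall>u p. f (u, p) \<noteq> 0 \<longrightarrow> m \<le> length p}"

lemma lowI: "f \<in> polys \<Longrightarrow> (\<And>u p. f (u, p) \<noteq> 0 \<Longrightarrow> m \<le> length p) \<Longrightarrow> f \<in> low m"
  and low_polys: "f \<in> low m \<Longrightarrow> f \<in> polys"
  and lowD: "f \<in> low m \<Longrightarrow> f (u, p) \<noteq> 0 \<Longrightarrow> m \<le> length p"
  and low_zero: "0 \<in> low m"
  by (auto simp: low_def polys_zero zero_fun_apply)

lemma low_0: "low 0 = polys"
  by (auto simp: low_def)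

lemma low_conv:
  assumes "f \<in> low m" "g \<in> low n"
  shows "conv f g \<in> low (m + n)"
proof (rule lowI)
  show "conv f g \<in> polys" using assms low_polys polys_conv by blast
  fix u p assume "conv f g (u, p) \<noteq> 0"
  then obtain i where i: "i \<le> length p"
    "f (u, take i p) * g (last (awalk_verts u (take i p)), drop i p) \<noteq> 0"
    unfolding conv_def by (auto elim: sum.not_neutral_contains_not_neutral)
  then have "m \<le> length (take i p)" "n \<le> length (drop i p)"
    using lowD[OF assms(1), of u "take i p"] lowD[OF assms(2), of _ "drop i p"] by auto
  then show "m + n \<le> length p" using i(1) by simp
qed

lemma low_add:
  assumes "f \<in> low m" "g \<in> low m"
  shows "f + g \<in> low m"
proof (rule lowI)
  show "f + g \<in> polys" using assms low_polys polys_add by blast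
  fix u p assume "(f + g) (u, p) \<noteq> 0"
  then have "f (u, p) \<noteq> 0 \<or> g (u, p) \<noteq> 0" by (auto simp: plus_fun_apply)
  then show "m \<le> length p" using assms lowD by blast
qed

lemma low_uminus: "f \<in> low m \<Longrightarrow> - f \<in> low m"
  by (auto simp: low_def polys_closed uminus_fun_apply)

lemma ideal_low: "ideal (low m) R"
proof (rule ideal_R_I)
  show "conv g f \<in> low m" "conv f g \<in> low m" if "f \<in> low m" "g \<in> polys" for f g
    using low_conv[of g 0 f m] low_conv[of f m g 0] that by (simp_all add: low_0)
qed (auto simp: low_polys low_zero low_add low_uminus)

lemma proj_low_ideal: "ideal (proj ` low m) A"
  using ring_hom_ring.ideal_image[OF proj_hom _ ideal_low] A_carrier by (simp add: R_simps)

lemma low_Suc_expansion: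
  assumes "f \<in> low (Suc m)"
  shows "f = (\<Sum>a\<in>arcs G. conv (arrow_elem G a) (der a f))" "\<And>a. a \<in> arcs G \<Longrightarrow> der a f \<in> low m"
proof -
  have "f (u, []) = 0" for u using lowD[OF assms, of u "[]"] by auto
  then show "f = (\<Sum>a\<in>arcs G. conv (arrow_elem G a) (der a f))"
    using arrows_expansion[OF polys_series[OF low_polys[OF assms]]] by (simp add: conv_arrow_elem)
  show "der a f \<in> low m" if "a \<in> arcs G" for a
  proof (rule lowI)
    fix u p assume "der a f (u, p) \<noteq> 0"
    then have "f (tail G a, a # p) \<noteq> 0" by (auto simp: der_apply split: if_splits)
    then show "m \<le> length p" using lowD[OF assms] by fastforce
  qed (use that low_polys[OF assms] in \<open>simp add: polys_closed\<close>)
qed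

lemma arrow_elem_low: "a \<in> arcs G \<Longrightarrow> arrow_elem G a \<in> low 1"
  by (rule lowI, erule arrow_elem_polys) (auto simp: arrow_elem_def path_elem_def split: if_splits)

text \<open>A polynomial of order at least \<open>Suc m\<close> is a finite sum of arrows times
  elements of \<open>low m\<close>. Stating this for an arbitrary additively closed \<open>X\<close>
  serves both the ideal \<open>arrows\<close> and the products that form its powers.\<close>

lemma proj_low_Suc:
  assumes f: "f \<in> low (Suc m)" and zero: "proj 0 \<in> X"
    and add: "\<And>x y. x \<in> X \<Longrightarrow> y \<in> X \<Longrightarrow> x \<oplus>\<^bsub>A\<^esub> y \<in> X"
    and prod: "\<And>a g. a \<in> arcs G \<Longrightarrow> g \<in> low m \<Longrightarrow> proj (arrow_elem G a) \<otimes>\<^bsub>A\<^esub> proj g \<in> X"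
  shows "proj f \<in> X"
proof -
  have Y: "proj (\<Sum>a\<in>Y. conv (arrow_elem G a) (der a f)) \<in> X" if "finite Y" "Y \<subseteq> arcs G" for Y
    using that
  proof (induction Y rule: finite_induct)
    case (insert a Y)
    have a: "a \<in> arcs G" "der a f \<in> low m" using insert.prems low_Suc_expansion(2)[OF f] by auto
    have p: "conv (arrow_elem G b) (der b f) \<in> polys" if "b \<in> arcs G" for b
      by (rule polys_conv[OF arrow_elem_polys[OF that] low_polys[OF low_Suc_expansion(2)[OF f that]]])
    have s: "(\<Sum>a\<in>Y. conv (arrow_elem G a) (der a f)) \<in> polys"
      using insert.prems p by (intro polys_sum) blast
    have "proj (conv (arrow_elem G a) (der a f)) \<in> X"
      using prod[OF a] proj_simps(3)[OF arrow_elem_polys[OF a(1)] low_polys[OF a(2)]] by simp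
    then show ?case
      using insert add proj_simps(2)[OF p[OF a(1)] s] by simp
  qed (use zero in simp)
  show ?thesis
    using Y[OF finite_arcs order_refl] by (simp only: low_Suc_expansion(1)[OF f, symmetric])
qed

lemma arrows_low: "arrows = proj ` low 1"
proof
  interpret A: ring A by (rule ring_A)
  have "(\<lambda>a. proj (arrow_elem G a)) ` arcs G \<subseteq> proj ` low 1" using arrow_elem_low by blast
  then show "arrows \<subseteq> proj ` low 1"
    unfolding arrows_def by (rule A.genideal_minimal[OF proj_low_ideal])
  have car: "(\<lambda>a. proj (arrow_elem G a)) ` arcs G \<subseteq> carrier A"
    using A_carrier arrow_elem_polys by blast
  interpret I: ideal arrows A unfolding arrows_def by (rule A.genideal_ideal[OF car])
  have self: "proj (arrow_elem G a) \<in> arrows" if "a \<in> arcs G" for a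
    using A.genideal_self[OF car] that unfolding arrows_def by blast
  have "proj f \<in> arrows" if f: "f \<in> low (Suc 0)" for f
  proof (rule proj_low_Suc[OF f])
    have "proj 0 = \<zero>\<^bsub>A\<^esub>" using proj_hom
      by (metis R_simps(4) ring_hom_ring.homh ring_hom_zero ring_A ring_path_algebra)
    then show "proj 0 \<in> arrows" by simp
    show "proj (arrow_elem G a) \<otimes>\<^bsub>A\<^esub> proj g \<in> arrows" if "a \<in> arcs G" "g \<in> low 0" for a g
      using I.I_r_closed[OF self[OF that(1)]] that(2) A_carrier by (simp add: low_0)
  qed (rule I.a_closed)
  then show "proj ` low 1 \<subseteq> arrows" by auto
qed

lemma ideal_power_low: "ideal_power A arrows m = proj ` low m"
proof (induction m)
  case 0
  then show ?case by (simp add: ideal_power_def A_carrier low_0)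
next
  case (Suc m)
  have "ideal_power A arrows (Suc m) = ideal_prod A (proj ` low 1) (proj ` low m)"
    using Suc by (simp add: ideal_power_def arrows_low)
  also have "\<dots> = proj ` low (Suc m)"
  proof
    show "ideal_prod A (proj ` low 1) (proj ` low m) \<subseteq> proj ` low (Suc m)"
    proof
      fix x assume "x \<in> ideal_prod A (proj ` low 1) (proj ` low m)"
      then show "x \<in> proj ` low (Suc m)"
      proof (induction rule: ideal_prod.induct)
        case (prod i j)
        then obtain f g where fg: "f \<in> low 1" "g \<in> low m" "i = proj f" "j = proj g" by blast
        then have "i \<otimes>\<^bsub>A\<^esub> j = proj (conv f g)" using proj_simps(3) low_polys by simp
        then show ?case using low_conv[OF fg(1,2)] by simp
      next
        case (sum s t)
        then show ?case using additive_subgroup.a_closed[OF ideal.axioms(1)[OF proj_low_ideal]] by blast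
      qed
    qed
    show "proj ` low (Suc m) \<subseteq> ideal_prod A (proj ` low 1) (proj ` low m)"
    proof
      fix x assume "x \<in> proj ` low (Suc m)"
      then obtain f where f: "f \<in> low (Suc m)" "x = proj f" by blast
      show "x \<in> ideal_prod A (proj ` low 1) (proj ` low m)"
        unfolding f(2)
      proof (rule proj_low_Suc[OF f(1)])
        have "proj 0 = proj 0 \<otimes>\<^bsub>A\<^esub> proj 0"
          using proj_simps(3)[OF polys_zero polys_zero] by (simp add: conv_zero_left)
        then show "proj 0 \<in> ideal_prod A (proj ` low 1) (proj ` low m)"
          using ideal_prod.prod[of "proj 0" "proj ` low 1" "proj 0" "proj ` low m" A] low_zero by simp
        show "proj (arrow_elem G a) \<otimes>\<^bsub>A\<^esub> proj g \<in> ideal_prod A (proj ` low 1) (proj ` low m)"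
          if "a \<in> arcs G" "g \<in> low m" for a g
          using arrow_elem_low[OF that(1)] that(2) by (intro ideal_prod.prod) auto
      qed (rule ideal_prod.sum)
    qed
  qed
  finally show ?case .
qed

definition cls :: "nat \<Rightarrow> (('a, 'b) path \<Rightarrow> 'k) \<Rightarrow> (('a, 'b) path \<Rightarrow> 'k) set set" where
  "cls m f = ideal_power A arrows m +>\<^bsub>A\<^esub> proj f"

abbreviation quot where "quot m \<equiv> A Quot ideal_power A arrows m"

lemma ideal_arrows_power: "ideal (ideal_power A arrows m) A"
  unfolding ideal_power_low by (rule proj_low_ideal)

lemma cls_hom: "ring_hom_ring R (quot m) (cls m)"
proof -
  interpret q: ring_hom_ring A "quot m" "(+>\<^bsub>A\<^esub>) (ideal_power A arrows m)"
    by (rule ideal.rcos_ring_hom_ring[OF ideal_arrows_power])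
  interpret p: ring_hom_ring R A proj by (rule proj_hom)
  have "cls m \<in> ring_hom R (quot m)"
    using ring_hom_trans[OF p.homh q.homh] by (simp add: cls_def[abs_def] comp_def)
  then show ?thesis by (rule ring_hom_ringI2[OF ring_path_algebra q.S.ring_axioms])
qed

lemma quot_carrier: "carrier (quot m) = cls m ` polys"
  by (auto simp: FactRing_def A_RCOSETS_def' cls_def A_carrier)

lemma trunc_hpart: "trunc m f = (\<Sum>d<m. hpart d f)" for f :: "('a, 'b) path \<Rightarrow> 'k"
proof
  fix x :: "('a, 'b) path"
  obtain u p where x: "x = (u, p)" by force
  have "(\<Sum>d<m. hpart d f x) = (\<Sum>d<m. if d = length p then f x else 0)"
    by (rule sum.cong) (auto simp: x hpart_apply)
  then show "trunc m f x = (\<Sum>d<m. hpart d f) x"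
    by (simp add: x trunc_apply sum_apply)
qed

text \<open>Homogeneity of the relations enters here: a polynomial is a relation modulo degree
  \<open>m\<close> exactly if each of its components of smaller degree is a relation.\<close>

lemma cls_eq_iff:
  assumes f: "f \<in> polys" and g: "g \<in> polys"
  shows "cls m f = cls m g \<longleftrightarrow> (\<forall>d<m. hpart d (f - g) \<in> rel_ideal)"
proof -
  have fg: "f - g \<in> polys" using polys_add[OF f polys_closed(1)[OF g]] by simp
  have "cls m f = cls m g \<longleftrightarrow> proj f \<ominus>\<^bsub>A\<^esub> proj g \<in> ideal_power A arrows m"
    using ring.quotient_eq_iff_same_a_r_cos[OF ring_A ideal_arrows_power] proj_simps(1) f g
    by (simp add: cls_def)
  also have "\<dots> \<longleftrightarrow> proj (f - g) \<in> proj ` low m"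
    using proj_simps(4)[OF f g] by (simp add: ideal_power_low)
  also have "\<dots> \<longleftrightarrow> (\<exists>h\<in>low m. (f - g) - h \<in> rel_ideal)"
    using proj_eq_iff[OF fg low_polys] by blast
  also have "\<dots> \<longleftrightarrow> (\<forall>d<m. hpart d (f - g) \<in> rel_ideal)"
  proof
    assume "\<exists>h\<in>low m. (f - g) - h \<in> rel_ideal"
    then obtain h where h: "h \<in> low m" "(f - g) - h \<in> rel_ideal" by blast
    show "\<forall>d<m. hpart d (f - g) \<in> rel_ideal"
    proof (intro allI impI)
      fix d assume d: "d < m"
      have "hpart d h = 0"
        using lowD[OF h(1)] d by (fastforce simp: fun_eq_iff hpart_apply zero_fun_apply)
      then have "hpart d (f - g) = hpart d ((f - g) - h)" by (simp only: hpart_diff diff_0_right)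
      then show "hpart d (f - g) \<in> rel_ideal" using rel_ideal_hpart[OF h(2)] by simp
    qed
  next
    assume "\<forall>d<m. hpart d (f - g) \<in> rel_ideal"
    then have t: "trunc m (f - g) \<in> rel_ideal" unfolding trunc_hpart by (intro rel_ideal_sum) simp
    have "(f - g) - trunc m (f - g) \<in> low m"
    proof (rule lowI)
      show "(f - g) - trunc m (f - g) \<in> polys"
        using polys_add[OF fg polys_closed(1)[OF rel_ideal_polys[OF t]]] by simp
    qed (auto simp: trunc_apply split: if_splits)
    moreover have "(f - g) - ((f - g) - trunc m (f - g)) \<in> rel_ideal" using t by simp
    ultimately show "\<exists>h\<in>low m. (f - g) - h \<in> rel_ideal" by blast
  qed
  finally show ?thesis .
qed

end

section \<open>The map from power series to the completion\<close>

context doubled_digraph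
begin

definition L where "L = adic_completion A arrows"

text \<open>Level \<open>m\<close> of the inverse limit sees only terms of degree below
  \<open>m\<close>, so truncation reduces it to a polynomial without loss. Through
  \<open>res\<close> the map is defined on all functions.\<close>

definition \<phi> :: "(('a, 'b) path \<Rightarrow> 'k) \<Rightarrow> nat \<Rightarrow> (('a, 'b) path \<Rightarrow> 'k) set set" where
  "\<phi> f = (\<lambda>m. cls m (trunc m (res f)))"

lemma \<phi>_polys:
  assumes "f \<in> polys"
  shows "\<phi> f = (\<lambda>m. cls m f)"
proof
  fix m
  have "hpart d (trunc m f - f) = 0" if "d < m" for d
    using that by (auto simp: fun_eq_iff hpart_apply trunc_apply zero_fun_apply)
  then have "cls m (trunc m f) = cls m f"
    using cls_eq_iff[OF trunc_polys[OF polys_series[OF assms]] assms, of m] rel_ideal.zero by simp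
  then show "\<phi> f m = cls m f" by (simp add: \<phi>_def res_series polys_series assms)
qed

lemma \<phi>_eq_iff: "\<phi> f = \<phi> g \<longleftrightarrow> f - g \<in> null"
proof -
  have "\<phi> f = \<phi> g \<longleftrightarrow> (\<forall>m. \<forall>d<m. hpart d (trunc m (res f) - trunc m (res g)) \<in> rel_ideal)"
    by (simp add: \<phi>_def fun_eq_iff cls_eq_iff trunc_polys series_closed)
  also have "\<dots> \<longleftrightarrow> (\<forall>m. \<forall>d<m. hpart d (res (f - g)) \<in> rel_ideal)"
  proof -
    have "hpart d (trunc m (res f) - trunc m (res g)) = hpart d (res (f - g))" if "d < m" for d m
      using that by (auto simp: fun_eq_iff hpart_apply trunc_apply res_diff)
    then show ?thesis by simp
  qed
  also have "\<dots> \<longleftrightarrow> f - g \<in> null"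
    by (auto simp: null_def)
  finally show ?thesis .
qed

lemma \<phi>_res: "\<phi> (res f) = \<phi> f"
  by (simp add: \<phi>_def res_series series_closed)

lemma arrows_power_Suc: "ideal_power A arrows (Suc m) \<subseteq> ideal_power A arrows m"
  unfolding ideal_power_low by (intro image_mono) (auto simp: low_def intro: Suc_leD)

lemma cls_Suc_subset: "cls (Suc m) f \<subseteq> cls m f"
  using arrows_power_Suc[of m] unfolding cls_def a_r_coset_def' by blast

lemma \<phi>_carrier: "\<phi> f \<in> carrier L"
proof -
  have "\<phi> f (Suc m) \<subseteq> \<phi> f m" for m
  proof -
    have t: "trunc d (res f) \<in> polys" for d by (simp add: trunc_polys series_closed)
    have "hpart d (trunc (Suc m) (res f) - trunc m (res f)) = 0" if "d < m" for d
      using that by (auto simp: fun_eq_iff hpart_apply trunc_apply zero_fun_apply)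
    then have "cls m (trunc (Suc m) (res f)) = cls m (trunc m (res f))"
      using cls_eq_iff[OF t t, of m] rel_ideal.zero by simp
    then show ?thesis using cls_Suc_subset[of m "trunc (Suc m) (res f)"] by (simp add: \<phi>_def)
  qed
  moreover have "\<phi> f m \<in> carrier (quot m)" for m
    using trunc_polys[OF series_closed(10)] by (auto simp: \<phi>_def quot_carrier)
  ultimately show ?thesis by (simp add: L_def adic_completion_def)
qed

lemma \<phi>_surj:
  assumes x: "x \<in> carrier L"
  obtains f where "f \<in> series" "x = \<phi> f"
proof -
  have xm: "x m \<in> cls m ` polys" "x (Suc m) \<subseteq> x m" for m
    using x quot_carrier by (auto simp: L_def adic_completion_def)
  then have "\<forall>m. \<exists>f\<in>polys. x m = cls m f" by blast
  then obtain F where F: "\<And>m. F m \<in> polys" "\<And>m. x m = cls m (F m)" by metis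
  have step: "cls m (F (Suc m)) = cls m (F m)" for m
  proof -
    interpret I: ideal "ideal_power A arrows m" A by (rule ideal_arrows_power)
    interpret I': ideal "ideal_power A arrows (Suc m)" A by (rule ideal_arrows_power)
    have p: "proj (F n) \<in> carrier A" for n using F(1) A_carrier by blast
    have "proj (F (Suc m)) \<in> x (Suc m)" using I'.a_rcos_self[OF p] F(2) by (simp add: cls_def)
    then have "proj (F (Suc m)) \<in> ideal_power A arrows m +>\<^bsub>A\<^esub> proj (F m)"
      using xm(2) F(2) cls_def by blast
    then show ?thesis unfolding cls_def using I.a_repr_independence'[OF _ p] by blast
  qed
  have diff: "hpart d (F (Suc d) - F m) \<in> rel_ideal" if "d < m" for d m
  proof -
    have "Suc d \<le> m" using that by simp
    then show ?thesis
    proof (induction m rule: dec_induct)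
      case base
      show ?case by (simp add: hpart_zero rel_ideal.zero)
    next
      case (step m)
      then have "hpart d (F (Suc m) - F m) \<in> rel_ideal"
        using \<open>cls m (F (Suc m)) = cls m (F m)\<close> cls_eq_iff[OF F(1) F(1), of m] by simp
      then have r: "hpart d (F (Suc d) - F m) - hpart d (F (Suc m) - F m) \<in> rel_ideal"
        using rel_ideal_diff step.IH by blast
      have "hpart d (F (Suc d) - F m) - hpart d (F (Suc m) - F m) = hpart d (F (Suc d) - F (Suc m))"
        by (auto simp: fun_eq_iff hpart_apply)
      then show ?case using r by (metis (no_types))
    qed
  qed
  \<comment> \<open>The polynomials \<open>F m\<close> agree in a fixed degree only up to relations.
    The part of degree d is taken from \<open>F (Suc d)\<close>, the first level that sees it, and
    \<open>diff\<close> compares it with all later levels.\<close>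
  define f where "f = (\<lambda>(u, p). F (Suc (length p)) (u, p))"
  have f: "f \<in> series"
    using F(1) polys_series by (auto simp: f_def series_def)
  have "\<phi> f m = x m" for m
  proof -
    have "hpart d (trunc m f - F m) = hpart d (F (Suc d) - F m)" if "d < m" for d
      using that by (auto simp: fun_eq_iff hpart_apply trunc_apply f_def)
    then have "cls m (trunc m f) = cls m (F m)"
      using cls_eq_iff[OF trunc_polys[OF f] F(1), of m m] diff by simp
    then show ?thesis using F(2) by (simp add: \<phi>_def res_series f)
  qed
  then show thesis using that[OF f] by (metis ext)
qed

lemma \<phi>_ring_hom: "\<phi> \<in> ring_hom series_ring L"
proof (rule ring_hom_memI)
  fix f g :: "('a, 'b) path \<Rightarrow> 'k" assume "f \<in> carrier series_ring" "g \<in> carrier series_ring"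
  then have fg: "f \<in> series" "g \<in> series" by (simp_all add: series_ring_simps)
  note t = trunc_polys[OF fg(1)] trunc_polys[OF fg(2)]
  have hom: "ring_hom_ring R (quot m) (cls m)" for m by (rule cls_hom)
  have "\<phi> (conv f g) m = \<phi> f m \<otimes>\<^bsub>quot m\<^esub> \<phi> g m" for m
  proof -
    have "hpart d (trunc m (conv f g) - conv (trunc m f) (trunc m g)) = 0" if d: "d < m" for d
    proof
      fix x :: "('a, 'b) path"
      obtain u p where x: "x = (u, p)" by force
      have "conv f g (u, p) = conv (trunc m f) (trunc m g) (u, p)" if "length p < m"
        unfolding conv_def prod.case using that by (intro sum.cong) (auto simp: trunc_apply)
      then show "hpart d (trunc m (conv f g) - conv (trunc m f) (trunc m g)) x = 0 x"
        using d by (auto simp: x hpart_apply trunc_apply zero_fun_apply)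
    qed
    then have "cls m (trunc m (conv f g)) = cls m (conv (trunc m f) (trunc m g))"
      using cls_eq_iff[OF trunc_polys[OF series_conv[OF fg]] polys_conv[OF t], of m m m] rel_ideal.zero
      by simp
    also have "\<dots> = cls m (trunc m f) \<otimes>\<^bsub>quot m\<^esub> cls m (trunc m g)"
      using ring_hom_mult[OF ring_hom_ring.homh[OF hom], of "trunc m f" "trunc m g" m] t
      by (simp add: R_simps)
    finally show ?thesis by (simp add: \<phi>_def res_series series_conv fg)
  qed
  then show "\<phi> (f \<otimes>\<^bsub>series_ring\<^esub> g) = \<phi> f \<otimes>\<^bsub>L\<^esub> \<phi> g"
    by (simp add: series_ring_simps L_def adic_completion_def fun_eq_iff)
  have "\<phi> (f + g) m = \<phi> f m \<oplus>\<^bsub>quot m\<^esub> \<phi> g m" for m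
  proof -
    have "trunc m (f + g) = trunc m f + trunc m g"
      by (auto simp: fun_eq_iff trunc_apply plus_fun_apply)
    then show ?thesis
      using ring_hom_add[OF ring_hom_ring.homh[OF hom], of "trunc m f" "trunc m g" m] t fg
      by (simp add: R_simps \<phi>_def res_series series_closed)
  qed
  then show "\<phi> (f \<oplus>\<^bsub>series_ring\<^esub> g) = \<phi> f \<oplus>\<^bsub>L\<^esub> \<phi> g"
    by (simp add: series_ring_simps L_def adic_completion_def fun_eq_iff)
next
  have "\<phi> unit m = \<one>\<^bsub>quot m\<^esub>" for m
    using ring_hom_one[OF ring_hom_ring.homh[OF cls_hom], of m] \<phi>_polys[OF polys_unit]
    by (simp add: R_simps)
  then show "\<phi> \<one>\<^bsub>series_ring\<^esub> = \<one>\<^bsub>L\<^esub>"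
    by (simp add: series_ring_simps L_def adic_completion_def fun_eq_iff)
qed (rule \<phi>_carrier)

lemma L_carrier: "carrier L = \<phi> ` series"
  using \<phi>_carrier \<phi>_surj by blast

text \<open>The ring axioms for the inverse limit are inherited from the series, whose image under
  \<open>\<phi>\<close> is the whole carrier.\<close>

lemma ring_L: "ring L"
proof -
  have "\<phi> 0 m = \<zero>\<^bsub>quot m\<^esub>" for m
  proof -
    interpret h: ring_hom_ring R "quot m" "cls m" by (rule cls_hom)
    show ?thesis using h.hom_zero \<phi>_polys[OF polys_zero] by (simp add: R_simps)
  qed
  then have z: "\<phi> \<zero>\<^bsub>series_ring\<^esub> = \<zero>\<^bsub>L\<^esub>"
    by (simp add: series_ring_simps L_def adic_completion_def fun_eq_iff)
  have "ring (L \<lparr>carrier := \<phi> ` carrier series_ring, zero := \<phi> \<zero>\<^bsub>series_ring\<^esub>\<rparr>)"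
    by (rule ring.ring_hom_imp_img_ring[OF ring_series_algebra \<phi>_ring_hom])
  then show ?thesis using z by (simp add: series_ring_simps L_carrier[symmetric])
qed

lemma \<phi>_hom: "ring_hom_ring series_ring L \<phi>"
  by (rule ring_hom_ringI2[OF ring_series_algebra ring_L \<phi>_ring_hom])

lemma \<phi>_conv: "f \<in> series \<Longrightarrow> g \<in> series \<Longrightarrow> \<phi> (conv f g) = \<phi> f \<otimes>\<^bsub>L\<^esub> \<phi> g"
  using ring_hom_mult[OF \<phi>_ring_hom, of f g] by (simp add: series_ring_simps)

lemma \<phi>_add: "\<phi> (f + g) = \<phi> f \<oplus>\<^bsub>L\<^esub> \<phi> g"
  using ring_hom_add[OF \<phi>_ring_hom, of "res f" "res g"] \<phi>_res[of f] \<phi>_res[of g] \<phi>_res[of "f + g"]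
  by (simp add: series_ring_simps series_closed res_add)

lemma \<phi>_diff: "\<phi> (f - g) = \<phi> f \<ominus>\<^bsub>L\<^esub> \<phi> g"
proof -
  interpret L: ring L by (rule ring_L)
  have "\<phi> f = \<phi> (f - g) \<oplus>\<^bsub>L\<^esub> \<phi> g" unfolding \<phi>_add[symmetric] by simp
  then show ?thesis using \<phi>_carrier by (simp add: a_minus_def L.a_assoc L.r_neg)
qed

lemma \<phi>_arr: "a \<in> arcs G \<Longrightarrow> \<phi> (arr a f) = \<phi> (arrow_elem G a) \<otimes>\<^bsub>L\<^esub> \<phi> f"
  using \<phi>_conv[of "arrow_elem G a" "res f"] \<phi>_res[of f] \<phi>_res[of "arr a f"]
  by (simp add: conv_arrow_elem res_arr arrow_elem_polys polys_series series_closed)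

lemma \<phi>_vpart: "i \<in> verts G \<Longrightarrow> \<phi> (vpart i f) = \<phi> (path_elem (i, [])) \<otimes>\<^bsub>L\<^esub> \<phi> f"
  using \<phi>_conv[of "path_elem (i, [])" "res f"] \<phi>_res[of f] \<phi>_res[of "vpart i f"]
  by (simp add: conv_idem res_vpart path_elem_polys paths_Nil polys_series series_closed)

lemma \<phi>_scale: "\<phi> (scale c f) = \<phi> (scale c unit) \<otimes>\<^bsub>L\<^esub> \<phi> f"
  using \<phi>_conv[of "scale c unit" "res f"] \<phi>_res[of f] \<phi>_res[of "scale c f"]
  by (simp add: conv_scale_left conv_unit_left res_scale series_closed)

section \<open>Ideals of the completion as left ideals of functions\<close>

sublocale M: preprojective_module "verts G" "arcs G" "tail G" "head G" st vpart arr star null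
  by (rule preprojective_module)

definition pre :: "(nat \<Rightarrow> (('a, 'b) path \<Rightarrow> 'k) set set) set \<Rightarrow> (('a, 'b) path \<Rightarrow> 'k) set" where
  "pre J = {f. \<phi> f \<in> J}"

lemma \<phi>_null: "f \<in> null \<Longrightarrow> \<phi> f = \<zero>\<^bsub>L\<^esub>"
proof -
  assume "f \<in> null"
  then have "\<phi> f = \<phi> 0" using \<phi>_eq_iff[of f 0] by simp
  then show ?thesis using ring_hom_zero[OF \<phi>_ring_hom ring_series_algebra ring_L]
    by (simp add: series_ring_simps)
qed

lemma left_ideal_pre:
  assumes "ideal J L"
  shows "M.left_ideal (pre J)"
proof -
  interpret J: ideal J L by (rule assms)
  show ?thesis
    unfolding M.left_ideal_def
    using J.zero_closed J.I_l_closed \<phi>_carrier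
    by (auto simp: pre_def \<phi>_null \<phi>_diff \<phi>_vpart \<phi>_arr J.minus_closed a_minus_def J.a_closed)
qed

lemma pre_scale:
  assumes "ideal J L" "f \<in> pre J"
  shows "scale c f \<in> pre J"
  using assms ideal.I_l_closed[OF assms(1)] \<phi>_carrier by (simp add: pre_def \<phi>_scale[of c f])

lemma pre_conv:
  assumes "ideal J L" "f \<in> series" "g \<in> series" "g \<in> pre J"
  shows "conv f g \<in> pre J"
  using assms ideal.I_l_closed[OF assms(1)] \<phi>_carrier by (simp add: pre_def \<phi>_conv)

lemma pre_image: "J \<subseteq> carrier L \<Longrightarrow> J = \<phi> ` pre J"
  using L_carrier by (auto simp: pre_def)

definition vert_ideal :: "'a \<Rightarrow> (nat \<Rightarrow> (('a, 'b) path \<Rightarrow> 'k) set set) set" where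
  "vert_ideal i = Idl\<^bsub>L\<^esub> {\<one>\<^bsub>L\<^esub> \<ominus>\<^bsub>L\<^esub> \<phi> (path_elem (i, []))}"

definition aug :: "'a \<Rightarrow> (('a, 'b) path \<Rightarrow> 'k) set" where
  "aug i = {f \<in> series. f (i, []) = 0}"

lemma ideal_aug:
  shows "ideal (aug i) series_ring"
proof (rule idealI[OF ring_series_algebra])
  interpret S: ring series_ring by (rule ring_series_algebra)
  show "subgroup (aug i) (add_monoid series_ring)"
  proof (rule S.add.subgroupI)
    fix f assume "f \<in> aug i"
    then show "\<ominus>\<^bsub>series_ring\<^esub> f \<in> aug i"
      by (simp add: aug_def series_uminus series_closed uminus_fun_apply)
  qed (auto simp: aug_def series_ring_simps series_closed plus_fun_apply zero_fun_apply intro!: exI[of _ 0])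
qed (auto simp: aug_def series_ring_simps series_conv conv_Nil)

text \<open>Multiplication by \<open>c = 1 - e_i\<close> gives \<open>g - vpart i g\<close>, so
  everything that starts at another vertex lies in the ideal. A series that starts at
  \<open>i\<close> and has no constant term is a sum of terms \<open>arr a g\<close>; as
  \<open>a\<close> ends outside of \<open>i\<close>, such a term does not change when
  \<open>g\<close> is replaced by \<open>g - vpart i g\<close>.\<close>

lemma vert_ideal_aug:
  assumes i: "i \<in> verts G"
  shows "vert_ideal i = \<phi> ` aug i"
proof
  interpret L: ring L by (rule ring_L)
  interpret h: ring_hom_ring series_ring L \<phi> by (rule \<phi>_hom)
  define c where "c = unit - (path_elem (i, []) :: ('a, 'b) path \<Rightarrow> 'k)"
  have p: "path_elem (i, []) \<in> series" using i by (simp add: path_elem_polys paths_Nil polys_series)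
  have c: "c \<in> series" using series_closed(3)[OF series_closed(2) series_closed(4)[OF p]] by (simp add: c_def)
  have "c (i, []) = 0" using i by (simp add: c_def unit_apply path_elem_def)
  then have ca: "c \<in> aug i" using c by (simp add: aug_def)
  have \<phi>c: "\<phi> c = \<one>\<^bsub>L\<^esub> \<ominus>\<^bsub>L\<^esub> \<phi> (path_elem (i, []))"
    using h.hom_one unfolding c_def \<phi>_diff by (simp add: series_ring_simps)
  have I: "ideal (\<phi> ` aug i) L"
    by (rule h.ideal_image[OF _ ideal_aug]) (simp add: L_carrier series_ring_simps)
  show "vert_ideal i \<subseteq> \<phi> ` aug i"
    unfolding vert_ideal_def \<phi>c[symmetric] using ca by (intro L.genideal_minimal[OF I]) simp
  have V: "ideal (vert_ideal i) L"
    unfolding vert_ideal_def \<phi>c[symmetric] using \<phi>_carrier by (intro L.genideal_ideal) simp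
  interpret V: ideal "vert_ideal i" L by (rule V)
  note s = M.left_idealD(1)[OF left_ideal_pre[OF V]]
  have cV: "\<phi> c \<in> vert_ideal i"
    unfolding vert_ideal_def \<phi>c[symmetric] by (rule L.genideal_self'[OF \<phi>_carrier])
  show "\<phi> ` aug i \<subseteq> vert_ideal i"
  proof
    fix x assume "x \<in> \<phi> ` aug i"
    then obtain f where f: "f \<in> aug i" "x = \<phi> f" by blast
    then have fs: "f \<in> series" by (simp add: aug_def)
    have "f \<in> pre (vert_ideal i)"
    proof (rule M.sub_local[OF s])
      have cc: "conv c g = g - vpart i g" if "g \<in> series" for g
      proof -
        have "conv c g + vpart i g = conv (c + path_elem (i, [])) g"
          by (simp add: conv_add_left conv_idem)
        also have "\<dots> = g" using conv_unit_left[OF that] by (simp add: c_def)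
        finally show ?thesis by (simp add: algebra_simps)
      qed
      have k: "g - vpart i g \<in> pre (vert_ideal i)" if "g \<in> series" for g
        using V.I_r_closed[OF cV \<phi>_carrier[of g]] \<phi>_conv[OF c that] cc[OF that] by (simp add: pre_def)
      fix t assume t: "t \<in> verts G"
      show "vpart t f \<in> pre (vert_ideal i)"
      proof (cases "t = i")
        case False
        then show ?thesis
          using M.left_idealD(2)[OF left_ideal_pre[OF V] t k[OF fs]] by (simp add: vpart_diff vpart_vpart)
      next
        case True
        have "vpart i f (u, []) = 0" for u using f(1) by (simp add: aug_def vpart_apply)
        then have "vpart i f = (\<Sum>a\<in>arcs G. arr a (der a (vpart i f)))"
          using arrows_expansion[of "vpart i f"] fs by (simp add: series_closed)
        also have "\<dots> \<in> pre (vert_ideal i)"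
        proof (rule M.sub_sum[OF s])
          fix a assume a: "a \<in> arcs G"
          show "arr a (der a (vpart i f)) \<in> pre (vert_ideal i)"
          proof (cases "tail G a = i")
            case False
            then have "der a (vpart i f) = 0"
              by (auto simp: der_apply vpart_apply fun_eq_iff zero_fun_apply)
            then show ?thesis using M.sub_zero[OF s] by (simp add: arr_zero)
          next
            case True
            then have h: "head G a \<noteq> i" using no_loops[OF a] by simp
            define g where "g = der a (vpart i f)"
            have "g - vpart i g \<in> pre (vert_ideal i)" 
              using k fs a by (simp add: g_def series_closed)
            then have "arr a (g - vpart i g) \<in> pre (vert_ideal i)"
              by (rule M.left_idealD(3)[OF left_ideal_pre[OF V] a])
            then show ?thesis using h by (simp add: arr_diff vpart_head_arr g_def)
          qed
        qed
        finally show ?thesis using True by simp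
      qed
    qed
    then show "x \<in> vert_ideal i" using f(2) by (simp add: pre_def)
  qed
qed

lemma ideal_vert_ideal: "i \<in> verts G \<Longrightarrow> ideal (vert_ideal i) L"
  unfolding vert_ideal_def
  using ring.ring_simprules(1)[OF ring_L] \<phi>_carrier ring_L
  by (intro ring.genideal_ideal[OF ring_L]) (auto intro!: abelian_group.minus_closed ring.is_abelian_group ring.ring_simprules)

text \<open>The product of ideals consists of finite sums, and so does \<open>M.D\<close>: expanding
  a series of \<open>aug i\<close> by its first arrow leaves finitely many terms, each an idempotent
  or an arrow times an element of \<open>pre J\<close>.\<close>

lemma pre_ideal_prod:
  assumes i: "i \<in> verts G" and J: "ideal J L"
  shows "pre (ideal_prod L (vert_ideal i) J) = M.D i (pre J)"
proof
  interpret L: ring L by (rule ring_L)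
  have V: "ideal (vert_ideal i) L" by (rule ideal_vert_ideal[OF i])
  have P: "ideal (ideal_prod L (vert_ideal i) J) L" by (rule L.ideal_prod_is_ideal[OF V J])
  note K = left_ideal_pre[OF J]
  note DK = M.left_ideal_D[OF K i]
  note sD = M.left_idealD(1)[OF DK] and sK = M.left_idealD(1)[OF K]
  \<comment> \<open>All preimages \<open>f\<close> of \<open>s\<close> are treated at once, because
    \<open>s\<close> determines \<open>f\<close> only modulo \<open>null\<close>.\<close>
  have "\<forall>f. \<phi> f = s \<longrightarrow> f \<in> M.D i (pre J)" if "s \<in> ideal_prod L (vert_ideal i) J" for s
    using that
  proof (induction rule: ideal_prod.induct)
    case (prod x y)
    obtain c where c: "c \<in> aug i" "x = \<phi> c" using prod(1) vert_ideal_aug[OF i] by blast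
    then have cs: "c \<in> series" "c (i, []) = 0" by (simp_all add: aug_def)
    obtain g where g: "g \<in> series" "y = \<phi> g"
      using prod(2) ideal.Icarr[OF J] \<phi>_surj by metis
    have gJ: "g \<in> pre J" using prod(2) g by (simp add: pre_def)
    have "conv c g = (\<Sum>t\<in>verts G. scale (c (t, [])) (vpart t g)) + (\<Sum>a\<in>arcs G. arr a (conv (der a c) g))"
      by (subst expansion[OF cs(1)]) (simp add: conv_add_left conv_sum_left conv_scale_left conv_idem conv_arr)
    also have "\<dots> \<in> M.D i (pre J)"
    proof (intro M.sub_add[OF sD] M.sub_sum[OF sD])
      fix t assume t: "t \<in> verts G"
      show "scale (c (t, [])) (vpart t g) \<in> M.D i (pre J)"
      proof (cases "t = i")
        case True
        have "scale 0 h = 0" for h :: "('a, 'b) path \<Rightarrow> 'k" by (simp add: fun_eq_iff scale_apply zero_fun_apply)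
        then show ?thesis using True cs(2) M.sub_zero[OF sD] by simp
      next
        case False
        show ?thesis
          using M.e_in_D[OF K t False pre_scale[OF J gJ]] by (simp add: vpart_scale)
      qed
    next
      fix a assume a: "a \<in> arcs G"
      have ck: "conv (der a c) g \<in> pre J" by (rule pre_conv[OF J _ g(1) gJ]) (simp add: series_closed cs a)
      show "arr a (conv (der a c) g) \<in> M.D i (pre J)"
      proof (cases "tail G a = i")
        case True
        then show ?thesis using M.A_in_D[OF K _ ck, of a i] a by (simp add: M.out_def)
      next
        case False
        have "vpart (tail G a) (arr a (conv (der a c) g)) \<in> M.D i (pre J)"
          by (rule M.e_in_D[OF K _ False M.left_idealD(3)[OF K a ck]]) (simp add: a)
        then show ?thesis by (simp add: vpart_arr)
      qed
    qed
    finally have cg: "conv c g \<in> M.D i (pre J)" .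
    show ?case
    proof (intro allI impI)
      fix f assume "\<phi> f = x \<otimes>\<^bsub>L\<^esub> y"
      then have "f - conv c g \<in> null" using \<phi>_conv[OF cs(1) g(1)] c g by (simp add: \<phi>_eq_iff[symmetric])
      then show "f \<in> M.D i (pre J)" using cg M.sub_congr[OF sD] by blast
    qed
  next
    case (sum s t)
    show ?case
    proof (intro allI impI)
      fix f assume f: "\<phi> f = s \<oplus>\<^bsub>L\<^esub> t"
      have car: "s \<in> carrier L" "t \<in> carrier L" using sum.hyps ideal.Icarr[OF P] by blast+
      obtain g where g: "s = \<phi> g" using \<phi>_surj[OF car(1)] by blast
      have "\<phi> (f - g) = t" unfolding \<phi>_diff f g[symmetric] using car
        by (simp add: a_minus_def L.a_comm[of s t] L.a_assoc L.r_neg)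
      then have "f - g \<in> M.D i (pre J)" "g \<in> M.D i (pre J)" using sum.IH g by blast+
      then show "f \<in> M.D i (pre J)" using M.sub_add[OF sD, of "f - g" g] by simp
    qed
  qed
  then show "pre (ideal_prod L (vert_ideal i) J) \<subseteq> M.D i (pre J)" by (auto simp: pre_def)
  show "M.D i (pre J) \<subseteq> pre (ideal_prod L (vert_ideal i) J)"
  proof (rule M.D_least[OF M.left_idealD(1)[OF left_ideal_pre[OF P]]])
    fix t x assume t: "t \<in> verts G" "t \<noteq> i" "x \<in> pre J"
    have "path_elem (t, []) \<in> aug i"
      using t by (simp add: aug_def path_elem_polys polys_series paths_Nil) (simp add: path_elem_def)
    then have "\<phi> (path_elem (t, [])) \<in> vert_ideal i" using vert_ideal_aug[OF i] by blast
    then show "vpart t x \<in> pre (ideal_prod L (vert_ideal i) J)"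
      using t(3) by (auto simp: pre_def \<phi>_vpart[OF t(1)] intro: ideal_prod.prod)
  next
    fix a x assume "a \<in> M.out i" and x: "x \<in> pre J"
    then have a: "a \<in> arcs G" by (simp add: M.out_def)
    have "arrow_elem G a \<in> aug i"
      using a by (simp add: aug_def arrow_elem_polys polys_series) (simp add: arrow_elem_def path_elem_def)
    then have "\<phi> (arrow_elem G a) \<in> vert_ideal i" using vert_ideal_aug[OF i] by blast
    then show "arr a x \<in> pre (ideal_prod L (vert_ideal i) J)"
      using x by (auto simp: pre_def \<phi>_arr[OF a] intro: ideal_prod.prod)
  qed
qed

definition word_ideal :: "'a list \<Rightarrow> (nat \<Rightarrow> (('a, 'b) path \<Rightarrow> 'k) set set) set" where
  "word_ideal is = foldr (\<lambda>i J. ideal_prod L (vert_ideal i) J) is (carrier L)"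

lemma pre_word_ideal:
  assumes "is \<in> lists (verts G)"
  shows "ideal (word_ideal is) L \<and> pre (word_ideal is) = foldr M.D is UNIV"
  using assms
proof (induction "is")
  case Nil
  show ?case using ring.oneideal[OF ring_L] \<phi>_carrier by (auto simp: word_ideal_def pre_def)
next
  case (Cons i "is")
  then have IH: "ideal (word_ideal is) L" "pre (word_ideal is) = foldr M.D is UNIV" and i: "i \<in> verts G" by auto
  have e: "word_ideal (i # is) = ideal_prod L (vert_ideal i) (word_ideal is)" by (simp add: word_ideal_def)
  show ?case
    unfolding e pre_ideal_prod[OF i IH(1)] IH(2)
    using ring.ideal_prod_is_ideal[OF ring_L ideal_vert_ideal[OF i] IH(1)] by simp
qed

lemma word_ideal_image:
  assumes "u \<in> lists (verts G)"
  shows "word_ideal u = \<phi> ` foldr M.D u UNIV"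
proof -
  note p = pre_word_ideal[OF assms]
  have "word_ideal u \<subseteq> carrier L" using ideal.Icarr[OF conjunct1[OF p]] by blast
  then show ?thesis unfolding conjunct2[OF p, symmetric] by (rule pre_image)
qed

lemma word_ideal_eq_iff:
  assumes "u \<in> lists (verts G)" "v \<in> lists (verts G)"
  shows "word_ideal u = word_ideal v \<longleftrightarrow> foldr M.D u UNIV = foldr M.D v UNIV"
proof
  assume "word_ideal u = word_ideal v"
  then have "pre (word_ideal u) = pre (word_ideal v)" by simp
  then show "foldr M.D u UNIV = foldr M.D v UNIV" using pre_word_ideal assms by simp
qed (use word_ideal_image assms in simp)

text \<open>The idempotent at \<open>i\<close> has constant term 1 there, whereas multiples of
  arrows and elements of \<open>null\<close> have constant term 0.\<close>

lemma D_proper: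
  assumes i: "i \<in> verts G"
  shows "M.D i UNIV \<noteq> UNIV"
proof
  assume "M.D i UNIV = UNIV"
  then have "path_elem (i, []) \<in> M.D i UNIV" by simp
  then obtain u where u: "vpart i (path_elem (i, [])) - (\<Sum>a\<in>M.out i. arr a (u a)) \<in> null"
    by (auto simp: M.D_def)
  then have "hpart 0 (res (vpart i (path_elem (i, [])) - (\<Sum>a\<in>M.out i. arr a (u a)))) (i, []) = 0"
    unfolding null_def using rel_ideal_Nil by blast
  then show False
    using i by (simp add: hpart_apply res_apply paths_Nil vpart_apply path_elem_def sum_apply arr_apply)
qed

lemma braid_operators: "braid_operators (verts G) M.links M.D M.U M.left_ideal UNIV"
  by (rule M.braid_operatorsI[OF D_proper])

end

section \<open>The action of the Coxeter group\<close>

lemma presented_lists: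
  assumes "presented_eq S X x y" "X \<subseteq> lists (S \<times> UNIV) \<times> lists (S \<times> UNIV)"
  shows "x \<in> lists (S \<times> UNIV) \<and> y \<in> lists (S \<times> UNIV)"
  using assms(1)
proof (induction rule: presented_eq.induct)
  case (pres_relation x y)
  then show ?case using assms(2) by blast
qed auto

lemma presented_class_eq_iff:
  assumes "x \<in> lists (S \<times> UNIV)"
  shows "Collect (presented_eq S X y) = Collect (presented_eq S X x) \<longleftrightarrow> presented_eq S X y x"
  using assms pres_refl[of x S X] pres_sym pres_trans by blast

lemma presented_carrier:
  "carrier (presented_group S X) = (\<lambda>x. Collect (presented_eq S X x)) ` lists (S \<times> UNIV)"
  by (auto simp: presented_group_def quotient_def)

lemma presented_mult:
  assumes "x \<in> lists (S \<times> UNIV)" "y \<in> lists (S \<times> UNIV)"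
  shows "Collect (presented_eq S X x) \<otimes>\<^bsub>presented_group S X\<^esub> Collect (presented_eq S X y)
    = Collect (presented_eq S X (x @ y))"
proof -
  have "presented_eq S X (x @ y) z" if "presented_eq S X x x'" "presented_eq S X y y'"
    "presented_eq S X (x' @ y') z" for x' y' z
    using that pres_append pres_trans by blast
  moreover have "presented_eq S X x x" "presented_eq S X y y" using assms by (auto intro: pres_refl)
  ultimately show ?thesis by (auto simp: presented_group_def)
qed

lemma presented_word:
  assumes "u \<in> lists S"
  shows "foldr (\<lambda>i x. presented_gen S X i \<otimes>\<^bsub>presented_group S X\<^esub> x) u \<one>\<^bsub>presented_group S X\<^esub>
    = Collect (presented_eq S X (map (\<lambda>i. (i, True)) u))"
  using assms
proof (induction u)
  case (Cons i u)
  then have "map (\<lambda>i. (i, True)) u \<in> lists (S \<times> UNIV)" by auto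
  then show ?case
    using Cons presented_mult[of "[(i, True)]" S "map (\<lambda>i. (i, True)) u" X]
    by (simp add: presented_gen_def)
qed (simp add: presented_group_def)

context braid_operators
begin

definition relations :: "('v gword \<times> 'v gword) set" where
  "relations = (let s = (\<lambda>i. (i, True)) in
      {([s i, s i], []) | i. i \<in> S} \<union>
      {([s i, s j], [s j, s i]) | i j. i \<in> S \<and> j \<in> S \<and> q i j = 0} \<union>
      {([s i, s j, s i], [s j, s i, s j]) | i j. i \<in> S \<and> j \<in> S \<and> q i j = 1})"

abbreviation equiv (infix "\<approx>" 50) where "x \<approx> y \<equiv> presented_eq S relations x y"

abbreviation pos :: "'v list \<Rightarrow> 'v gword" where "pos u \<equiv> map (\<lambda>i. (i, True)) u"

text \<open>The exponents of the letters are ignored because \<open>reflect i\<close> is an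
  involution on \<open>products\<close>.\<close>

definition act :: "'v gword \<Rightarrow> 'x \<Rightarrow> 'x" where "act x J = foldr (\<lambda>p. reflect (fst p)) x J"

lemma relations_lists: "relations \<subseteq> lists (S \<times> UNIV) \<times> lists (S \<times> UNIV)"
  by (auto simp: relations_def)

lemma pos_lists: "u \<in> lists S \<Longrightarrow> pos u \<in> lists (S \<times> UNIV)"
  by auto

lemma act_products: "x \<in> lists (S \<times> UNIV) \<Longrightarrow> J \<in> products \<Longrightarrow> act x J \<in> products"
  by (induction x) (auto simp: act_def reflect_products)

lemma act_equiv: "x \<approx> y \<Longrightarrow> J \<in> products \<Longrightarrow> act x J = act y J"
proof (induction arbitrary: J rule: presented_eq.induct)
  case (pres_append x y x' y')
  have "x' \<in> lists (S \<times> UNIV)" using presented_lists[OF pres_append.hyps(2) relations_lists] by blast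
  then have "act x' J \<in> products" using act_products pres_append.prems by blast
  then show ?case using pres_append.IH(1) pres_append.IH(2)[OF pres_append.prems] by (simp add: act_def)
next
  case (pres_inverse g b)
  then show ?case by (simp add: act_def reflect_products)
next
  case (pres_relation x y)
  then consider i where "i \<in> S" "x = [(i, True), (i, True)]" "y = []"
    | i j where "i \<in> S" "j \<in> S" "q i j = 0" "x = [(i, True), (j, True)]" "y = [(j, True), (i, True)]"
    | i j where "i \<in> S" "j \<in> S" "q i j = 1" "x = [(i, True), (j, True), (i, True)]"
        "y = [(j, True), (i, True), (j, True)]"
    by (auto simp: relations_def)
  then show ?case
  proof cases
    case 1
    then show ?thesis using pres_relation.prems by (simp add: act_def reflect_products)
  next
    \<comment> \<open>The defining relations do not exclude \<open>i = j\<close>; in that case both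
      sides are the same word.\<close>
    case 2
    then show ?thesis
      using reflect_commute[OF pres_relation.prems 2(1,2)] by (cases "i = j") (simp_all add: act_def)
  next
    case 3
    then show ?thesis
      using reflect_braid[OF pres_relation.prems 3(1,2)] by (cases "i = j") (simp_all add: act_def)
  qed
qed auto

lemma act_pos: "act (pos u) J = foldr reflect u J"
  by (induction u) (auto simp: act_def)

lemma T_products: "T \<in> products"
  unfolding products_def by (rule image_eqI[of _ _ "[]"]) auto

lemma square_equiv: "i \<in> S \<Longrightarrow> [(i, True), (i, True)] \<approx> []"
  by (rule pres_relation) (auto simp: relations_def)

lemma braid_step_equiv: "braid_step q u v \<Longrightarrow> u \<in> lists S \<Longrightarrow> pos u \<approx> pos v"
proof (induction rule: braid_step.induct)
  case (commute i j x y)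
  have "[(i, True), (j, True)] \<approx> [(j, True), (i, True)]"
    using commute by (intro pres_relation) (auto simp: relations_def)
  moreover have "pos x \<approx> pos x" "pos y \<approx> pos y" using commute by (auto intro!: pres_refl)
  ultimately have "pos x @ [(i, True), (j, True)] @ pos y \<approx> pos x @ [(j, True), (i, True)] @ pos y"
    by (intro pres_append)
  then show ?case by simp
next
  case (braid i j x y)
  have "[(i, True), (j, True), (i, True)] \<approx> [(j, True), (i, True), (j, True)]"
    using braid by (intro pres_relation) (auto simp: relations_def)
  moreover have "pos x \<approx> pos x" "pos y \<approx> pos y" using braid by (auto intro!: pres_refl)
  ultimately have "pos x @ [(i, True), (j, True), (i, True)] @ pos y
      \<approx> pos x @ [(j, True), (i, True), (j, True)] @ pos y"
    by (intro pres_append)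
  then show ?case by simp
qed

lemma braids_equiv: "u \<sim> v \<Longrightarrow> u \<in> lists S \<Longrightarrow> pos u \<approx> pos v"
proof (induction rule: rtranclp_induct)
  case base
  then show ?case using pos_lists by (blast intro: pres_refl)
next
  case (step v w)
  then have "pos v \<approx> pos w" using braid_step_equiv braids_lists by blast
  then show ?case using step by (blast intro: pres_trans)
qed

definition reduced :: "'v list \<Rightarrow> bool" where
  "reduced u \<longleftrightarrow> u \<in> lists S \<and> (\<forall>v\<in>lists S. pos u \<approx> pos v \<longrightarrow> length u \<le> length v)"

text \<open>In the group a doubled letter cancels altogether, so a word that braids to one with a
  doubled letter is not shortest.\<close>

lemma reduced_free:
  assumes "reduced u"
  shows "free u"
proof (rule ccontr)
  have u: "u \<in> lists S" using assms by (simp add: reduced_def)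
  assume "\<not> free u"
  then obtain x j y where b: "u \<sim> x @ [j, j] @ y" unfolding braid_free_def by blast
  have m: "x @ [j, j] @ y \<in> lists S" using braids_lists[OF b u] .
  then have "pos x \<approx> pos x" "pos y \<approx> pos y" by (auto intro!: pres_refl)
  moreover have "[(j, True), (j, True)] \<approx> []" using m square_equiv by simp
  ultimately have "pos x @ [(j, True), (j, True)] @ pos y \<approx> pos x @ [] @ pos y"
    by (intro pres_append)
  then have "pos u \<approx> pos (x @ y)" using braids_equiv[OF b u] by (simp add: pres_trans)
  moreover have "x @ y \<in> lists S" using m by simp
  ultimately have "length u \<le> length (x @ y)" using assms unfolding reduced_def by blast
  then show False using braids_length[OF b] by simp
qed

lemma pos_exists: "x \<in> lists (S \<times> UNIV) \<Longrightarrow> x \<approx> pos (map fst x)"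
proof (induction x)
  case Nil
  then show ?case by (simp add: pres_refl)
next
  case (Cons p x)
  obtain i b where p: "p = (i, b)" by force
  then have i: "i \<in> S" using Cons by simp
  have "[(i, b)] \<approx> [(i, True)]"
  proof (cases b)
    case True
    then show ?thesis using i by (simp add: pres_refl)
  next
    case False
    have s: "[(i, True)] \<approx> [(i, True)]" "[(i, False)] \<approx> [(i, False)]" using i by (auto intro: pres_refl)
    have "[(i, False)] @ [(i, True), (i, True)] \<approx> [(i, False)] @ []"
      by (rule pres_append[OF s(2) square_equiv[OF i]])
    then have 1: "[(i, False)] \<approx> [(i, False), (i, True), (i, True)]" by (simp add: pres_sym)
    have "[(i, False), (i, True)] \<approx> []" using pres_inverse[OF i, of relations False] by simp
    then have "[(i, False), (i, True)] @ [(i, True)] \<approx> [] @ [(i, True)]" using s(1) by (rule pres_append)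
    then show ?thesis using 1 False by (auto intro: pres_trans)
  qed
  then have "[p] @ x \<approx> [(i, True)] @ pos (map fst x)"
    using Cons p by (intro pres_append) auto
  then show ?case by (simp add: p)
qed

lemma reduced_exists:
  assumes "x \<in> lists (S \<times> UNIV)"
  obtains u where "reduced u" "x \<approx> pos u"
proof -
  let ?P = "\<lambda>u. u \<in> lists S \<and> x \<approx> pos u"
  have "map fst x \<in> lists S" using assms by (force simp: in_lists_conv_set)
  then have "?P (map fst x)" using pos_exists[OF assms] by blast
  then obtain u where u: "?P u" "\<forall>v. ?P v \<longrightarrow> length u \<le> length v"
    using ex_has_least_nat[of ?P "map fst x" length] by blast
  then have "reduced u" using pres_trans by (fastforce simp: reduced_def)
  then show thesis using that u by blast
qed

text \<open>The value at a class is the result of letting any representative act on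
  \<open>T\<close>; that the action respects the relations makes this well defined. For injectivity,
  equal ideals of braid-free words give braid equivalent words by \<open>word_inj\<close>, and these
  are equal in the group.\<close>

theorem presented_bijection:
  "\<exists>F. bij_betw F (carrier (presented_group S relations)) products \<and>
    (\<forall>u. reduced u \<longrightarrow> F (Collect (presented_eq S relations (pos u))) = foldr D u T)"
proof -
  define F where "F = (\<lambda>w :: 'v gword set. act (SOME x. x \<in> w) T)"
  have F: "F (Collect (presented_eq S relations x)) = act x T" if "x \<in> lists (S \<times> UNIV)" for x
  proof -
    have "(SOME y. y \<in> Collect (presented_eq S relations x)) \<in> Collect (presented_eq S relations x)"
      using pres_refl[OF that] by (intro someI[of "\<lambda>y. y \<in> Collect (presented_eq S relations x)"]) simp
    then have "x \<approx> (SOME y. y \<in> Collect (presented_eq S relations x))" by (rule CollectD)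
    then show ?thesis unfolding F_def using act_equiv T_products by metis
  qed
  have Fu: "F (Collect (presented_eq S relations (pos u))) = foldr D u T" if "free u" "u \<in> lists S" for u
    using F[OF pos_lists[OF that(2)]] reflect_free[OF that] by (simp add: act_pos)
  have represent: "\<exists>u. reduced u \<and> w = Collect (presented_eq S relations (pos u))"
    if "w \<in> carrier (presented_group S relations)" for w
  proof -
    obtain x where x: "x \<in> lists (S \<times> UNIV)" "w = Collect (presented_eq S relations x)"
      using \<open>w \<in> _\<close> unfolding presented_carrier by blast
    obtain u where u: "reduced u" "x \<approx> pos u" using reduced_exists[OF x(1)] by blast
    then have "pos u \<in> lists (S \<times> UNIV)" by (auto simp: reduced_def)
    then show ?thesis using u x(2) presented_class_eq_iff by metis
  qed
  have "bij_betw F (carrier (presented_group S relations)) products"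
    unfolding bij_betw_def
  proof (intro conjI inj_onI)
    fix w w' assume w: "w \<in> carrier (presented_group S relations)" "w' \<in> carrier (presented_group S relations)"
      and eq: "F w = F w'"
    obtain u where u: "reduced u" "w = Collect (presented_eq S relations (pos u))" using represent w(1) by blast
    obtain v where v: "reduced v" "w' = Collect (presented_eq S relations (pos v))" using represent w(2) by blast
    have uv: "free u" "u \<in> lists S" "free v" "v \<in> lists S"
      using u v reduced_free by (auto simp: reduced_def)
    then have "u \<sim> v" using word_inj eq Fu u(2) v(2) by simp
    then have "pos u \<approx> pos v" using braids_equiv uv by blast
    then show "w = w'" using u(2) v(2) presented_class_eq_iff[OF pos_lists[OF uv(4)]] by blast
  next
    show "F ` carrier (presented_group S relations) = products"
    proof (intro subset_antisym subsetI)
      fix J assume "J \<in> F ` carrier (presented_group S relations)"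
      then obtain u where u: "reduced u" "J = F (Collect (presented_eq S relations (pos u)))"
        using represent by blast
      then have "u \<in> lists S" "J = foldr D u T" using Fu reduced_free by (auto simp: reduced_def)
      then show "J \<in> products" by (auto simp: products_def)
    next
      fix J assume "J \<in> products"
      then obtain u where u: "free u" "u \<in> lists S" "J = foldr D u T" by (rule productsE)
      then have "J = F (Collect (presented_eq S relations (pos u)))" using Fu by simp
      moreover have "Collect (presented_eq S relations (pos u)) \<in> carrier (presented_group S relations)"
        unfolding presented_carrier using pos_lists[OF u(2)] by blast
      ultimately show "J \<in> F ` carrier (presented_group S relations)" by blast
    qed
  qed
  moreover have "F (Collect (presented_eq S relations (pos u))) = foldr D u T" if "reduced u" for u
    using Fu[OF reduced_free[OF that]] that by (simp add: reduced_def)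
  ultimately show ?thesis by blast
qed

end

section \<open>The double quiver\<close>

definition opposite :: "'a + 'a \<Rightarrow> 'a + 'a" where "opposite = case_sum Inr Inl"

definition arrow_sign :: "'a + 'a \<Rightarrow> 'k :: field" where "arrow_sign = case_sum (\<lambda>_. 1) (\<lambda>_. - 1)"

lemma double_quiver_simps:
  "verts (double_quiver Q) = verts Q" "arcs (double_quiver Q) = arcs Q <+> arcs Q"
  "tail (double_quiver Q) = case_sum (tail Q) (head Q)" "head (double_quiver Q) = case_sum (head Q) (tail Q)"
  by (simp_all add: double_quiver_def)

lemma acyclic_no_loop:
  assumes "fin_digraph Q" "\<not> (\<exists>p. pre_digraph.cycle Q p)" "a \<in> arcs Q"
  shows "tail Q a \<noteq> head Q a"
proof
  interpret fin_digraph Q by (rule assms(1))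
  assume "tail Q a = head Q a"
  then have "cycle [a]" using assms(3) by (auto simp: cycle_def awalk_def)
  then show False using assms(2) by blast
qed

lemma doubled_digraph_double_quiver:
  assumes "fin_digraph Q" "\<not> (\<exists>p. pre_digraph.cycle Q p)"
  shows "doubled_digraph (double_quiver Q) opposite (arrow_sign :: _ \<Rightarrow> 'k :: field)"
proof -
  interpret Q: fin_digraph Q by (rule assms(1))
  note nl = acyclic_no_loop[OF assms]
  show ?thesis
    by unfold_locales
      (auto simp: double_quiver_simps opposite_def arrow_sign_def nl nl[symmetric] split: sum.splits)
qed

lemma (in doubled_digraph) finsum_R:
  "finite X \<Longrightarrow> (\<And>x. x \<in> X \<Longrightarrow> f x \<in> polys) \<Longrightarrow> finsum R f X = (\<Sum>x\<in>X. f x)"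
proof (induction X rule: finite_induct)
  case empty
  interpret ring R by (rule ring_path_algebra)
  show ?case by (simp only: finsum_empty R_simps sum.empty)
next
  case (insert x X)
  interpret ring R by (rule ring_path_algebra)
  have "f \<in> X \<rightarrow> carrier R" "f x \<in> carrier R" using insert.prems by (auto simp: R_simps)
  then have "finsum R f (insert x X) = f x \<oplus>\<^bsub>R\<^esub> finsum R f X"
    using insert.hyps by (intro finsum_insert)
  also have "finsum R f X = (\<Sum>x\<in>X. f x)" using insert.IH insert.prems by blast
  also have "f x \<oplus>\<^bsub>R\<^esub> (\<Sum>x\<in>X. f x) = (\<Sum>x\<in>insert x X. f x)"
    unfolding R_simps by (rule sum.insert[OF insert.hyps, symmetric])
  finally show ?case .
qed

lemma preprojective_relation_relator:
  assumes "doubled_digraph (double_quiver Q) opposite (arrow_sign :: _ \<Rightarrow> 'k :: field)"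
  shows "(preprojective_relation Q :: ('v, 'a, 'k) double_path_elem)
    = doubled_digraph.relator (double_quiver Q) opposite arrow_sign"
proof -
  interpret doubled_digraph "double_quiver Q" opposite "arrow_sign :: _ \<Rightarrow> 'k" by (rule assms)
  have fin: "finite (arcs Q)" using finite_arcs by (simp add: double_quiver_simps finite_Plus_iff)
  let ?x = "\<lambda>b. arrow_elem (double_quiver Q) (Inl b) :: ('v, 'a, 'k) double_path_elem"
    and ?y = "\<lambda>b. arrow_elem (double_quiver Q) (Inr b) :: ('v, 'a, 'k) double_path_elem"
  have p: "?x b \<in> polys" "?y b \<in> polys" if "b \<in> arcs Q" for b
    using that by (auto intro!: arrow_elem_polys simp: double_quiver_simps)
  have t: "(?x b \<otimes>\<^bsub>R\<^esub> ?y b) \<ominus>\<^bsub>R\<^esub> (?y b \<otimes>\<^bsub>R\<^esub> ?x b) = conv (?x b) (?y b) - conv (?y b) (?x b)"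
    if "b \<in> arcs Q" for b
    unfolding R_simps using p[OF that] by (intro R_minus polys_conv)
  have q: "(?x b \<otimes>\<^bsub>R\<^esub> ?y b) \<ominus>\<^bsub>R\<^esub> (?y b \<otimes>\<^bsub>R\<^esub> ?x b) \<in> polys" if "b \<in> arcs Q" for b
    unfolding t[OF that] diff_conv_add_uminus
    using p[OF that] by (intro polys_add polys_closed polys_conv)
  have "preprojective_relation Q = (\<Sum>b\<in>arcs Q. (?x b \<otimes>\<^bsub>R\<^esub> ?y b) \<ominus>\<^bsub>R\<^esub> (?y b \<otimes>\<^bsub>R\<^esub> ?x b))"
    unfolding preprojective_relation_def Let_def by (rule finsum_R[OF fin q])
  also have "\<dots> = (\<Sum>b\<in>arcs Q. conv (?x b) (?y b) + - conv (?y b) (?x b))"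
    by (rule sum.cong) (simp_all add: t)
  also have "\<dots> = (\<Sum>b\<in>arcs Q. conv (?x b) (?y b)) + (\<Sum>b\<in>arcs Q. - conv (?y b) (?x b))"
    by (rule sum.distrib)
  also have "\<dots> = relator"
  proof -
    have one: "scale 1 f = f" for f :: "('v, 'a, 'k) double_path_elem" by (simp add: fun_eq_iff scale_apply)
    have "relator = (\<Sum>b\<in>arcs Q. scale (arrow_sign (Inl b)) (conv (?x b) (arrow_elem (double_quiver Q) (opposite (Inl b)))))
       + (\<Sum>b\<in>arcs Q. scale (arrow_sign (Inr b)) (conv (?y b) (arrow_elem (double_quiver Q) (opposite (Inr b)))))"
      unfolding relator_def double_quiver_simps(2) sum.Plus[OF fin fin] comp_def ..
    then show ?thesis by (simp only: arrow_sign_def opposite_def sum.case one scale_minus_one)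
  qed
  finally show ?thesis .
qed

context
  fixes Q :: "('v, 'a) pre_digraph"
  assumes Q: "doubled_digraph (double_quiver Q) opposite (arrow_sign :: _ \<Rightarrow> 'k :: field)"
begin

interpretation doubled_digraph "double_quiver Q" opposite "arrow_sign :: _ \<Rightarrow> 'k" by (rule Q)

lemma preprojective_ideal_eq: "preprojective_ideal Q = rel_ideal"
  unfolding preprojective_ideal_def preprojective_relation_relator[OF Q] by (rule genideal_relator)

lemma preprojective_algebra_eq: "preprojective_algebra Q = A"
  unfolding preprojective_algebra_def A_def preprojective_ideal_eq ..

lemma to_preprojective_eq: "to_preprojective Q x = proj x"
  unfolding to_preprojective_def proj_def preprojective_ideal_eq ..

lemma arrow_ideal_eq: "arrow_ideal Q = arrows"
  unfolding arrow_ideal_def arrows_def preprojective_algebra_eq to_preprojective_eq ..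

lemma completed_eq: "completed_preprojective_algebra Q = L"
  unfolding completed_preprojective_algebra_def L_def preprojective_algebra_eq arrow_ideal_eq ..

lemma vertex_ideal_eq:
  assumes "i \<in> verts Q"
  shows "vertex_ideal Q i = vert_ideal i"
proof -
  have "(path_elem (i, []) :: ('v, 'a, 'k) double_path_elem) \<in> polys"
    using assms by (intro path_elem_polys) (simp add: paths_Nil double_quiver_simps)
  then have "vertex_idempotent Q i = \<phi> (path_elem (i, []))"
    unfolding vertex_idempotent_def to_completion_def preprojective_algebra_eq arrow_ideal_eq
      to_preprojective_eq by (simp add: \<phi>_polys cls_def)
  then show ?thesis unfolding vertex_ideal_def vert_ideal_def completed_eq Let_def by simp
qed

lemma ideal_word_eq: "u \<in> lists (verts Q) \<Longrightarrow> ideal_word Q u = word_ideal u"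
proof (induction u)
  case (Cons i u)
  then show ?case
    unfolding ideal_word_def word_ideal_def Let_def completed_eq by (simp add: vertex_ideal_eq)
qed (simp add: ideal_word_def word_ideal_def completed_eq)

text \<open>The arrows from \<open>i\<close> to \<open>j\<close> in the double quiver are those of
  \<open>Q\<close> from \<open>i\<close> to \<open>j\<close> and the opposites of those from
  \<open>j\<close> to \<open>i\<close>. The absence of loops keeps the two sets disjoint even for
  \<open>i = j\<close>.\<close>

lemma links_eq: "M.links i j = num_arrows Q i j"
proof -
  let ?X = "{a \<in> arcs Q. tail Q a = i \<and> head Q a = j}" and ?Y = "{a \<in> arcs Q. tail Q a = j \<and> head Q a = i}"
  have fin: "finite (arcs Q)" using finite_arcs by (simp add: double_quiver_simps finite_Plus_iff)
  have "tail Q a \<noteq> head Q a" if "a \<in> arcs Q" for a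
    using no_loops[of "Inl a"] that by (simp add: double_quiver_simps InlI)
  then have dis: "?X \<inter> ?Y = {}" by auto
  have "{a \<in> arcs (double_quiver Q). tail (double_quiver Q) a = i \<and> head (double_quiver Q) a = j} = ?X <+> ?Y"
    by (auto simp: double_quiver_simps)
  then have "M.links i j = card ?X + card ?Y" using fin by (simp add: M.links_def card_Plus)
  also have "\<dots> = card (?X \<union> ?Y)" using fin dis by (simp add: card_Un_disjoint)
  also have "?X \<union> ?Y = {a \<in> arcs Q. tail Q a = i \<and> head Q a = j \<or> tail Q a = j \<and> head Q a = i}" by blast
  finally show ?thesis by (simp add: num_arrows_def)
qed

lemma ideal_bijection:
  "\<exists>I :: 'v gword set \<Rightarrow> ('v, 'a, 'k) completed_elem set.
    bij_betw I (carrier (coxeter_group Q)) (ideal_products Q) \<and>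
    (\<forall>w \<in> carrier (coxeter_group Q). \<forall>is.
       reduced_expression Q is w \<longrightarrow> I w = ideal_word Q is)"
proof -
  have links: "M.links = num_arrows Q" by (intro ext) (rule links_eq)
  interpret B: braid_operators "verts Q" "num_arrows Q" M.D M.U M.left_ideal UNIV
    using braid_operators unfolding links double_quiver_simps(1) .
  have rel: "coxeter_relations Q = B.relations"
    unfolding coxeter_relations_def B.relations_def ..
  obtain F where F: "bij_betw F (carrier (coxeter_group Q)) B.products"
    and Fred: "\<And>u. B.reduced u \<Longrightarrow> F (Collect (presented_eq (verts Q) B.relations (B.pos u))) = foldr M.D u UNIV"
    using B.presented_bijection unfolding coxeter_group_def rel by blast
  have word: "word_ideal u = \<phi> ` foldr M.D u UNIV" if "u \<in> lists (verts Q)" for u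
    using word_ideal_image[of u] that by (simp add: double_quiver_simps)
  \<comment> \<open>\<open>B.products\<close> contains preimages under \<open>\<phi>\<close>. Taking
    images recovers the ideals of \<Lambda>, and no two products are identified because each is the
    full preimage of its image.\<close>
  have "bij_betw (image \<phi>) B.products (ideal_products Q)"
    unfolding bij_betw_def
  proof (intro conjI inj_onI)
    fix J K assume "J \<in> B.products" "K \<in> B.products" and eq: "\<phi> ` J = \<phi> ` K"
    then obtain u v where "u \<in> lists (verts Q)" "J = foldr M.D u UNIV" "v \<in> lists (verts Q)" "K = foldr M.D v UNIV"
      by (auto simp: B.products_def)
    then show "J = K" using eq word word_ideal_eq_iff[of u v] by (simp add: double_quiver_simps)
  next
    have "ideal_word Q u = \<phi> ` foldr M.D u UNIV" if "u \<in> lists (verts Q)" for u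
      using word[OF that] ideal_word_eq[OF that] by simp
    then show "image \<phi> ` B.products = ideal_products Q"
      unfolding B.products_def ideal_products_def image_image by (intro image_cong) auto
  qed
  then have "bij_betw (image \<phi> \<circ> F) (carrier (coxeter_group Q)) (ideal_products Q)"
    by (rule bij_betw_trans[OF F])
  moreover have "(image \<phi> \<circ> F) w = ideal_word Q u" if "reduced_expression Q u w" for w u
  proof -
    have expr: "expression Q v w' \<longleftrightarrow> v \<in> lists (verts Q) \<and>
        w' = Collect (presented_eq (verts Q) B.relations (B.pos v))" for v w'
      unfolding expression_def coxeter_group_def coxeter_gen_def rel 
      using presented_word[of v "verts Q" B.relations] by (cases "v \<in> lists (verts Q)") simp_all
    have u: "u \<in> lists (verts Q)" and w: "w = Collect (presented_eq (verts Q) B.relations (B.pos u))"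
      and min: "\<And>v. expression Q v w \<Longrightarrow> length u \<le> length v"
      using that unfolding reduced_expression_def expr by blast+
    have "length u \<le> length v" if "v \<in> lists (verts Q)" "presented_eq (verts Q) B.relations (B.pos u) (B.pos v)" for v
      using min[of v] that presented_class_eq_iff[OF B.pos_lists[OF that(1)]] unfolding expr w by blast
    then have "B.reduced u" using u by (simp add: B.reduced_def)
    then show ?thesis using Fred word[OF u] ideal_word_eq[OF u] w by simp
  qed
  ultimately show ?thesis by blast
qed

end

theorem theorem2p1p9:
  fixes Q :: "('v, 'a) pre_digraph"
  assumes "fin_digraph Q"
    and "Digraph_Component.connected Q"
    and "\<not> (\<exists>p. pre_digraph.cycle Q p)"
    and "\<not> dynkin Q"
  shows "\<exists>I :: 'v gword set \<Rightarrow> ('v, 'a, 'k :: alg_closed_field) completed_elem set.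
    bij_betw I (carrier (coxeter_group Q)) (ideal_products Q) \<and>
    (\<forall>w \<in> carrier (coxeter_group Q). \<forall>is.
       reduced_expression Q is w \<longrightarrow> I w = ideal_word Q is)"
  by (rule ideal_bijection[OF doubled_digraph_double_quiver[OF assms(1,3)]])

end
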